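(* Assume hypotheses (H1) and (H2) of the context. Suppose that $\mu(y\in Y:\varphi(y)>n)=c(n^{-1}+H(n))$ where $c>0$ and $H(n)=O(n^{-q})$, $q>1$. Let $H_1(x)=[x]^{-1}-x^{-1}+H([x])$ for $x\ge1$ and $H_1(x)=\frac1c$ for $x\in[0,1)$. Then $$(\log n)T_n=c^{-1}\Bigl\{1-\int_0^\infty H_1(x)\,dx\,(\log n)^{-1}+O((\log n)^{-2})\Bigr\}P+O((\log n)^{\frac12}n^{-\frac12})$$ as $n\to\infty$, where the last error term is in the operator norm on $\mathcal{B}$.
   Context: Setting. $(X,\mu)$ is an infinite measure space, $f:X\to X$ a conservative measure preserving map, $Y\subset X$ measurable with $\mu(Y)\in(0,\infty)$, and $\mu$ is rescaled so that $\mu(Y)=1$. Let $\varphi:Y\to\mathbb{Z}^+$, $\varphi(y)=\inf\{n\ge1:f^ny\in Y\}$ (finite a.e.), and $F=f^\varphi:Y\to Y$ the first return map. Let $L:L^1(X)\to L^1(X)$ and $R:L^1(Y)\to L^1(Y)$ be the transfer operators of $f$ and $F$: $\int_XLv\,w\,d\mu=\int_Xv\,w\circ f\,d\mu$ and $\int_YRv\,w\,d\mu=\int_Yv\,w\circ F\,d\mu$ for bounded measurable $w$. For $v$ on $Y$ set $T_nv=1_YL^n(1_Yv)$ ($n\ge0$), $R_nv=R(1_{\{\varphi=n\}}v)$ ($n\ge1$), and $R(z)v=R(z^\varphi v)=\sum_{n\ge1}z^nR_nv$ for $z\in\bar{\mathbb{D}}=\{z\in\mathbb{C}:|z|\le1\}$.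 $\mathcal{B}\subset L^\infty(Y)$ is a (real) Banach space of functions containing the constants with norm satisfying $|v|_\infty\le\|v\|$ (complexified when $z$ is complex), such that: (H1) there is $C>0$ such that for all $n\ge1$, $R_n:\mathcal{B}\to\mathcal{B}$ is bounded with $\|R_n\|\le C\mu(\varphi=n)$. (H2) (i) the eigenvalue $1$ is simple and isolated in the spectrum of $R(1):\mathcal{B}\to\mathcal{B}$; (ii) for $z\in\bar{\mathbb{D}}\setminus\{1\}$ the spectrum of $R(z):\mathcal{B}\to\mathcal{B}$ does not contain $1$. $P$ is the spectral projection of $R(1)$ for the eigenvalue $1$: $Pv\equiv\int_Yv\,d\mu$. $[x]$ denotes the integer part of $x$. *)

theory Defs
  imports
    "HOL-Probability.Essential_Supremum"
    "HOL-Analysis.Analysis"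
    "HOL-Library.Landau_Symbols"
begin

subsection \<open>Measure preserving maps, first returns and transfer operators\<close>

definition measure_preserving_map :: "'a measure \<Rightarrow> ('a \<Rightarrow> 'a) \<Rightarrow> bool" where
  "measure_preserving_map M f \<longleftrightarrow>
     f \<in> measurable M M \<and>
     (\<forall>A\<in>sets M. emeasure M (f -` A \<inter> space M) = emeasure M A)"

text \<open>Conservativity: every wandering set is null.\<close>

definition conservative :: "'a measure \<Rightarrow> ('a \<Rightarrow> 'a) \<Rightarrow> bool" where
  "conservative M f \<longleftrightarrow>
     (\<forall>W\<in>sets M. disjoint_family (\<lambda>n. (f ^^ n) -` W \<inter> space M) \<longrightarrow> W \<in> null_sets M)"

text \<open>
  On the set of points of \<open>Y\<close> that never return to \<open>Y\<close> (a null set when the map is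
  conservative and measure preserving) the infimum is that of the empty set, hence \<open>0\<close>.
\<close>

definition first_return_time :: "('a \<Rightarrow> 'a) \<Rightarrow> 'a set \<Rightarrow> 'a \<Rightarrow> nat" where
  "first_return_time f Y y = Inf {n. n \<ge> 1 \<and> (f ^^ n) y \<in> Y}"

definition first_return_map :: "('a \<Rightarrow> 'a) \<Rightarrow> 'a set \<Rightarrow> 'a \<Rightarrow> 'a" where
  "first_return_map f Y y = (f ^^ first_return_time f Y y) y"

text \<open>
  Operators on \<open>L\<^sup>1\<close> are represented by operators on integrable functions.  The duality
  relation determines \<open>U v\<close> almost everywhere from the almost-everywhere class of \<open>v\<close>.
\<close>

definition transfer_operator ::
    "'a measure \<Rightarrow> ('a \<Rightarrow> 'a) \<Rightarrow> (('a \<Rightarrow> real) \<Rightarrow> ('a \<Rightarrow> real)) \<Rightarrow> bool" where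
  "transfer_operator M g U \<longleftrightarrow>
     (\<forall>v. integrable M v \<longrightarrow>
        integrable M (U v) \<and>
        (\<forall>w\<in>borel_measurable M. bounded (w ` space M) \<longrightarrow>
           (\<integral>x. U v x * w x \<partial>M) = (\<integral>x. v x * w (g x) \<partial>M)))"

subsection \<open>Banach spaces of bounded functions\<close>

text \<open>
  A Banach space contained in \<open>L\<^sup>\<infinity>(N)\<close>, with norm dominating the \<open>L\<^sup>\<infinity>\<close> norm, is
  a Banach space \<open>'b\<close> together with a choice \<open>\<iota> v\<close> of a representative function for each \<open>v\<close>;
  linearity and injectivity of \<open>\<iota>\<close> are understood modulo null sets.
\<close>

definition Linfty_subspace :: "'a measure \<Rightarrow> ('b::banach \<Rightarrow> 'a \<Rightarrow> real) \<Rightarrow> bool" where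
  "Linfty_subspace N \<iota> \<longleftrightarrow>
     (\<forall>v. \<iota> v \<in> borel_measurable N) \<and>
     (\<forall>u v. AE y in N. \<iota> (u + v) y = \<iota> u y + \<iota> v y) \<and>
     (\<forall>r v. AE y in N. \<iota> (r *\<^sub>R v) y = r * \<iota> v y) \<and>
     (\<forall>u v. (AE y in N. \<iota> u y = \<iota> v y) \<longrightarrow> u = v) \<and>
     (\<forall>v. esssup N (\<lambda>y. ereal \<bar>\<iota> v y\<bar>) \<le> ereal (norm v))"

definition contains_constants :: "'a measure \<Rightarrow> ('b \<Rightarrow> 'a \<Rightarrow> real) \<Rightarrow> bool" where
  "contains_constants N \<iota> \<longleftrightarrow> (\<forall>r. \<exists>v. AE y in N. \<iota> v y = r)"

text \<open>The operator \<open>U\<close> on functions maps the space into itself and acts there as \<open>A\<close>.\<close>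

definition acts_as ::
    "'a measure \<Rightarrow> ('b::banach \<Rightarrow> 'a \<Rightarrow> real) \<Rightarrow> (('a \<Rightarrow> real) \<Rightarrow> ('a \<Rightarrow> real)) \<Rightarrow>
       ('b \<Rightarrow>\<^sub>L 'b) \<Rightarrow> bool" where
  "acts_as N \<iota> U A \<longleftrightarrow> (\<forall>v. AE y in N. \<iota> (blinfun_apply A v) y = U (\<iota> v) y)"

subsection \<open>Complexification and spectrum\<close>

text \<open>
  The complexification of a real Banach space \<open>'b\<close> is \<open>'b \<times> 'b\<close>, the pair \<open>(u, v)\<close> standing for
  \<open>u + i v\<close>.  The product norm is equivalent to the usual complexification norms, so that
  bounded invertibility, spectra and spectral projections do not depend on this choice.
\<close>

definition cscale :: "complex \<Rightarrow> ('b \<times> 'b) \<Rightarrow>\<^sub>L ('b::banach \<times> 'b)" where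
  "cscale z = Blinfun (\<lambda>(u, v). (Re z *\<^sub>R u - Im z *\<^sub>R v, Im z *\<^sub>R u + Re z *\<^sub>R v))"

lemma cscale_apply:
  "blinfun_apply (cscale z) (u, v) = (Re z *\<^sub>R u - Im z *\<^sub>R v, Im z *\<^sub>R u + Re z *\<^sub>R v)"
proof -
  have "bounded_linear (\<lambda>p :: 'a \<times> 'a.
      (Re z *\<^sub>R fst p - Im z *\<^sub>R snd p, Im z *\<^sub>R fst p + Re z *\<^sub>R snd p))"
    by (intro bounded_linear_intros)
  then show ?thesis
    by (simp add: cscale_def case_prod_unfold bounded_linear_Blinfun_apply)
qed

definition complexify :: "('b::banach \<Rightarrow>\<^sub>L 'b) \<Rightarrow> ('b \<times> 'b) \<Rightarrow>\<^sub>L ('b \<times> 'b)" where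
  "complexify A = Blinfun (\<lambda>(u, v). (blinfun_apply A u, blinfun_apply A v))"

lemma complexify_apply:
  "blinfun_apply (complexify A) (u, v) = (blinfun_apply A u, blinfun_apply A v)"
proof -
  have "bounded_linear (\<lambda>p :: 'a \<times> 'a. (blinfun_apply A (fst p), blinfun_apply A (snd p)))"
    by (intro bounded_linear_intros)
  then show ?thesis
    by (simp add: complexify_def case_prod_unfold bounded_linear_Blinfun_apply)
qed

definition is_inverse ::
    "('c::real_normed_vector \<Rightarrow>\<^sub>L 'c) \<Rightarrow> ('c \<Rightarrow>\<^sub>L 'c) \<Rightarrow> bool" where
  "is_inverse A S \<longleftrightarrow> A o\<^sub>L S = id_blinfun \<and> S o\<^sub>L A = id_blinfun"

definition spectrum :: "(('b::banach \<times> 'b) \<Rightarrow>\<^sub>L ('b \<times> 'b)) \<Rightarrow> complex set" where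
  "spectrum A = {\<alpha>. \<not> (\<exists>S. is_inverse (cscale \<alpha> - A) S)}"

definition resolvent ::
    "(('b::banach \<times> 'b) \<Rightarrow>\<^sub>L ('b \<times> 'b)) \<Rightarrow> complex \<Rightarrow> ('b \<times> 'b) \<Rightarrow>\<^sub>L ('b \<times> 'b)" where
  "resolvent A \<alpha> = (THE S. is_inverse (cscale \<alpha> - A) S)"

definition eigenvalue :: "(('b::banach \<times> 'b) \<Rightarrow>\<^sub>L ('b \<times> 'b)) \<Rightarrow> complex \<Rightarrow> bool" where
  "eigenvalue A \<alpha> \<longleftrightarrow> (\<exists>w. w \<noteq> 0 \<and> blinfun_apply A w = blinfun_apply (cscale \<alpha>) w)"

text \<open>
  \<open>Q\<close> is the spectral (Riesz) projection \<open>(2 \<pi> i)\<^sup>-\<^sup>1 \<integral> (\<zeta> - A)\<^sup>-\<^sup>1 d\<zeta>\<close>, the integral being over a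
  circle \<open>\<zeta> = \<alpha> + r e\<^sup>i\<^sup>t\<close> that separates \<open>\<alpha>\<close> from the rest of the spectrum; there
  \<open>d\<zeta> = i r e\<^sup>i\<^sup>t dt\<close>.
\<close>

definition spectral_projection ::
    "(('b::banach \<times> 'b) \<Rightarrow>\<^sub>L ('b \<times> 'b)) \<Rightarrow> complex \<Rightarrow> (('b \<times> 'b) \<Rightarrow>\<^sub>L ('b \<times> 'b)) \<Rightarrow> bool" where
  "spectral_projection A \<alpha> Q \<longleftrightarrow>
     (\<exists>r>0. spectrum A \<inter> cball \<alpha> r = {\<alpha>} \<and>
        ((\<lambda>t. (1 / (2 * pi)) *\<^sub>R
            (cscale (of_real r * cis t) o\<^sub>L resolvent A (\<alpha> + of_real r * cis t)))
          has_integral Q) {0..2 * pi})"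

text \<open>
  Simplicity of an isolated eigenvalue means algebraic multiplicity one: the range of its
  spectral projection is one-dimensional over the complex numbers.
\<close>

definition simple_isolated_eigenvalue ::
    "(('b::banach \<times> 'b) \<Rightarrow>\<^sub>L ('b \<times> 'b)) \<Rightarrow> complex \<Rightarrow> bool" where
  "simple_isolated_eigenvalue A \<alpha> \<longleftrightarrow>
     eigenvalue A \<alpha> \<and> \<alpha> isolated_in spectrum A \<and>
     (\<exists>Q w. spectral_projection A \<alpha> Q \<and> w \<noteq> 0 \<and>
        range (blinfun_apply Q) = range (\<lambda>a. blinfun_apply (cscale a) w))"

text \<open>\<open>R(z) = \<Sum>\<^sub>n\<^sub>\<ge>\<^sub>1 z\<^sup>n R\<^sub>n\<close> on the complexification.\<close>

definition power_series_operator ::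
    "(nat \<Rightarrow> ('b::banach \<Rightarrow>\<^sub>L 'b)) \<Rightarrow> complex \<Rightarrow> ('b \<times> 'b) \<Rightarrow>\<^sub>L ('b \<times> 'b)" where
  "power_series_operator Rn z = (\<Sum>n. cscale (z ^ Suc n) o\<^sub>L complexify (Rn (Suc n)))"

subsection \<open>The correction to the tail\<close>

definition tail_correction :: "real \<Rightarrow> (nat \<Rightarrow> real) \<Rightarrow> real \<Rightarrow> real" where
  "tail_correction c H x =
     (if x \<ge> 1 then 1 / of_int \<lfloor>x\<rfloor> - 1 / x + H (nat \<lfloor>x\<rfloor>) else 1 / c)"

end

theory Submission
  imports Defs "HOL-Probability.Probability" "HOL-Real_Asymp.Real_Asymp" "HOL-Computational_Algebra.Formal_Power_Series"
begin

text \<open>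
  Decomposing an orbit segment that starts and ends in \<open>Y\<close> at its first return gives the
  renewal equation \<open>T\<^sub>n = \<Sum>\<^sub>k T\<^sub>n\<^sub>-\<^sub>k R\<^sub>k\<close>, so that \<open>\<Sum>\<^sub>n z\<^sup>n T\<^sub>n = (1 - R(z))\<^sup>-\<^sup>1\<close> in the open unit disc
  (\<open>renewal_op_acts_as\<close>, \<open>gen_T\<close>); that the series converges there is a lemma of Wiener type
  (\<open>summable_renewal_seq\<close>). The only singularity on the closed disc is \<open>z = 1\<close>, and it sits in
  the direction of the rank one projection \<open>P\<close>, where \<open>P R\<^sub>n P = \<mu>(\<phi> = n) P\<close>. The proof
  therefore splits into an operator part, which replaces \<open>T\<^sub>n\<close> by a scalar sequence times \<open>P\<close>,
  and a probabilistic part, which determines the scalar sequence.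

  Operator part. Let \<open>u\<close> be the scalar renewal sequence of the distribution \<open>f\<^sub>n = \<mu>(\<phi> = n)\<close>,
  with generating function \<open>1 / (1 - \<psi>(z))\<close>. Since \<open>\<mu>(\<phi> > n) = O(1/n)\<close>, both \<open>R(z)\<close> and \<open>\<psi>(z)\<close>
  have modulus of continuity \<open>x log (1/x)\<close> (\<open>power_modulus\<close>), while \<open>|1 - \<psi>(z)|\<close> is bounded
  below by a multiple of the same function at \<open>x = |1 - z|\<close> (\<open>one_minus_psi_lower_bound\<close>).
  These two matching estimates make \<open>(1 - R(z))\<^sup>-\<^sup>1 - (1 - \<psi>(z))\<^sup>-\<^sup>1 P\<close> bounded
  (\<open>res_diff_bounded\<close>), and give it oscillation at most \<open>h log (1/h) / (|1 - z| log |1 - z|)\<^sup>2\<close>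
  under a rotation by \<open>h\<close>. Shifting the integration variable in the Fourier coefficient by
  \<open>\<pi> / n\<close> then yields \<open>\<parallel>T\<^sub>n - u\<^sub>n P\<parallel> = O((n log n)\<^sup>-\<^sup>1\<^sup>/\<^sup>2)\<close> (\<open>coefficient_decay\<close>,
  \<open>renewal_seq_approx\<close>), which is the operator error term after multiplication by \<open>log n\<close>.

  Scalar part. Write \<open>1 - \<psi>(z) = (1 - z) c (1/c - log (1 - z) + \<Sum>\<^sub>n H(n) z\<^sup>n)\<close>. Freezing the
  last series at \<open>z = 1\<close> leads to \<open>1 / ((1 - z) (a - log (1 - z)))\<close> with \<open>a = 1/c + \<Sum>\<^sub>n H(n)\<close>.
  Up to a harmless term this is \<open>\<integral> e\<^sup>-\<^sup>a\<^sup>s (1 - z)\<^sup>s\<^sup>-\<^sup>1 ds\<close> over \<open>[0, 1]\<close>, whose coefficients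
  \<open>v\<^sub>n = \<integral> e\<^sup>-\<^sup>a\<^sup>s \<Prod>\<^sub>k\<^sub>\<le>\<^sub>n (1 - s/k) ds\<close> are explicit: they satisfy an exact renewal equation
  (\<open>model_seq_renewal\<close>) and equal \<open>1 / (a + h\<^sub>n)\<close> up to a relative error \<open>O(log\<^sup>-\<^sup>2 n)\<close>, \<open>h\<^sub>n\<close>
  being the harmonic number (\<open>model_seq_asymp\<close>). The error made by freezing is controlled
  because \<open>v / c = u * \<xi>\<close> for a sequence \<open>\<xi>\<close> of total sum \<open>1\<close> and power decay, and because \<open>u\<close>
  varies slowly; hence \<open>v\<^sub>n / c - u\<^sub>n = O(log\<^sup>-\<^sup>3 n)\<close> (\<open>model_seq_approx\<close>). Together with
  \<open>h\<^sub>n = log n + \<gamma> + O(1/n)\<close> this expands \<open>c u\<^sub>n log n\<close> to second order with the constant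
  \<open>1/c + \<gamma> + \<Sum>\<^sub>n H(n)\<close> (\<open>u_asymptotics\<close>), and that constant is the integral of \<open>H\<^sub>1\<close>, the part
  \<open>[x]\<^sup>-\<^sup>1 - x\<^sup>-\<^sup>1\<close> contributing Euler's constant \<open>\<gamma>\<close> (\<open>integral_tail_correction\<close>).
\<close>

section \<open>Power series with coefficients in a Banach algebra\<close>

text \<open>
  The modulus of continuity \<open>x log (1/x)\<close>, in a form that is increasing on \<open>[0, 2]\<close>, the range
  of distances in the closed unit disc. At \<open>0\<close> the value \<open>0\<close> results from the factor \<open>x\<close>,
  whatever the value of the logarithm.
\<close>

definition ell :: "real \<Rightarrow> real" where
  "ell x = x * (1 + ln (2 / x))"

lemma ell_0 [simp]: "ell 0 = 0"
  by (simp add: ell_def)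

lemma ell_ge_self: "0 \<le> x \<Longrightarrow> x \<le> 2 \<Longrightarrow> x \<le> ell x"
  by (cases "x = 0") (auto simp: ell_def field_simps)

lemma ell_pos: "0 < x \<Longrightarrow> x \<le> 2 \<Longrightarrow> 0 < ell x"
  using ell_ge_self[of x] by linarith

lemma ell_nonneg: "0 \<le> x \<Longrightarrow> x \<le> 2 \<Longrightarrow> 0 \<le> ell x"
  using ell_ge_self[of x] by linarith

lemma ell_mono:
  assumes "0 \<le> x" "x \<le> y" "y \<le> 2"
  shows "ell x \<le> ell y"
proof (cases "x = 0")
  case True
  then show ?thesis using ell_nonneg[of y] assms by simp
next
  case False
  show ?thesis
  proof (rule DERIV_nonneg_imp_nondecreasing[OF assms(2)])
    fix z assume z: "x \<le> z" "z \<le> y"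
    then have "0 < z" "z \<le> 2" using False assms by auto
    then have "(ell has_real_derivative ln (2 / z)) (at z)"
      unfolding ell_def
      by (auto intro!: derivative_eq_intros simp: divide_simps power2_eq_square)
    moreover have "0 \<le> ln (2 / z)"
      using \<open>0 < z\<close> \<open>z \<le> 2\<close> by simp
    ultimately show "\<exists>d. (ell has_real_derivative d) (at z) \<and> 0 \<le> d" by blast
  qed
qed

lemma ell_le_2: "0 \<le> x \<Longrightarrow> x \<le> 2 \<Longrightarrow> ell x \<le> 2"
  using ell_mono[of x 2] by (simp add: ell_def)

lemma ell_half_ge: "0 \<le> x \<Longrightarrow> ell x / 2 \<le> ell (x / 2)"
proof (cases "x = 0")
  case False
  assume "0 \<le> x"
  with False have "0 < x" by simp
  have "2 / (x / 2) = 2 * (2 / x)" by simp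
  then have "ln (2 / (x / 2)) = ln 2 + ln (2 / x)"
    using \<open>0 < x\<close> by (simp only: ln_mult) simp
  then show ?thesis
    using \<open>0 < x\<close> by (simp add: ell_def field_simps)
qed simp

lemma ell_tendsto_0: "(ell \<longlongrightarrow> 0) (at_right 0)"
  unfolding ell_def by real_asymp

text \<open>
  Two Banach algebras with complex scalars are needed: \<open>\<complex>\<close> itself, and the complex-linear
  operators on the complexification of a real Banach space, whose norm is only equivalent to a
  complex one. Both are covered by a real Banach algebra with a central copy \<open>\<sigma>\<close> of \<open>\<complex>\<close>. The
  unit is introduced through \<open>monoid_mult\<close> instead of \<open>ring_1\<close>, since the operators on a
  trivial space violate \<open>0 \<noteq> 1\<close>.
\<close>

locale scalar_algebra =
  fixes \<sigma> :: "complex \<Rightarrow> 'x::{real_normed_algebra, monoid_mult, banach}"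
  assumes scal_linear: "bounded_linear \<sigma>"
    and scal_mult: "\<sigma> (z * w) = \<sigma> z * \<sigma> w"
    and scal_1: "\<sigma> 1 = 1"
    and scal_commute: "x * \<sigma> z = \<sigma> z * x"
begin

interpretation scal: bounded_linear \<sigma> by (rule scal_linear)

lemma scal_left_commute: "x * (\<sigma> z * y) = \<sigma> z * (x * y)"
  by (metis mult.assoc scal_commute)

lemma scal_of_real: "\<sigma> (of_real r) * x = r *\<^sub>R x"
proof -
  have "\<sigma> (of_real r) = r *\<^sub>R \<sigma> 1"
    by (metis scal.scaleR scaleR_conv_of_real mult.right_neutral)
  then show ?thesis by (simp add: scal_1)
qed

definition scal_bound :: real where
  "scal_bound = (SOME K. 1 \<le> K \<and> (\<forall>z x. norm (\<sigma> z * x) \<le> K * (cmod z * norm x)))"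

lemma scal_bound_props: "1 \<le> scal_bound" "norm (\<sigma> z * x) \<le> scal_bound * (cmod z * norm x)"
proof -
  obtain K where K: "K > 0" "\<And>z. norm (\<sigma> z) \<le> cmod z * K"
    using scal.pos_bounded by blast
  have "norm (\<sigma> z * x) \<le> max K 1 * (cmod z * norm x)" for z x
  proof -
    have "norm (\<sigma> z * x) \<le> norm (\<sigma> z) * norm x" by (rule norm_mult_ineq)
    also have "\<dots> \<le> (cmod z * max K 1) * norm x"
      by (intro mult_right_mono order.trans[OF K(2)] mult_left_mono) auto
    finally show ?thesis by (simp add: mult_ac)
  qed
  then have "\<exists>K. 1 \<le> K \<and> (\<forall>z x. norm (\<sigma> z * x) \<le> K * (cmod z * norm x))"
    by (intro exI[of _ "max K 1"]) auto
  from someI_ex[OF this]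
  show "1 \<le> scal_bound" "norm (\<sigma> z * x) \<le> scal_bound * (cmod z * norm x)"
    unfolding scal_bound_def by blast+
qed

definition gen :: "(nat \<Rightarrow> 'x) \<Rightarrow> complex \<Rightarrow> 'x" where
  "gen a z = (\<Sum>n. \<sigma> (z ^ n) * a n)"

lemma summable_gen_norm:
  assumes "summable (\<lambda>n. norm (a n) * r ^ n)" "cmod z \<le> r"
  shows "summable (\<lambda>n. norm (\<sigma> (z ^ n) * a n))"
proof (rule summable_comparison_test')
  show "summable (\<lambda>n. scal_bound * (norm (a n) * r ^ n))"
    using assms(1) by (rule summable_mult)
  fix n
  have "norm (\<sigma> (z ^ n) * a n) \<le> scal_bound * (cmod (z ^ n) * norm (a n))"
    by (rule scal_bound_props)
  also have "\<dots> \<le> scal_bound * (norm (a n) * r ^ n)"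
    using scal_bound_props(1) assms(2)
    by (intro mult_left_mono) (auto simp: norm_power mult.commute[of _ "norm (a n)"] intro!: mult_left_mono power_mono)
  finally show "norm (norm (\<sigma> (z ^ n) * a n)) \<le> scal_bound * (norm (a n) * r ^ n)" by simp
qed

lemma gen_sums:
  assumes "summable (\<lambda>n. norm (a n) * r ^ n)" "cmod z \<le> r"
  shows "(\<lambda>n. \<sigma> (z ^ n) * a n) sums gen a z"
  unfolding gen_def
  by (rule summable_sums[OF summable_norm_cancel[OF summable_gen_norm[OF assms]]])

lemma gen_diff:
  assumes "summable (\<lambda>n. norm (a n) * r ^ n)" "summable (\<lambda>n. norm (b n) * r ^ n)" "cmod z \<le> r"
  shows "gen (\<lambda>n. a n - b n) z = gen a z - gen b z"
  using sums_diff[OF gen_sums[OF assms(1,3)] gen_sums[OF assms(2,3)]]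
  by (simp add: gen_def sums_iff algebra_simps)

lemma gen_mult:
  assumes "summable (\<lambda>n. norm (a n) * r ^ n)" "summable (\<lambda>n. norm (b n) * r ^ n)" "cmod z \<le> r"
  shows "(\<lambda>n. \<sigma> (z ^ n) * (\<Sum>i\<le>n. a i * b (n - i))) sums (gen a z * gen b z)"
proof -
  have "(\<lambda>k. \<Sum>i\<le>k. (\<sigma> (z ^ i) * a i) * (\<sigma> (z ^ (k - i)) * b (k - i)))
        sums ((\<Sum>k. \<sigma> (z ^ k) * a k) * (\<Sum>k. \<sigma> (z ^ k) * b k))"
    by (intro Cauchy_product_sums summable_gen_norm[OF assms(1,3)] summable_gen_norm[OF assms(2,3)])
  moreover have "(\<Sum>i\<le>k. (\<sigma> (z ^ i) * a i) * (\<sigma> (z ^ (k - i)) * b (k - i))) =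
      \<sigma> (z ^ k) * (\<Sum>i\<le>k. a i * b (k - i))" for k
    unfolding sum_distrib_left
  proof (rule sum.cong[OF refl])
    fix i assume "i \<in> {..k}"
    then have "z ^ k = z ^ i * z ^ (k - i)" by (simp flip: power_add)
    then show "(\<sigma> (z ^ i) * a i) * (\<sigma> (z ^ (k - i)) * b (k - i)) = \<sigma> (z ^ k) * (a i * b (k - i))"
      by (simp add: scal_mult mult.assoc scal_left_commute[of "a i"])
  qed
  ultimately show ?thesis by (simp add: gen_def)
qed

lemma has_integral_cis_mult:
  fixes k :: int
  shows "((\<lambda>\<theta>. cis (of_int k * \<theta>)) has_integral (if k = 0 then of_real (2 * pi) else 0)) {-pi..pi}"
proof (cases "k = 0")
  case True
  then show ?thesis
    using has_integral_const_real[of "1::complex" "-pi" pi] by (simp add: scaleR_conv_of_real)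
next
  case False
  have "((\<lambda>\<theta>. cis (of_int k * \<theta>)) has_integral
      (cis (of_int k * pi) / (\<i> * of_int k) - cis (of_int k * (-pi)) / (\<i> * of_int k))) {-pi..pi}"
  proof (rule fundamental_theorem_of_calculus)
    fix x :: real
    have "((\<lambda>z. exp (\<i> * of_int k * z) / (\<i> * of_int k)) has_field_derivative
        exp (\<i> * of_int k * of_real x)) (at (of_real x))"
      using False by (auto intro!: derivative_eq_intros)
    then have "((\<lambda>x. exp (\<i> * of_int k * of_real x) / (\<i> * of_int k)) has_vector_derivative
        exp (\<i> * of_int k * of_real x)) (at x within {-pi..pi})"
      by (rule has_vector_derivative_real_field)
    then show "((\<lambda>x. cis (of_int k * x) / (\<i> * of_int k)) has_vector_derivative cis (of_int k * x)) (at x within {-pi..pi})"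
      by (simp add: cis_conv_exp mult.assoc)
  qed simp
  moreover have "cis (of_int k * pi) = cis (of_int k * (-pi))"
  proof -
    have "cis (of_int k * pi) = cis (of_int k * (-pi)) * cis (2 * pi * of_int k)"
      by (subst cis_mult) (rule arg_cong[where f = cis], simp)
    also have "cis (2 * pi * of_int k) = 1"
      by (rule cis_multiple_2pi) simp
    finally show ?thesis by simp
  qed
  ultimately show ?thesis using False by simp
qed

end

text \<open>
  By \<open>|1 - r e\<^sup>i\<^sup>\<theta>|\<^sup>2 = (1 - r)\<^sup>2 + 4 r sin\<^sup>2(\<theta>/2)\<close> and Jordan's inequality \<open>sin x \<ge> 2 x / \<pi>\<close>. The
  lower bound on \<open>r\<close> is what makes the estimate uniform as \<open>r\<close> tends to \<open>1\<close>.
\<close>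

lemma norm_one_minus_polar_ge:
  assumes "1 / 4 \<le> r" "\<bar>\<theta>\<bar> \<le> pi"
  shows "\<bar>\<theta>\<bar> / pi \<le> cmod (1 - of_real r * cis \<theta>)"
proof -
  define x where "x = \<bar>\<theta>\<bar> / 2"
  have x: "0 \<le> x" "x \<le> pi / 2" using assms by (auto simp: x_def)
  \<comment> \<open>Concavity of the sine on \<open>[0, \<pi>]\<close>, used between \<open>0\<close> and \<open>\<pi>/2\<close>.\<close>
  have sin_ge: "2 * x / pi \<le> sin x"
  proof -
    have "convex_on {0..pi} (\<lambda>x. - sin x)"
      by (rule f''_ge0_imp_convex[where f' = "\<lambda>x. - cos x" and f'' = sin])
         (auto intro!: derivative_eq_intros sin_ge_zero)
    from convex_onD[OF this, of "2 * x / pi" 0 "pi / 2"] x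
    show ?thesis by (simp add: field_simps)
  qed
  have "(\<bar>\<theta>\<bar> / pi)\<^sup>2 = (2 * x / pi)\<^sup>2" by (simp add: x_def)
  also have "\<dots> \<le> (sin x)\<^sup>2"
    using sin_ge x by (intro power_mono) auto
  also have "(sin x)\<^sup>2 = (1 - cos \<theta>) / 2"
  proof -
    have "cos \<theta> = cos (2 * x)" by (simp add: x_def)
    then show ?thesis by (simp add: cos_double_sin)
  qed
  also have "\<dots> \<le> (1 - r)\<^sup>2 + 2 * r * (1 - cos \<theta>)"
  proof -
    have "0 \<le> (2 * r - 1 / 2) * (1 - cos \<theta>)"
      using assms(1) by (intro mult_nonneg_nonneg) auto
    moreover have "(1 - r)\<^sup>2 + 2 * r * (1 - cos \<theta>) - (1 - cos \<theta>) / 2 =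
        (1 - r)\<^sup>2 + (2 * r - 1 / 2) * (1 - cos \<theta>)"
      by (simp add: algebra_simps)
    ultimately show ?thesis using zero_le_power2[of "1 - r"] by linarith
  qed
  also have "\<dots> = (1 - r * cos \<theta>)\<^sup>2 + (r * sin \<theta>)\<^sup>2"
    using sin_cos_squared_add[of \<theta>] by algebra
  also have "\<dots> = (cmod (1 - of_real r * cis \<theta>))\<^sup>2"
    by (simp add: cmod_power2)
  finally show ?thesis by (rule power2_le_imp_le) simp
qed

context scalar_algebra
begin

interpretation scal: bounded_linear \<sigma> by (rule scal_linear)

lemma continuous_on_scal [continuous_intros]:
  "continuous_on S g \<Longrightarrow> continuous_on S (\<lambda>x. \<sigma> (g x))"
  by (rule scal.continuous_on)

lemma Fourier_coefficient:
  assumes summ: "summable (\<lambda>m. norm (a m) * r ^ m)" and r: "0 \<le> r"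
  shows "((\<lambda>\<theta>. \<sigma> (cis (- (real n * \<theta>))) * gen a (of_real r * cis \<theta>))
            has_integral (2 * pi * r ^ n) *\<^sub>R a n) {-pi..pi}"
proof -
  define c where "c m \<theta> = \<sigma> (cis (real_of_int (int m - int n) * \<theta>)) * (r ^ m *\<^sub>R a m)" for m \<theta>
  have c_eq: "c m \<theta> = \<sigma> (cis (- (real n * \<theta>))) * (\<sigma> ((of_real r * cis \<theta>) ^ m) * a m)" for m \<theta>
  proof -
    have D: "(of_real r * cis \<theta>) ^ m = of_real (r ^ m) * cis (real m * \<theta>)"
      by (metis power_mult_distrib Complex.DeMoivre of_real_power)
    have "\<sigma> (cis (- (real n * \<theta>))) * (\<sigma> ((of_real r * cis \<theta>) ^ m) * a m) =
        \<sigma> (cis (- (real n * \<theta>)) * (of_real (r ^ m) * cis (real m * \<theta>))) * a m"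
      unfolding D by (simp only: mult.assoc scal_mult)
    also have "cis (- (real n * \<theta>)) * (of_real (r ^ m) * cis (real m * \<theta>)) =
        cis (real_of_int (int m - int n) * \<theta>) * of_real (r ^ m)"
      by (simp add: cis_mult algebra_simps)
    also have "\<sigma> \<dots> * a m = c m \<theta>"
      unfolding c_def scal_mult mult.assoc scal_of_real ..
    finally show ?thesis ..
  qed
  have c_int: "(c m has_integral (if m = n then (2 * pi * r ^ n) *\<^sub>R a n else 0)) {-pi..pi}" for m
  proof -
    have "bounded_linear (\<lambda>w. \<sigma> w * (r ^ m *\<^sub>R a m))"
      by (intro bounded_linear_mult_const scal_linear)
    from has_integral_linear[OF has_integral_cis_mult[of "int m - int n"] this]
    show ?thesis
      by (cases "m = n") (auto simp: o_def c_def[abs_def] scal_of_real scal.zero mult.commute[of "r ^ n"] simp del: of_real_mult)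
  qed
  have lim: "uniform_limit (cbox (-pi) pi) (\<lambda>N \<theta>. \<Sum>m<N. c m \<theta>)
      (\<lambda>\<theta>. \<Sum>m. c m \<theta>) sequentially"
  proof (rule Weierstrass_m_test)
    show "summable (\<lambda>m. scal_bound * (norm (a m) * r ^ m))"
      using summ by (rule summable_mult)
    fix m \<theta>
    have "norm (c m \<theta>) \<le> scal_bound * (1 * norm (r ^ m *\<^sub>R a m))"
      unfolding c_def using scal_bound_props(2) norm_cis by metis
    then show "norm (c m \<theta>) \<le> scal_bound * (norm (a m) * r ^ m)"
      using r by (simp add: mult_ac)
  qed
  obtain I J where IJ: "\<And>N. ((\<lambda>\<theta>. \<Sum>m<N. c m \<theta>) has_integral I N) (cbox (-pi) pi)"
    "((\<lambda>\<theta>. \<Sum>m. c m \<theta>) has_integral J) (cbox (-pi) pi)" "I \<longlonglongrightarrow> J"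
    by (rule uniform_limit_integral_cbox[OF lim]) (auto simp: c_def intro!: continuous_intros)
  have "I N = (\<Sum>m<N. if m = n then (2 * pi * r ^ n) *\<^sub>R a n else 0)" for N
  proof (rule has_integral_unique)
    show "((\<lambda>\<theta>. \<Sum>m<N. c m \<theta>) has_integral I N) {-pi..pi}" using IJ(1)[of N] by simp
    show "((\<lambda>\<theta>. \<Sum>m<N. c m \<theta>) has_integral
        (\<Sum>m<N. if m = n then (2 * pi * r ^ n) *\<^sub>R a n else 0)) {-pi..pi}"
      by (intro has_integral_sum c_int) simp
  qed
  then have "\<forall>\<^sub>F N in sequentially. I N = (2 * pi * r ^ n) *\<^sub>R a n"
    by (intro eventually_sequentiallyI[of "Suc n"]) (auto simp: sum.delta)
  then have "I \<longlonglongrightarrow> (2 * pi * r ^ n) *\<^sub>R a n" by (simp add: tendsto_eventually)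
  with IJ(3) have J: "J = (2 * pi * r ^ n) *\<^sub>R a n" by (metis LIMSEQ_unique)
  have "(\<Sum>m. c m \<theta>) = \<sigma> (cis (- (real n * \<theta>))) * gen a (of_real r * cis \<theta>)" for \<theta>
  proof -
    have "cmod (of_real r * cis \<theta>) \<le> r" using r by (simp add: norm_mult)
    from gen_sums[OF summ this] show ?thesis
      unfolding c_eq gen_def by (intro suminf_mult) (simp add: sums_iff)
  qed
  with IJ(2) J show ?thesis by simp
qed

lemma gen_continuous_on_circle:
  assumes summ: "summable (\<lambda>m. norm (a m) * r ^ m)" and r: "0 \<le> r"
  shows "continuous_on S (\<lambda>\<theta>. gen a (of_real r * cis \<theta>))"
proof -
  have "uniform_limit S (\<lambda>N \<theta>. \<Sum>m<N. \<sigma> ((of_real r * cis \<theta>) ^ m) * a m)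
      (\<lambda>\<theta>. gen a (of_real r * cis \<theta>)) sequentially"
    unfolding gen_def
  proof (rule Weierstrass_m_test)
    show "summable (\<lambda>m. scal_bound * (norm (a m) * r ^ m))"
      using summ by (rule summable_mult)
    fix m \<theta>
    have "norm (\<sigma> ((of_real r * cis \<theta>) ^ m) * a m) \<le> scal_bound * (cmod ((of_real r * cis \<theta>) ^ m) * norm (a m))"
      by (rule scal_bound_props)
    then show "norm (\<sigma> ((of_real r * cis \<theta>) ^ m) * a m) \<le> scal_bound * (norm (a m) * r ^ m)"
      using r by (simp add: norm_power norm_mult mult_ac)
  qed
  then show ?thesis
    by (rule uniform_limit_theorem[rotated]) (auto intro!: always_eventually continuous_intros)
qed

section \<open>Decay of coefficients from a modulus of continuity\<close>

text \<open>
  The function \<open>1 / (\<theta> log \<theta>)\<^sup>2\<close> has no elementary antiderivative, but \<open>- 1 / (\<theta> L(\<theta>)\<^sup>2)\<close> with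
  \<open>L(\<theta>) = 4 + log (2\<pi>/\<theta>)\<close> has the derivative \<open>(L - 2) / (\<theta>\<^sup>2 L\<^sup>3)\<close> of the same size. The summand
  \<open>4\<close> gives \<open>L \<ge> 4\<close> on the whole interval, hence both \<open>L - 2 \<ge> L/2\<close> and \<open>L - 3 \<ge> L/4\<close>.
\<close>

lemma integral_inverse_ell_square:
  assumes "0 < b" "b \<le> pi"
  obtains g I where "(g has_integral I) {b..pi}"
    "\<And>\<theta>. \<theta> \<in> {b..pi} \<Longrightarrow> 1 / (ell (\<theta> / pi))\<^sup>2 \<le> g \<theta>"
    "I \<le> 32 * pi\<^sup>2 / (b * (4 + ln (2 * pi / b))\<^sup>2)"
proof -
  define L where "L \<theta> = 4 + ln (2 * pi / \<theta>)" for \<theta>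
  define G where "G \<theta> = - (32 * pi\<^sup>2) / (\<theta> * (L \<theta>)\<^sup>2)" for \<theta>
  define g where "g \<theta> = 32 * pi\<^sup>2 * (L \<theta> - 2) / (\<theta>\<^sup>2 * (L \<theta>) ^ 3)" for \<theta>
  have L4: "4 \<le> L \<theta>" if "0 < \<theta>" "\<theta> \<le> pi" for \<theta>
    using that by (simp add: L_def)
  show ?thesis
  proof (rule that[of g "G pi - G b"])
    show "(g has_integral (G pi - G b)) {b..pi}"
    proof (rule fundamental_theorem_of_calculus[OF assms(2)])
      fix x assume x: "x \<in> {b..pi}"
      then have x0: "0 < x" "4 \<le> L x" using assms L4[of x] by auto
      have dL: "(L has_real_derivative - (1 / x)) (at x within {b..pi})"
        unfolding L_def using x0
        by (auto intro!: derivative_eq_intros simp: divide_simps power2_eq_square)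
      have "(G has_real_derivative g x) (at x within {b..pi})"
        unfolding G_def using x0
        apply (auto intro!: derivative_eq_intros dL)
        apply (simp add: g_def divide_simps)
        apply (simp add: algebra_simps power2_eq_square power3_eq_cube)
        done
      then show "(G has_vector_derivative g x) (at x within {b..pi})"
        by (simp add: has_real_derivative_iff_has_vector_derivative)
    qed
    show "1 / (ell (\<theta> / pi))\<^sup>2 \<le> g \<theta>" if "\<theta> \<in> {b..pi}" for \<theta>
    proof -
      have t: "0 < \<theta>" "4 \<le> L \<theta>" using assms that L4[of \<theta>] by auto
      have "ell (\<theta> / pi) = \<theta> / pi * (L \<theta> - 3)"
        by (simp add: ell_def L_def)
      also have "\<dots> \<ge> \<theta> / pi * (L \<theta> / 4)"
        using t by (intro mult_left_mono) auto
      finally have "(\<theta> / pi * (L \<theta> / 4))\<^sup>2 \<le> (ell (\<theta> / pi))\<^sup>2"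
        using t by (intro power_mono) auto
      then have "1 / (ell (\<theta> / pi))\<^sup>2 \<le> 1 / (\<theta> / pi * (L \<theta> / 4))\<^sup>2"
        using t ell_pos[of "\<theta> / pi"] that by (intro divide_left_mono mult_pos_pos) auto
      also have "\<dots> = 16 * pi\<^sup>2 / (\<theta>\<^sup>2 * (L \<theta>)\<^sup>2)"
        by (simp add: power_mult_distrib power_divide)
      also have "\<dots> = 16 * pi\<^sup>2 * L \<theta> / (\<theta>\<^sup>2 * (L \<theta>) ^ 3)"
        using t by (simp add: power2_eq_square power3_eq_cube)
      also have "\<dots> \<le> g \<theta>"
        unfolding g_def using t by (intro divide_right_mono) auto
      finally show ?thesis .
    qed
    have "G pi \<le> 0" using L4[of pi] by (simp add: G_def)
    then show "G pi - G b \<le> 32 * pi\<^sup>2 / (b * (4 + ln (2 * pi / b))\<^sup>2)"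
      by (simp add: G_def L_def)
  qed
qed

lemma gen_rotate: "gen (\<lambda>n. \<sigma> (cis (real n * h)) * a n) z = gen a (z * cis h)"
proof -
  have "\<sigma> (z ^ n) * (\<sigma> (cis (real n * h)) * a n) = \<sigma> ((z * cis h) ^ n) * a n" for n
    by (simp add: power_mult_distrib Complex.DeMoivre scal_mult mult.assoc)
  then show ?thesis by (simp add: gen_def)
qed

lemma summable_rotate:
  assumes "summable (\<lambda>m. norm (a m) * r ^ m)" "0 \<le> r"
  shows "summable (\<lambda>m. norm (\<sigma> (cis (real m * h)) * a m) * r ^ m)"
proof (rule summable_comparison_test')
  show "summable (\<lambda>m. scal_bound * (norm (a m) * r ^ m))"
    using assms(1) by (rule summable_mult)
  fix m
  have "norm (\<sigma> (cis (real m * h)) * a m) \<le> scal_bound * (1 * norm (a m))"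
    using scal_bound_props(2) norm_cis by metis
  then have "norm (\<sigma> (cis (real m * h)) * a m) * r ^ m \<le> (scal_bound * norm (a m)) * r ^ m"
    using assms(2) by (intro mult_right_mono) auto
  then show "norm (norm (\<sigma> (cis (real m * h)) * a m) * r ^ m) \<le> scal_bound * (norm (a m) * r ^ m)"
    using assms(2) by (simp add: mult_ac)
qed

text \<open>
  Replacing \<open>\<theta>\<close> by \<open>\<theta> + h\<close> with \<open>h = \<pi> / n\<close> changes the sign of \<open>e\<^sup>-\<^sup>i\<^sup>n\<^sup>\<theta>\<close>, so twice the \<open>n\<close>-th
  Fourier coefficient is the coefficient of the difference of the generating function and its
  rotation. For \<open>|\<theta>| \<le> b\<close> this difference is bounded by \<open>2K\<close>; elsewhere the oscillation
  hypothesis applies, and its bound is integrated by the preceding lemma. The condition on \<open>b\<close>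
  is what makes \<open>h\<close> small enough compared with the distance to \<open>1\<close>.
\<close>

lemma coefficient_bound:
  assumes summ: "\<And>r. 0 \<le> r \<Longrightarrow> r < 1 \<Longrightarrow> summable (\<lambda>m. norm (a m) * r ^ m)"
    and K: "0 \<le> K" "\<And>z. cmod z < 1 \<Longrightarrow> norm (gen a z) \<le> K"
    and osc: "\<And>z h. cmod z < 1 \<Longrightarrow> 0 < h \<Longrightarrow> 2 * h \<le> cmod (1 - z) \<Longrightarrow>
        norm (gen a z - gen a (z * cis h)) \<le> K * ell h / (ell (cmod (1 - z)))\<^sup>2"
    and n: "0 < n" and b: "2 * pi\<^sup>2 / real n \<le> b" "b \<le> pi"
  shows "norm (a n) \<le> scal_bound * K *
           (b + 16 * pi * ell (pi / real n) / (b * (4 + ln (2 * pi / b))\<^sup>2))"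
proof -
  define h where "h = pi / real n"
  have h: "0 < h" "2 * h \<le> b / pi" using n b(1) by (auto simp: h_def field_simps power2_eq_square)
  have b0: "0 < b"
  proof -
    have "0 < 2 * pi\<^sup>2 / real n" using n by simp
    then show ?thesis using b(1) by linarith
  qed
  have h2: "h \<le> 2"
  proof -
    have "b / pi \<le> 1" using b(2) by simp
    then show ?thesis using h by linarith
  qed
  define W where "W = 4 * pi * (scal_bound * K *
           (b + 16 * pi * ell h / (b * (4 + ln (2 * pi / b))\<^sup>2)))"
  obtain g I where g: "(g has_integral I) {b..pi}"
    "\<And>\<theta>. \<theta> \<in> {b..pi} \<Longrightarrow> 1 / (ell (\<theta> / pi))\<^sup>2 \<le> g \<theta>"
    "I \<le> 32 * pi\<^sup>2 / (b * (4 + ln (2 * pi / b))\<^sup>2)"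
    using integral_inverse_ell_square[OF b0 b(2)] by blast
  \<comment> \<open>The estimate is proved on circles of radius \<open>r < 1\<close>, uniformly in \<open>r\<close>; then \<open>r\<close> tends to \<open>1\<close>.\<close>
  have main: "4 * pi * (r ^ n * norm (a n)) \<le> W" if r: "1 / 4 \<le> r" "r < 1" for r
  proof -
    have r0: "0 \<le> r" using r by simp
    define F where "F \<theta> = gen a (of_real r * cis \<theta>)" for \<theta>
    define \<Phi> where "\<Phi> \<theta> = \<sigma> (cis (- (real n * \<theta>))) * (F \<theta> - F (\<theta> + h))" for \<theta>
    define a' where "a' m = \<sigma> (cis (real m * h)) * a m" for m
    have gen_a': "gen a' (of_real r * cis \<theta>) = F (\<theta> + h)" for \<theta>
      unfolding a'_def[abs_def] gen_rotate F_def by (simp add: mult.assoc cis_mult)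
    have summ': "summable (\<lambda>m. norm (a' m) * r ^ m)"
      unfolding a'_def by (rule summable_rotate[OF summ[OF r0 r(2)] r0])
    have "(\<Phi> has_integral (2 * pi * r ^ n) *\<^sub>R a n - (2 * pi * r ^ n) *\<^sub>R a' n) {-pi..pi}"
      unfolding \<Phi>_def right_diff_distrib
      using has_integral_diff[OF Fourier_coefficient[OF summ[OF r0 r(2)] r0, of n]
          Fourier_coefficient[OF summ' r0, of n]]
      by (simp only: gen_a' F_def)
    moreover have "a' n = - a n"
    proof -
      have "cis (real n * h) = -1" using n by (simp add: h_def)
      moreover have "\<sigma> (-1) = - 1" using scal.neg[of 1] by (simp add: scal_1)
      ultimately show ?thesis by (simp add: a'_def)
    qed
    ultimately have \<Phi>: "(\<Phi> has_integral (4 * pi * r ^ n) *\<^sub>R a n) {-pi..pi}"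
      by (simp flip: scaleR_add_left) (simp add: algebra_simps)
    have cont: "continuous_on S \<Phi>" for S
      unfolding \<Phi>_def F_def
      using gen_continuous_on_circle[OF summ[OF r0 r(2)] r0, of S]
        gen_continuous_on_circle[OF summ' r0, of S]
      by (intro continuous_intros) (auto simp: gen_a' F_def)
    have int: "\<Phi> integrable_on {x..y}" for x y
      by (rule integrable_continuous_real[OF cont])
    have in_disc: "cmod (of_real r * cis \<theta>) < 1" for \<theta>
      using r by (simp add: norm_mult)
    have norm_\<Phi>: "norm (\<Phi> \<theta>) \<le> scal_bound * norm (F \<theta> - F (\<theta> + h))" for \<theta>
      using scal_bound_props(2)[of "cis (- (real n * \<theta>))"] by (simp add: \<Phi>_def)
    have mid: "norm (integral {-b..b} \<Phi>) \<le> (scal_bound * (2 * K)) * (b - (-b))"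
    proof (rule integral_bound)
      fix \<theta>
      have "norm (F \<theta> - F (\<theta> + h)) \<le> K + K"
        unfolding F_def by (intro order.trans[OF norm_triangle_ineq4] add_mono K in_disc)
      then have "scal_bound * norm (F \<theta> - F (\<theta> + h)) \<le> scal_bound * (2 * K)"
        using scal_bound_props(1) by (intro mult_left_mono) auto
      with norm_\<Phi>[of \<theta>] show "norm (\<Phi> \<theta>) \<le> scal_bound * (2 * K)" by linarith
    qed (use b0 cont in auto)
    have side: "norm (\<Phi> \<theta>) \<le> scal_bound * K * ell h * g \<bar>\<theta>\<bar>" if \<theta>: "\<bar>\<theta>\<bar> \<in> {b..pi}" for \<theta>
    proof -
      define z where "z = of_real r * cis \<theta>"
      have z: "cmod z < 1" using in_disc by (simp add: z_def)
      have dist2: "cmod (1 - z) \<le> 2" using norm_triangle_ineq4[of 1 z] z by simp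
      have low: "\<bar>\<theta>\<bar> / pi \<le> cmod (1 - z)"
        unfolding z_def using r \<theta> by (intro norm_one_minus_polar_ge) auto
      have \<theta>0: "0 < \<bar>\<theta>\<bar> / pi" using \<theta> b0 by auto
      have "b / pi \<le> \<bar>\<theta>\<bar> / pi" using \<theta> by (intro divide_right_mono) auto
      then have "2 * h \<le> cmod (1 - z)" using h low by linarith
      from osc[OF z h(1) this]
      have "norm (F \<theta> - F (\<theta> + h)) \<le> K * ell h / (ell (cmod (1 - z)))\<^sup>2"
        by (simp add: F_def z_def cis_mult mult.assoc)
      also have "\<dots> \<le> K * ell h * (1 / (ell (\<bar>\<theta>\<bar> / pi))\<^sup>2)"
      proof -
        have "0 < ell (\<bar>\<theta>\<bar> / pi)" using \<theta>0 low dist2 by (intro ell_pos) auto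
        moreover have "ell (\<bar>\<theta>\<bar> / pi) \<le> ell (cmod (1 - z))"
          using \<theta>0 low dist2 by (intro ell_mono) auto
        ultimately have "1 / (ell (cmod (1 - z)))\<^sup>2 \<le> 1 / (ell (\<bar>\<theta>\<bar> / pi))\<^sup>2"
          by (intro divide_left_mono power_mono mult_pos_pos) auto
        then have "K * ell h * (1 / (ell (cmod (1 - z)))\<^sup>2) \<le> K * ell h * (1 / (ell (\<bar>\<theta>\<bar> / pi))\<^sup>2)"
          using K(1) ell_nonneg[of h] h(1) h2 by (intro mult_left_mono) auto
        then show ?thesis by simp
      qed
      also have "\<dots> \<le> K * ell h * g \<bar>\<theta>\<bar>"
        using K(1) ell_nonneg[of h] h(1) h2 g(2)[OF \<theta>] by (intro mult_left_mono) auto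
      finally have "scal_bound * norm (F \<theta> - F (\<theta> + h)) \<le> scal_bound * (K * ell h * g \<bar>\<theta>\<bar>)"
        using scal_bound_props(1) by (intro mult_left_mono) auto
      with norm_\<Phi>[of \<theta>] show ?thesis by (simp add: mult.assoc)
    qed
    define I' where "I' = scal_bound * K * ell h * I"
    have g': "((\<lambda>\<theta>. scal_bound * K * ell h * g \<theta>) has_integral I') {b..pi}"
      unfolding I'_def using g(1) by (rule has_integral_mult_right)
    have right: "norm (integral {b..pi} \<Phi>) \<le> I'"
      unfolding integral_unique[OF g', symmetric]
    proof (rule integral_norm_bound_integral[OF int has_integral_integrable[OF g']])
      fix \<theta> assume "\<theta> \<in> {b..pi}"
      then show "norm (\<Phi> \<theta>) \<le> scal_bound * K * ell h * g \<theta>" using side[of \<theta>] b0 by auto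
    qed
    have left: "norm (integral {-pi..-b} \<Phi>) \<le> I'"
    proof -
      have *: "((\<lambda>\<theta>. \<Phi> (- \<theta>)) has_integral integral {-pi..-b} \<Phi>) {b..pi}"
        using has_integral_reflect_real[of \<Phi> "integral {-pi..-b} \<Phi>" "-b" "-pi"]
          integrable_integral[OF int[of "-pi" "-b"]] by simp
      then have "(\<lambda>\<theta>. \<Phi> (- \<theta>)) integrable_on {b..pi}" by (rule has_integral_integrable)
      then have "norm (integral {b..pi} (\<lambda>\<theta>. \<Phi> (- \<theta>))) \<le> I'"
        unfolding integral_unique[OF g', symmetric]
      proof (rule integral_norm_bound_integral[OF _ has_integral_integrable[OF g']])
        fix \<theta> assume "\<theta> \<in> {b..pi}"
        then show "norm (\<Phi> (- \<theta>)) \<le> scal_bound * K * ell h * g \<theta>" using side[of "-\<theta>"] b0 by auto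
      qed
      then show ?thesis using * by (simp add: integral_unique)
    qed
    have "(4 * pi * r ^ n) *\<^sub>R a n = integral {-pi..pi} \<Phi>"
      using \<Phi> by (simp add: integral_unique)
    also have "\<dots> = integral {-pi..-b} \<Phi> + (integral {-b..b} \<Phi> + integral {b..pi} \<Phi>)"
      using b0 b(2) Henstock_Kurzweil_Integration.integral_combine[OF _ _ int, of "-pi" "-b" pi] Henstock_Kurzweil_Integration.integral_combine[OF _ _ int, of "-b" b pi]
      by simp
    finally have "norm ((4 * pi * r ^ n) *\<^sub>R a n) \<le> I' + ((scal_bound * (2 * K)) * (b - (-b)) + I')"
      using norm_triangle_mono[OF left norm_triangle_mono[OF mid right]] by simp
    also have "\<dots> = 4 * (scal_bound * K) * b + 2 * (scal_bound * K * ell h) * I"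
      by (simp add: I'_def algebra_simps)
    also have "\<dots> \<le> 4 * (scal_bound * K) * b + 2 * (scal_bound * K * ell h) *
        (32 * pi\<^sup>2 / (b * (4 + ln (2 * pi / b))\<^sup>2))"
      using K(1) ell_nonneg[of h] h(1) h2 g(3) scal_bound_props(1)
      by (intro add_left_mono mult_left_mono) auto
    also have "\<dots> \<le> W"
    proof -
      have "4 * (scal_bound * K) * b \<le> 4 * pi * (scal_bound * K * b)"
        using K(1) scal_bound_props(1) b0 pi_ge_two
          mult_right_mono[of 1 pi "4 * (scal_bound * K) * b"] by (simp add: mult_ac)
      then show ?thesis
        by (simp add: W_def distrib_left power2_eq_square mult_ac)
    qed
    finally show ?thesis using r0 by (simp add: mult_ac)
  qed
  have "4 * pi * (1 ^ n * norm (a n)) \<le> W"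
  proof (rule tendsto_upperbound)
    show "((\<lambda>r. 4 * pi * (r ^ n * norm (a n))) \<longlongrightarrow> 4 * pi * (1 ^ n * norm (a n))) (at_left 1)"
      by (intro tendsto_intros)
    show "\<forall>\<^sub>F r in at_left 1. 4 * pi * (r ^ n * norm (a n)) \<le> W"
    proof -
      have "\<forall>\<^sub>F r in at_left (1::real). r \<in> {1 / 4<..<1}"
        by (rule eventually_at_left_real) simp
      then show ?thesis by eventually_elim (rule main, auto)
    qed
  qed simp
  then show ?thesis by (simp add: W_def h_def)
qed

text \<open>
  The choice \<open>b = 1 / sqrt (n log n)\<close> balances the two terms of the preceding bound: with
  \<open>log (1/b)\<close> comparable to \<open>log n\<close>, the second one is of order
  \<open>(log n / n) / (b log\<^sup>2 n) = 1 / (b n log n)\<close>.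
\<close>

lemma coefficient_decay:
  assumes "\<And>r. 0 \<le> r \<Longrightarrow> r < 1 \<Longrightarrow> summable (\<lambda>m. norm (a m) * r ^ m)"
    and "0 \<le> K" "\<And>z. cmod z < 1 \<Longrightarrow> norm (gen a z) \<le> K"
    and "\<And>z h. cmod z < 1 \<Longrightarrow> 0 < h \<Longrightarrow> 2 * h \<le> cmod (1 - z) \<Longrightarrow>
        norm (gen a z - gen a (z * cis h)) \<le> K * ell h / (ell (cmod (1 - z)))\<^sup>2"
  shows "(\<lambda>n. norm (a n)) \<in> O(\<lambda>n. 1 / sqrt (real n * ln (real n)))"
proof -
  define b where "b n = 1 / sqrt (real n * ln (real n))" for n
  define X where "X n = b n + 16 * pi * ell (pi / real n) / (b n * (4 + ln (2 * pi / b n))\<^sup>2)" for n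
  have "X \<in> O(\<lambda>n. 1 / sqrt (real n * ln (real n)))"
    unfolding X_def b_def ell_def by real_asymp
  moreover have "(\<lambda>n. norm (a n)) \<in> O(X)"
  proof (rule bigoI)
    have "eventually (\<lambda>n. 2 * pi\<^sup>2 / real n \<le> b n) sequentially"
      unfolding b_def by real_asymp
    moreover have "eventually (\<lambda>n. b n \<le> pi) sequentially"
      unfolding b_def by real_asymp
    ultimately show "eventually (\<lambda>n. norm (norm (a n)) \<le> (scal_bound * K) * norm (X n)) sequentially"
      using eventually_gt_at_top[of 0]
    proof eventually_elim
      case (elim n)
      have "norm (a n) \<le> scal_bound * K * X n"
        unfolding X_def using coefficient_bound[OF assms elim(3) elim(1,2)] .
      also have "\<dots> \<le> scal_bound * K * norm (X n)"
        using assms(2) scal_bound_props(1) by (intro mult_left_mono) auto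
      finally show ?case by simp
    qed
  qed
  ultimately show ?thesis by (rule landau_o.big_trans[rotated])
qed

end

section \<open>Renewal sequences and their generating functions\<close>

unbundle no vec_syntax
unbundle fps_syntax

lemma norm_one_minus_cis_le: "cmod (1 - cis x) \<le> \<bar>x\<bar>"
proof -
  have "(cmod (1 - cis x))\<^sup>2 = (1 - cos x)\<^sup>2 + (sin x)\<^sup>2"
    by (simp add: cmod_power2)
  also have "\<dots> = 2 * (1 - cos (2 * (x / 2)))"
    using sin_cos_squared_add[of x] by (simp add: power2_eq_square algebra_simps)
  also have "\<dots> = (2 * \<bar>sin (x / 2)\<bar>)\<^sup>2"
    unfolding cos_double_sin by (simp add: power2_eq_square)
  also have "\<dots> \<le> \<bar>x\<bar>\<^sup>2"
    using abs_sin_x_le_abs_x[of "x / 2"] by (intro power_mono) auto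
  finally show ?thesis by (rule power2_le_imp_le) simp
qed

fun renewal_seq :: "(nat \<Rightarrow> 'a) \<Rightarrow> nat \<Rightarrow> 'a::{monoid_mult, ring}" where
  "renewal_seq R n = (if n = 0 then 1 else (\<Sum>k = 1..n. renewal_seq R (n - k) * R k))"

declare renewal_seq.simps [simp del]

lemma renewal_seq_0 [simp]: "renewal_seq R 0 = 1"
  by (subst renewal_seq.simps) simp

lemma renewal_seq_conv:
  assumes "R 0 = 0"
  shows "renewal_seq R n = (if n = 0 then 1 else 0) + (\<Sum>i\<le>n. renewal_seq R i * R (n - i))"
proof (cases "n = 0")
  case False
  have "(\<Sum>k = 1..n. renewal_seq R (n - k) * R k) = (\<Sum>k\<le>n. renewal_seq R (n - k) * R k)"
    using assms by (intro sum.mono_neutral_left) (auto simp: not_le)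
  also have "\<dots> = (\<Sum>i\<le>n. renewal_seq R i * R (n - i))"
    by (rule sum.reindex_bij_witness[of _ "\<lambda>i. n - i" "\<lambda>i. n - i"]) auto
  finally show ?thesis using False by (subst renewal_seq.simps) simp
qed (use assms in simp)

text \<open>
  The generating function of the renewal sequence without its constant term. Leaving out the
  unit keeps the formal identities below within the class \<open>ring\<close>, to which the power series
  over the operator algebra belong.
\<close>

definition renewal_fps :: "(nat \<Rightarrow> 'a) \<Rightarrow> 'a::{monoid_mult, ring} fps" where
  "renewal_fps R = Abs_fps (\<lambda>n. if n = 0 then 0 else renewal_seq R n)"

lemma renewal_fps_left:
  assumes "R 0 = 0"
  shows "renewal_fps R = Abs_fps R + renewal_fps R * Abs_fps R"
proof (rule fps_ext)
  fix n
  show "renewal_fps R $ n = (Abs_fps R + renewal_fps R * Abs_fps R) $ n"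
  proof (cases "n = 0")
    case False
    have "(\<Sum>i\<le>n. renewal_seq R i * R (n - i)) =
        R n + (\<Sum>i\<le>n. (if i = 0 then 0 else renewal_seq R i) * R (n - i))"
      by (subst (1 2) sum.atMost_shift) simp
    then show ?thesis
      using renewal_seq_conv[of R n, OF assms] False
      by (simp add: renewal_fps_def fps_mult_nth atLeast0AtMost)
  qed (use assms in \<open>simp add: renewal_fps_def fps_mult_nth\<close>)
qed

lemma fps_eq_0_of_mult_fixpoint:
  fixes X A :: "'a::ring fps"
  assumes "X = X * A" "A $ 0 = 0"
  shows "X = 0"
proof (rule fps_ext)
  fix n
  show "X $ n = 0 $ n"
  proof (induction n rule: less_induct)
    case (less n)
    have "X $ n = (\<Sum>i=0..n. X $ i * A $ (n - i))"
      by (subst assms(1)) (simp add: fps_mult_nth)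
    also have "\<dots> = 0"
    proof (rule sum.neutral, rule ballI)
      fix i assume "i \<in> {0..n}"
      then show "X $ i * A $ (n - i) = 0"
        using less[of i] assms(2) by (cases "i = n") auto
    qed
    finally show ?case by simp
  qed
qed

lemma renewal_fps_right:
  assumes "R 0 = 0"
  shows "renewal_fps R = Abs_fps R + Abs_fps R * renewal_fps R"
proof -
  let ?S = "renewal_fps R" and ?R = "Abs_fps R"
  have S: "?S = ?R + ?S * ?R" by (rule renewal_fps_left[of R, OF assms])
  have "?S * ?R - ?R * ?S = (?R + ?S * ?R) * ?R - ?R * (?R + ?S * ?R)"
    using S by simp
  also have "\<dots> = (?S * ?R - ?R * ?S) * ?R"
    by (simp add: algebra_simps)
  finally have "?S * ?R - ?R * ?S = 0"
    by (rule fps_eq_0_of_mult_fixpoint) (simp add: assms)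
  with S show ?thesis by simp
qed

text \<open>
  With \<open>S\<close> standing for \<open>(1 - R)\<^sup>-\<^sup>1 - 1\<close>, this is the resolvent identity
  \<open>S' - S = (1 + S') (R' - R) (1 + S)\<close> written without a unit.
\<close>

lemma renewal_fps_perturb:
  assumes "R 0 = 0" "R' 0 = 0"
  defines "D \<equiv> Abs_fps R' - Abs_fps R"
  shows "renewal_fps R' = renewal_fps R + (D + renewal_fps R' * D) +
           (D + renewal_fps R' * D) * renewal_fps R"
proof -
  have 1: "D + renewal_fps R' * D = renewal_fps R' - Abs_fps R - renewal_fps R' * Abs_fps R"
    using renewal_fps_left[of R', OF assms(2)] by (simp add: D_def algebra_simps)
  have 2: "Abs_fps R * renewal_fps R = renewal_fps R - Abs_fps R"
    using renewal_fps_right[of R, OF assms(1)] by (simp add: algebra_simps)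
  have "(D + renewal_fps R' * D) * renewal_fps R =
      renewal_fps R' * renewal_fps R - Abs_fps R * renewal_fps R
        - renewal_fps R' * (Abs_fps R * renewal_fps R)"
    unfolding 1 by (simp add: algebra_simps)
  also have "\<dots> = - renewal_fps R + Abs_fps R + renewal_fps R' * Abs_fps R"
    unfolding 2 by (simp add: algebra_simps)
  finally show ?thesis unfolding 1 by (simp add: algebra_simps)
qed

text \<open>
  Truncations of the norm of the Wiener algebra of absolutely convergent power series. They
  are finite for every series, so that a bound can be derived from an inequality in which the
  quantity occurs on both sides.
\<close>

definition partial_norm :: "nat \<Rightarrow> 'a::real_normed_algebra fps \<Rightarrow> real" where
  "partial_norm m A = (\<Sum>n\<le>m. norm (A $ n))"

lemma partial_norm_nonneg: "0 \<le> partial_norm m A"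
  by (simp add: partial_norm_def sum_nonneg)

lemma partial_norm_add: "partial_norm m (A + B) \<le> partial_norm m A + partial_norm m B"
  by (simp add: partial_norm_def flip: sum.distrib) (intro sum_mono norm_triangle_ineq)

lemma partial_norm_mult: "partial_norm m (A * B) \<le> partial_norm m A * partial_norm m B"
proof -
  have "partial_norm m (A * B) \<le> (\<Sum>n\<le>m. \<Sum>i\<le>n. norm (A $ i) * norm (B $ (n - i)))"
    unfolding partial_norm_def fps_mult_nth atLeast0AtMost
    by (intro sum_mono order.trans[OF norm_sum] norm_mult_ineq)
  also have "\<dots> = (\<Sum>(i, j)\<in>{(i, j). i + j \<le> m}. norm (A $ i) * norm (B $ j))"
    by (simp add: sum.triangle_reindex_eq)
  also have "\<dots> \<le> (\<Sum>(i, j)\<in>{..m} \<times> {..m}. norm (A $ i) * norm (B $ j))"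
    by (rule sum_mono2) auto
  also have "\<dots> = partial_norm m A * partial_norm m B"
    by (simp add: partial_norm_def sum_product sum.cartesian_product)
  finally show ?thesis .
qed

text \<open>
  Neumann series in the Wiener algebra: by the resolvent identity, the norm \<open>s\<close> of the
  perturbed series satisfies \<open>s \<le> W + (1 + W) \<delta> + s (1 + W) \<delta>\<close>, and \<open>s\<close> can be absorbed on the
  left.
\<close>

lemma summable_renewal_seq_perturb:
  fixes R R' :: "nat \<Rightarrow> 'a::{real_normed_algebra, monoid_mult}"
  assumes R0: "R 0 = 0" "R' 0 = 0"
    and W: "summable (\<lambda>n. norm (renewal_seq R n))" "(\<Sum>n. norm (renewal_seq R n)) \<le> W"
    and d: "summable (\<lambda>n. norm (R' n - R n))" "(\<Sum>n. norm (R' n - R n)) \<le> \<delta>"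
    and small: "(1 + W) * \<delta> < 1"
  shows "summable (\<lambda>n. norm (renewal_seq R' n))"
proof -
  define D where "D = Abs_fps R' - Abs_fps R"
  let ?S = "renewal_fps R" and ?S' = "renewal_fps R'"
  have nW: "partial_norm m ?S \<le> W" for m
  proof -
    have "partial_norm m ?S \<le> (\<Sum>n\<le>m. norm (renewal_seq R n))"
      unfolding partial_norm_def by (intro sum_mono) (auto simp: renewal_fps_def)
    also have "\<dots> \<le> (\<Sum>n. norm (renewal_seq R n))"
      by (intro sum_le_suminf W) auto
    finally show ?thesis using W(2) by linarith
  qed
  have nD: "partial_norm m D \<le> \<delta>" for m
  proof -
    have "partial_norm m D \<le> (\<Sum>n. norm (R' n - R n))"
      unfolding partial_norm_def D_def by (auto intro!: sum_le_suminf d)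
    then show ?thesis using d(2) by linarith
  qed
  have W0: "0 \<le> W" using nW[of 0] partial_norm_nonneg[of 0 ?S] by linarith
  have \<delta>0: "0 \<le> \<delta>" using nD[of 0] partial_norm_nonneg[of 0 D] by linarith
  define B where "B = (W + (1 + W) * \<delta>) / (1 - (1 + W) * \<delta>)"
  have B: "partial_norm m ?S' \<le> B" for m
  proof -
    define s where "s = partial_norm m ?S'"
    have "partial_norm m (D + ?S' * D) \<le> partial_norm m D + s * partial_norm m D"
      unfolding s_def by (intro order.trans[OF partial_norm_add] add_mono partial_norm_mult order.refl)
    also have "\<dots> \<le> \<delta> + s * \<delta>"
      using nD[of m] partial_norm_nonneg[of m ?S'] by (intro add_mono mult_left_mono) (auto simp: s_def)
    finally have 1: "partial_norm m (D + ?S' * D) \<le> \<delta> + s * \<delta>" .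
    have "s = partial_norm m (?S + (D + ?S' * D) + (D + ?S' * D) * ?S)"
      unfolding s_def D_def using renewal_fps_perturb[of R R', OF R0] by simp
    also have "\<dots> \<le> partial_norm m ?S + partial_norm m (D + ?S' * D) + partial_norm m ((D + ?S' * D) * ?S)"
      by (intro order.trans[OF partial_norm_add] add_mono order.refl)
    also have "\<dots> \<le> W + (\<delta> + s * \<delta>) + (\<delta> + s * \<delta>) * W"
      using 1 nW[of m] W0 partial_norm_nonneg
      by (intro add_mono order.trans[OF partial_norm_mult] mult_mono) (auto intro: order.trans[OF _ 1])
    also have "\<dots> = W + (1 + W) * \<delta> + s * ((1 + W) * \<delta>)"
      by (simp add: algebra_simps)
    finally have "s * (1 - (1 + W) * \<delta>) \<le> W + (1 + W) * \<delta>"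
      by (simp add: algebra_simps)
    then show ?thesis using small by (simp add: s_def B_def field_simps)
  qed
  show ?thesis
  proof (rule bounded_imp_summable)
    fix m
    have "(\<Sum>n\<le>m. norm (renewal_seq R' n)) \<le> norm (1::'a) + partial_norm m ?S'"
      unfolding partial_norm_def renewal_fps_def
      by (subst (1 2) sum.atMost_shift) simp
    then show "(\<Sum>n\<le>m. norm (renewal_seq R' n)) \<le> norm (1::'a) + B" using B[of m] by linarith
  qed simp
qed

lemma renewal_seq_scale:
  fixes R :: "nat \<Rightarrow> 'a::{real_algebra, monoid_mult}"
  shows "renewal_seq (\<lambda>n. s ^ n *\<^sub>R R n) n = s ^ n *\<^sub>R renewal_seq R n"
proof (induction n rule: less_induct)
  case (less n)
  show ?case
  proof (cases "n = 0")
    case False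
    have "(\<Sum>k = 1..n. renewal_seq (\<lambda>n. s ^ n *\<^sub>R R n) (n - k) * (s ^ k *\<^sub>R R k)) =
        (\<Sum>k = 1..n. s ^ n *\<^sub>R (renewal_seq R (n - k) * R k))"
      using less by (intro sum.cong) (auto simp flip: power_add)
    then show ?thesis using False
      by (subst (1 2) renewal_seq.simps) (simp add: scaleR_sum_right)
  qed simp
qed

lemma of_nat_mult_power_le:
  fixes r :: real
  assumes "0 \<le> r" "r < 1"
  shows "real n * r ^ (n - 1) \<le> 1 / (1 - r)\<^sup>2"
proof (cases n)
  case (Suc m)
  have s: "(\<lambda>n. of_nat (Suc n) * r ^ n) sums (1 / (1 - r)\<^sup>2)"
    using geometric_deriv_sums[of r] assms by simp
  have "(\<Sum>k\<in>{m}. of_nat (Suc k) * r ^ k) \<le> (\<Sum>k. of_nat (Suc k) * r ^ k)"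
    using assms s by (intro sum_le_suminf) (auto simp: sums_iff)
  then show ?thesis using s Suc by (simp add: sums_iff)
qed simp

lemma power_diff_le:
  fixes s t r :: real
  assumes "0 \<le> s" "s \<le> t" "t \<le> r"
  shows "t ^ n - s ^ n \<le> real n * r ^ (n - 1) * (t - s)"
proof (cases n)
  case (Suc m)
  have "t ^ Suc m - s ^ Suc m = (t - s) * (\<Sum>p<Suc m. t ^ p * s ^ (m - p))"
    by (rule diff_power_eq_sum)
  also have "\<dots> \<le> (t - s) * (\<Sum>p<Suc m. r ^ p * r ^ (m - p))"
    using assms by (intro mult_left_mono sum_mono mult_mono power_mono) auto
  also have "(\<Sum>p<Suc m. r ^ p * r ^ (m - p)) = real (Suc m) * r ^ m"
    by (simp flip: power_add)
  finally show ?thesis using Suc by (simp add: mult_ac)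
qed simp

context scalar_algebra
begin

interpretation scal: bounded_linear \<sigma> by (rule scal_linear)

lemma Cauchy_coefficient_bound:
  assumes summ: "summable (\<lambda>m. norm (a m) * r ^ m)" and r: "0 \<le> r"
    and B: "\<And>z. cmod z = r \<Longrightarrow> norm (gen a z) \<le> B"
  shows "r ^ n * norm (a n) \<le> scal_bound * B"
proof -
  have "norm ((2 * pi * r ^ n) *\<^sub>R a n) \<le> (scal_bound * B) * measure lborel (cbox (-pi) pi)"
  proof (rule has_integral_bound)
    show "((\<lambda>\<theta>. \<sigma> (cis (- (real n * \<theta>))) * gen a (of_real r * cis \<theta>))
            has_integral (2 * pi * r ^ n) *\<^sub>R a n) (cbox (-pi) pi)"
      using Fourier_coefficient[OF summ r] by simp
    have "norm (gen a (of_real r)) \<le> B" using r by (intro B) simp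
    then show "0 \<le> scal_bound * B"
      using scal_bound_props(1) norm_ge_zero[of "gen a (of_real r)"] by (intro mult_nonneg_nonneg) linarith+
    fix \<theta>
    have "norm (\<sigma> (cis (- (real n * \<theta>))) * gen a (of_real r * cis \<theta>)) \<le>
        scal_bound * (1 * norm (gen a (of_real r * cis \<theta>)))"
      using scal_bound_props(2) norm_cis by metis
    also have "\<dots> \<le> scal_bound * (1 * B)"
      using r scal_bound_props(1) by (intro mult_left_mono B) (auto simp: norm_mult)
    finally show "norm (\<sigma> (cis (- (real n * \<theta>))) * gen a (of_real r * cis \<theta>)) \<le> scal_bound * B"
      by simp
  qed
  then show ?thesis using r by (simp add: field_simps)
qed

text \<open>
  The coefficients of the derivative of a summable series grow at most linearly, so the series
  is Lipschitz on every smaller disc.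
\<close>

lemma norm_gen_rotate_diff_le:
  assumes summ: "summable (\<lambda>n. norm (R n))" and r: "0 \<le> r" "r < 1" "cmod z \<le> r" and h: "0 \<le> h"
  shows "norm (gen R z - gen R (z * cis h)) \<le> scal_bound * ((\<Sum>n. norm (R n)) / (1 - r)\<^sup>2) * h"
proof -
  have summ_r: "summable (\<lambda>n. norm (R n) * 1 ^ n)" using summ by simp
  have 1: "(\<lambda>n. \<sigma> (z ^ n) * R n - \<sigma> ((z * cis h) ^ n) * R n) sums (gen R z - gen R (z * cis h))"
    using r by (intro sums_diff gen_sums[OF summ_r]) (auto simp: norm_mult)
  have 2: "norm (\<sigma> (z ^ n) * R n - \<sigma> ((z * cis h) ^ n) * R n) \<le>
      scal_bound * (norm (R n) / (1 - r)\<^sup>2) * h" for n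
  proof -
    have "\<sigma> (z ^ n) * R n - \<sigma> ((z * cis h) ^ n) * R n = \<sigma> (z ^ n * (1 - cis (real n * h))) * R n"
      by (simp add: power_mult_distrib Complex.DeMoivre scal_mult scal.diff algebra_simps)
    also have "norm \<dots> \<le> scal_bound * (cmod (z ^ n * (1 - cis (real n * h))) * norm (R n))"
      by (rule scal_bound_props)
    also have "cmod (z ^ n * (1 - cis (real n * h))) \<le> r ^ n * (real n * h)"
      unfolding norm_mult norm_power
      using norm_one_minus_cis_le[of "real n * h"] r h by (intro mult_mono power_mono) auto
    also have "r ^ n * (real n * h) \<le> (real n * r ^ (n - 1)) * h"
    proof -
      have "r ^ n \<le> r ^ (n - 1)" using r by (intro power_decreasing) auto
      then have "r ^ n * (real n * h) \<le> r ^ (n - 1) * (real n * h)"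
        using h by (intro mult_right_mono) auto
      then show ?thesis by (simp add: mult_ac)
    qed
    also have "\<dots> \<le> 1 / (1 - r)\<^sup>2 * h"
      using h of_nat_mult_power_le[OF r(1,2)] by (intro mult_right_mono)
    finally show ?thesis
      using scal_bound_props(1) by (simp add: mult_right_mono mult_left_mono mult_ac)
  qed
  have 3: "(\<lambda>n. scal_bound * (norm (R n) / (1 - r)\<^sup>2) * h) sums
      (scal_bound * ((\<Sum>n. norm (R n)) / (1 - r)\<^sup>2) * h)"
    by (intro sums_mult sums_mult2 sums_divide summable_sums summ)
  show ?thesis by (rule norm_sums_le[OF 1 3 2])
qed

lemma gen_renewal_seq:
  assumes R0: "R 0 = 0" and summ: "summable (\<lambda>n. norm (R n) * r ^ n)"
    "summable (\<lambda>n. norm (renewal_seq R n) * r ^ n)" and z: "cmod z \<le> r"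
  shows "gen (renewal_seq R) z * (1 - gen R z) = 1"
proof -
  have "(\<lambda>n. \<sigma> (z ^ n) * renewal_seq R n - \<sigma> (z ^ n) * (\<Sum>i\<le>n. renewal_seq R i * R (n - i)))
      sums (gen (renewal_seq R) z - gen (renewal_seq R) z * gen R z)"
    by (intro sums_diff gen_sums[OF summ(2) z] gen_mult[OF summ(2,1) z])
  moreover have "\<sigma> (z ^ n) * renewal_seq R n - \<sigma> (z ^ n) * (\<Sum>i\<le>n. renewal_seq R i * R (n - i)) =
      (if n = 0 then 1 else 0)" for n
    using renewal_seq_conv[of R n, OF R0] by (simp add: scal_1 flip: right_diff_distrib)
  ultimately have "(\<lambda>n. if n = 0 then 1 else 0) sums (gen (renewal_seq R) z - gen (renewal_seq R) z * gen R z)"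
    by simp
  moreover have "(\<lambda>n. if n = 0 then 1 else 0 :: 'x) sums 1"
    using sums_If_finite_set[of "{0::nat}" "\<lambda>_. 1::'x"] by simp
  ultimately show ?thesis
    by (metis sums_unique2 right_diff_distrib mult.right_neutral)
qed

lemma scal_minus_1: "\<sigma> (-1) = -1"
  using scal.neg[of 1] by (simp add: scal_1)

text \<open>
  Inside the disc the inverse \<open>G\<close> of \<open>1 - R\<close> is Lipschitz along circles, so one shift by
  \<open>\<pi> / n\<close> in the Fourier integral gains a factor \<open>1 / n\<close>. What matters is that the bound
  depends on \<open>r\<close> and not on \<open>s\<close>.
\<close>

lemma renewal_seq_coefficient_bound:
  assumes R0: "R 0 = 0" and summ: "summable (\<lambda>n. norm (R n))"
    and G: "\<And>z. cmod z < 1 \<Longrightarrow> (1 - gen R z) * G z = 1"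
    and B: "\<And>z. cmod z \<le> r \<Longrightarrow> norm (G z) \<le> B"
    and s: "0 \<le> s" "s \<le> r" "r < 1" "summable (\<lambda>n. norm (renewal_seq R n) * s ^ n)"
    and n: "0 < n"
  shows "norm (renewal_seq R n) * s ^ n \<le>
           scal_bound * (B * (scal_bound * ((\<Sum>n. norm (R n)) / (1 - r)\<^sup>2) * pi) * B) / real n"
proof -
  let ?T = "renewal_seq R"
  define L where "L = scal_bound * ((\<Sum>n. norm (R n)) / (1 - r)\<^sup>2)"
  define h where "h = pi / real n"
  have h: "0 < h" using n by (simp add: h_def)
  have summ_s: "summable (\<lambda>n. norm (R n) * s ^ n)"
  proof (rule summable_comparison_test'[OF summ])
    fix n
    have "norm (R n) * s ^ n \<le> norm (R n) * 1"
      using s by (intro mult_left_mono power_le_one) auto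
    then show "norm (norm (R n) * s ^ n) \<le> norm (R n)" using s by simp
  qed
  have inv: "gen ?T z * (1 - gen R z) = 1" "gen ?T z = G z" if "cmod z \<le> s" for z
  proof -
    show 1: "gen ?T z * (1 - gen R z) = 1"
      by (rule gen_renewal_seq[OF R0 summ_s s(4) that])
    have "gen ?T z = gen ?T z * ((1 - gen R z) * G z)"
      using G[of z] that s by simp
    also have "\<dots> = G z" using 1 by (simp flip: mult.assoc)
    finally show "gen ?T z = G z" .
  qed
  define a where "a m = ?T m - \<sigma> (cis (real m * h)) * ?T m" for m
  note rot = summable_rotate[OF s(4,1)]
  have gen_a: "gen a z = G z - G (z * cis h)" if "cmod z \<le> s" for z
  proof -
    have "gen a z = gen ?T z - gen ?T (z * cis h)"
      unfolding a_def using gen_diff[OF s(4) rot that] by (simp add: gen_rotate)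
    then show ?thesis using that by (simp add: inv norm_mult)
  qed
  have "s ^ n * norm (a n) \<le> scal_bound * (B * (L * h) * B)"
  proof (rule Cauchy_coefficient_bound)
    show "summable (\<lambda>m. norm (a m) * s ^ m)"
    proof (rule summable_comparison_test'[OF summable_add[OF s(4) rot]])
      fix m
      have "norm (a m) * s ^ m \<le> (norm (?T m) + norm (\<sigma> (cis (real m * h)) * ?T m)) * s ^ m"
        using s(1) unfolding a_def by (intro mult_right_mono norm_triangle_ineq4) auto
      then show "norm (norm (a m) * s ^ m) \<le> norm (?T m) * s ^ m + norm (\<sigma> (cis (real m * h)) * ?T m) * s ^ m"
        using s(1) by (simp add: distrib_right)
    qed
    fix z assume z: "cmod z = s"
    define w where "w = z * cis h"
    have w: "cmod w = s" using z by (simp add: w_def norm_mult)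
    have "G z - G w = G z * ((1 - gen R w) * G w) - (G z * (1 - gen R z)) * G w"
      using G[of w] inv[of z] w z s by simp
    also have "\<dots> = G z * (gen R z - gen R w) * G w"
      by (simp add: algebra_simps)
    finally have eq: "gen a z = G z * (gen R z - gen R w) * G w"
      using gen_a[of z] z by (simp add: w_def)
    have B0: "0 \<le> B" using order.trans[OF norm_ge_zero B[of z]] z s by simp
    have Lh: "norm (gen R z - gen R w) \<le> L * h"
      unfolding w_def L_def using z s h by (intro norm_gen_rotate_diff_le[OF summ]) auto
    have "norm (G z) * norm (gen R z - gen R w) * norm (G w) \<le> B * (L * h) * B"
      using z w s B0 mult_nonneg_nonneg[OF B0 order.trans[OF norm_ge_zero Lh]]
      by (intro mult_mono B Lh) auto
    moreover have "norm (gen a z) \<le> norm (G z) * norm (gen R z - gen R w) * norm (G w)"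
      unfolding eq by (intro order.trans[OF norm_mult_ineq] mult_right_mono norm_mult_ineq) auto
    ultimately show "norm (gen a z) \<le> B * (L * h) * B" by linarith
  qed (use s in auto)
  moreover have "a n = 2 *\<^sub>R ?T n"
  proof -
    have "cis (real n * h) = -1" using n by (simp add: h_def)
    then show ?thesis by (simp add: a_def scal_minus_1 scaleR_2)
  qed
  ultimately have "2 * (norm (?T n) * s ^ n) \<le> scal_bound * (B * (L * pi) * B) / real n"
    by (simp add: h_def mult_ac)
  moreover have "0 \<le> norm (?T n) * s ^ n" using s by simp
  ultimately show ?thesis unfolding L_def by linarith
qed

text \<open>
  The radius of convergence is at least \<open>1\<close> because \<open>1 - R(z)\<close> is invertible throughout the disc,
  with an inverse that is bounded on smaller discs. The argument takes the place of Cauchy's theorem for functions with values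
  in a Banach algebra. Let \<open>\<rho>\<close> be the supremum of the radii, up to some \<open>r < 1\<close>, at which the
  renewal sequence is absolutely summable. At the radius \<open>\<rho> (1 - \<epsilon>)\<^sup>2\<close> its norm is only
  \<open>O(log (1/\<epsilon>))\<close>, by the previous lemma, whereas enlarging the radius to \<open>\<rho> (1 + \<epsilon>)\<close> perturbs
  \<open>R\<close> by \<open>O(\<epsilon>)\<close>. As \<open>\<epsilon> log (1/\<epsilon>)\<close> tends to \<open>0\<close>, the perturbation lemma passes beyond \<open>\<rho>\<close>
  unless \<open>\<rho>\<close> is the largest possible radius.
\<close>

lemma summable_renewal_seq:
  assumes R0: "R 0 = 0" and summ: "summable (\<lambda>n. norm (R n))"
    and G: "\<And>z. cmod z < 1 \<Longrightarrow> (1 - gen R z) * G z = 1"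
    and bdd: "\<And>r. r < 1 \<Longrightarrow> \<exists>B. \<forall>z. cmod z \<le> r \<longrightarrow> norm (G z) \<le> B"
    and r0: "0 \<le> r0" "r0 < 1"
  shows "summable (\<lambda>n. norm (renewal_seq R n) * r0 ^ n)"
proof -
  let ?T = "renewal_seq R"
  define r where "r = (r0 + 1) / 2"
  have r: "0 < r" "r0 < r" "r < 1" using r0 by (auto simp: r_def)
  define L where "L = (\<Sum>n. norm (R n)) / (1 - r)\<^sup>2"
  have L0: "0 \<le> L" unfolding L_def by (intro divide_nonneg_nonneg suminf_nonneg summ) auto
  define S where "S = {s \<in> {0..r}. summable (\<lambda>n. norm (?T n) * s ^ n)}"
  have step: "t \<in> S" if st: "s \<in> S" "s \<le> t" "t \<le> r" "(\<Sum>n. norm (?T n) * s ^ n) \<le> W"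
    and small: "(1 + W) * (L * (t - s)) < 1" for s t W
  proof -
    let ?R = "\<lambda>s n. s ^ n *\<^sub>R R n"
    have s: "0 \<le> s" "summable (\<lambda>n. norm (?T n) * s ^ n)" using st by (auto simp: S_def)
    have le: "norm (?R t n - ?R s n) \<le> norm (R n) / (1 - r)\<^sup>2 * (t - s)" for n
    proof -
      have "norm (?R t n - ?R s n) = (t ^ n - s ^ n) * norm (R n)"
        using power_mono[OF st(2) s(1), of n] by (simp flip: scaleR_diff_left)
      also have "\<dots> \<le> (real n * r ^ (n - 1) * (t - s)) * norm (R n)"
        using st s by (intro mult_right_mono power_diff_le) auto
      also have "\<dots> \<le> (1 / (1 - r)\<^sup>2 * (t - s)) * norm (R n)"
        using st r by (intro mult_right_mono of_nat_mult_power_le) auto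
      finally show ?thesis by (simp add: mult_ac)
    qed
    have sums: "(\<lambda>n. norm (R n) / (1 - r)\<^sup>2 * (t - s)) sums (L * (t - s))"
      unfolding L_def by (intro sums_mult2 sums_divide summable_sums summ)
    have "summable (\<lambda>n. norm (renewal_seq (?R t) n))"
    proof (rule summable_renewal_seq_perturb[where R = "?R s" and \<delta> = "L * (t - s)"])
      show "summable (\<lambda>n. norm (?R t n - ?R s n))"
        using le by (intro summable_comparison_test'[OF sums_summable[OF sums]]) auto
      from suminf_le[OF le this sums_summable[OF sums]]
      show "(\<Sum>n. norm (?R t n - ?R s n)) \<le> L * (t - s)"
        by (simp only: sums_unique[OF sums])
      show "summable (\<lambda>n. norm (renewal_seq (?R s) n))" "(\<Sum>n. norm (renewal_seq (?R s) n)) \<le> W"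
        using s st(4) by (simp_all add: renewal_seq_scale mult.commute[of "s ^ _"])
    qed (use R0 small in simp_all)
    then show ?thesis
      using s st by (simp add: S_def renewal_seq_scale mult.commute[of "t ^ _"])
  qed
  have S0: "0 \<in> S" using r by (simp add: S_def)
  define \<rho> where "\<rho> = Sup S"
  have bdd_S: "bdd_above S" by (rule bdd_aboveI[of _ r]) (auto simp: S_def)
  have below: "s \<in> S" if s: "0 \<le> s" "s < \<rho>" for s
  proof -
    obtain t where t: "t \<in> S" "s < t"
      using less_cSupE[of s S] s S0 unfolding \<rho>_def by (metis empty_iff)
    have "summable (\<lambda>n. norm (?T n) * s ^ n)"
    proof (rule summable_comparison_test')
      show "summable (\<lambda>n. norm (?T n) * t ^ n)" using t by (simp add: S_def)
      show "norm (norm (?T n) * s ^ n) \<le> norm (?T n) * t ^ n" for n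
        using that t by (simp add: mult_left_mono power_mono)
    qed
    then show ?thesis using that t by (auto simp: S_def)
  qed
  have \<rho>: "0 < \<rho>"
  proof -
    define W where "W = norm (1::'x)"
    have W0: "0 \<le> W" by (simp add: W_def)
    have "(\<lambda>n. norm (?T n) * 0 ^ n) sums (norm (?T 0))"
      using powser_sums_zero[of "\<lambda>n. norm (?T n)"] by simp
    then have W: "(\<Sum>n. norm (?T n) * 0 ^ n) \<le> W" by (simp add: sums_iff W_def)
    have "((\<lambda>t. (1 + W) * (L * t)) \<longlongrightarrow> (1 + W) * (L * 0)) (at_right 0)"
      by (intro tendsto_intros)
    then have "\<forall>\<^sub>F t in at_right 0. (1 + W) * (L * t) < 1"
      by (rule order_tendstoD) simp
    moreover have "\<forall>\<^sub>F t in at_right 0. t \<in> {0<..<r}" using r by (intro eventually_at_right_real)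
    ultimately have "\<forall>\<^sub>F t in at_right 0. t \<in> {0<..<r} \<and> (1 + W) * (L * t) < 1"
      by eventually_elim auto
    then obtain t where t: "t \<in> {0<..<r}" "(1 + W) * (L * t) < 1"
      using eventually_happens[of _ "at_right (0::real)"] by (auto simp: trivial_limit_at_right_real)
    have "t \<in> S" using step[OF S0 _ _ W, of t] t by auto
    then have "t \<le> \<rho>" unfolding \<rho>_def by (rule cSup_upper[OF _ bdd_S])
    then show ?thesis using t by auto
  qed
  have "r0 < \<rho>"
  proof (rule ccontr)
    assume "\<not> r0 < \<rho>"
    then have \<rho>_less: "\<rho> < r" using r by linarith
    obtain B where B: "\<And>z. cmod z \<le> r \<Longrightarrow> norm (G z) \<le> B" using bdd[OF r(3)] by blast
    define K where "K = scal_bound * (B * (scal_bound * ((\<Sum>n. norm (R n)) / (1 - r)\<^sup>2) * pi) * B)"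
    have K: "norm (?T n) * s ^ n \<le> K / real n" if "s \<in> S" "0 < n" for n s
      unfolding K_def using renewal_seq_coefficient_bound[OF R0 summ G B, of r s n] that r by (auto simp: S_def)
    define W where "W \<epsilon> = norm (1::'x) + K * (- ln \<epsilon>)" for \<epsilon> :: real
    have "((\<lambda>\<epsilon>. (1 + W \<epsilon>) * (L * (3 * \<rho> * \<epsilon>))) \<longlongrightarrow> 0) (at_right 0)"
      unfolding W_def by real_asymp
    then have "\<forall>\<^sub>F \<epsilon> in at_right 0. (1 + W \<epsilon>) * (L * (3 * \<rho> * \<epsilon>)) < 1"
      by (rule order_tendstoD) simp
    moreover have "\<forall>\<^sub>F \<epsilon> in at_right 0. \<epsilon> \<in> {0<..<min 1 ((r - \<rho>) / \<rho>)}"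
      using \<rho> \<rho>_less by (intro eventually_at_right_real) auto
    ultimately have "\<forall>\<^sub>F \<epsilon> in at_right 0. \<epsilon> \<in> {0<..<min 1 ((r - \<rho>) / \<rho>)} \<and>
        (1 + W \<epsilon>) * (L * (3 * \<rho> * \<epsilon>)) < 1"
      by eventually_elim auto
    then obtain \<epsilon> where \<epsilon>: "0 < \<epsilon>" "\<epsilon> < 1" "\<epsilon> < (r - \<rho>) / \<rho>" "(1 + W \<epsilon>) * (L * (3 * \<rho> * \<epsilon>)) < 1"
      using eventually_happens[of _ "at_right (0::real)"] by (auto simp: trivial_limit_at_right_real)
    \<comment> \<open>One factor \<open>1 - \<epsilon>\<close> stays below the supremum, where the coefficients are bounded by \<open>K / n\<close>;
      the other one makes the sum of \<open>(1 - \<epsilon>)\<^sup>n / n\<close> converge, to \<open>- log \<epsilon>\<close>.\<close>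
    define s1 s t where "s1 = \<rho> * (1 - \<epsilon>)" and "s = s1 * (1 - \<epsilon>)" and "t = \<rho> * (1 + \<epsilon>)"
    have ord: "s1 < \<rho>" "\<rho> < t" "t < r"
      using \<epsilon> \<rho> by (auto simp: s1_def t_def field_simps)
    have "0 < s1" using \<epsilon> \<rho> by (simp add: s1_def)
    then have "0 < s" "s < s1" using \<epsilon> by (simp_all add: s_def)
    note ord = this ord
    have s1S: "s1 \<in> S" using below[of s1] ord by auto
    have sS: "s \<in> S" using below[of s] ord by auto
    have lns: "(\<lambda>n. (1 - \<epsilon>) ^ n / real n) sums (- ln \<epsilon>)"
      using sums_minus[OF ln_series'[of "\<epsilon> - 1"]] \<epsilon> by simp
    define M where "M n = (if n = 0 then norm (1::'x) else 0) + K * ((1 - \<epsilon>) ^ n / real n)" for n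
    have M: "M sums W \<epsilon>"
      unfolding M_def W_def
      using sums_If_finite_set[of "{0::nat}" "\<lambda>_. norm (1::'x)"] by (intro sums_add sums_mult lns) simp
    have le: "norm (?T n) * s ^ n \<le> M n" for n
    proof (cases "n = 0")
      case False
      have "norm (?T n) * s ^ n = (norm (?T n) * s1 ^ n) * (1 - \<epsilon>) ^ n"
        by (simp add: s_def power_mult_distrib)
      also have "\<dots> \<le> K / real n * (1 - \<epsilon>) ^ n"
        using K[OF s1S, of n] False \<epsilon> by (intro mult_right_mono) auto
      finally show ?thesis using False by (simp add: M_def)
    qed (simp add: M_def)
    have "(\<Sum>n. norm (?T n) * s ^ n) \<le> suminf M"
      using sS le sums_summable[OF M] by (intro suminf_le) (auto simp: S_def)
    then have "(\<Sum>n. norm (?T n) * s ^ n) \<le> W \<epsilon>"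
      using sums_unique[OF M] by simp
    moreover have "0 \<le> 1 + W \<epsilon>"
    proof -
      have "0 \<le> (\<Sum>n. norm (?T n) * s ^ n)" using sS ord by (intro suminf_nonneg) (auto simp: S_def)
      then show ?thesis using calculation by linarith
    qed
    then have "(1 + W \<epsilon>) * (L * (t - s)) \<le> (1 + W \<epsilon>) * (L * (3 * \<rho> * \<epsilon>))"
    proof (intro mult_left_mono L0)
      show "t - s \<le> 3 * \<rho> * \<epsilon>"
        using \<rho> \<epsilon>(1) by (simp add: t_def s_def s1_def algebra_simps)
    qed
    ultimately have "t \<in> S" using ord \<epsilon>(4) by (intro step[OF sS]) auto
    then have "t \<le> \<rho>" unfolding \<rho>_def by (rule cSup_upper[OF _ bdd_S])
    then show False using ord by simp
  qed
  then show ?thesis using below[OF r0(1)] by (simp add: S_def)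
qed

end

section \<open>Return time distributions with tail close to c/n\<close>

text \<open>
  The tail condition concerns positive indices only; \<open>H 0 = 0\<close> normalises the sums over \<open>H\<close>.
\<close>

locale renewal_tail =
  fixes f :: "nat \<Rightarrow> real" and c q :: real and H :: "nat \<Rightarrow> real"
  assumes f_nonneg: "0 \<le> f n" and f_0 [simp]: "f 0 = 0" and f_sums: "f sums 1"
    and c_pos: "0 < c" and q_gt_1: "1 < q"
    and H_0 [simp]: "H 0 = 0" and H_bigo: "H \<in> O(\<lambda>n. real n powr (-q))"
    and tail_law: "0 < n \<Longrightarrow> 1 - (\<Sum>k\<le>n. f k) = c * (1 / real n + H n)"
begin

definition tail :: "nat \<Rightarrow> real" where
  "tail n = 1 - (\<Sum>k\<le>n. f k)"

lemma tail_0 [simp]: "tail 0 = 1"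
  by (simp add: tail_def)

lemma tail_Suc: "tail (Suc n) = tail n - f (Suc n)"
  by (simp add: tail_def)

lemma tail_eq: "0 < n \<Longrightarrow> tail n = c * (1 / real n + H n)"
  by (simp add: tail_def tail_law)

lemma tail_nonneg: "0 \<le> tail n"
  using sum_le_suminf[of f "{..n}"] f_nonneg f_sums by (auto simp: tail_def sums_iff)

lemma tail_sums: "(\<lambda>k. f (k + Suc n)) sums tail n"
proof -
  have "(\<lambda>k. f (k + Suc n)) sums (1 - (\<Sum>k<Suc n. f k))"
    by (rule sums_split_initial_segment[OF f_sums])
  then show ?thesis by (simp only: tail_def lessThan_Suc_atMost)
qed

lemma summable_abs_H: "summable (\<lambda>n. \<bar>H n\<bar>)"
proof (rule summable_comparison_test_bigo)
  show "summable (\<lambda>n. norm (real n powr (-q)))"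
    using q_gt_1 by (simp add: summable_real_powr_iff)
  show "(\<lambda>n. \<bar>H n\<bar>) \<in> O(\<lambda>n. real n powr (-q))" using H_bigo by simp
qed

lemma tail_bound: obtains A where "0 < A" "\<And>n. 0 < n \<Longrightarrow> tail n \<le> A / real n"
proof -
  have "(\<lambda>n. real n powr (-q)) \<in> O(\<lambda>n. 1 / real n)"
    using q_gt_1 by real_asymp
  then have "H \<in> O(\<lambda>n. 1 / real n)" using H_bigo landau_o.big_trans by blast
  then obtain K where K: "K > 0" "eventually (\<lambda>n. \<bar>H n\<bar> \<le> K * \<bar>1 / real n\<bar>) sequentially"
    by (elim landau_o.bigE) auto
  then obtain N where N: "\<And>n. n \<ge> N \<Longrightarrow> \<bar>H n\<bar> \<le> K / real n"
    by (auto simp: eventually_sequentially)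
  define A where "A = max (c * (1 + K)) (real N + 1)"
  show ?thesis
  proof (rule that[of A])
    show "0 < A" by (auto simp: A_def)
    fix n :: nat assume n: "0 < n"
    show "tail n \<le> A / real n"
    proof (cases "n \<ge> N")
      case True
      have "tail n \<le> c * (1 / real n + K / real n)"
        using tail_eq[OF n] N[OF True] c_pos by (auto intro!: mult_left_mono)
      also have "\<dots> = c * (1 + K) / real n" by (simp add: add_divide_distrib algebra_simps)
      also have "\<dots> \<le> A / real n" by (intro divide_right_mono) (auto simp: A_def)
      finally show ?thesis .
    next
      case False
      have "tail n \<le> 1" using f_nonneg by (simp add: tail_def sum_nonneg)
      also have "1 \<le> A / real n" using False n by (simp add: A_def)
      finally show ?thesis .
    qed
  qed
qed

text \<open>
  Summation by parts; the mean itself is infinite.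
\<close>

lemma truncated_mean: "(\<Sum>k\<le>N. real k * f k) \<le> (\<Sum>j<N. tail j)"
proof -
  have "(\<Sum>k\<le>N. real k * f k) = (\<Sum>j<N. tail j) - real N * tail N"
  proof (induction N)
    case (Suc N)
    then show ?case by (simp add: tail_Suc algebra_simps)
  qed simp
  then show ?thesis using tail_nonneg[of N] by simp
qed

text \<open>
  Cut at \<open>n\<close> near \<open>2/x\<close>: beyond it the sum is at most twice the tail, which is \<open>O(x)\<close>, and
  below it the truncated mean grows like \<open>log (1/x)\<close>.
\<close>

lemma truncated_mean_modulus:
  obtains K where "0 < K"
    "\<And>x. 0 \<le> x \<Longrightarrow> x \<le> 2 \<Longrightarrow> (\<Sum>n. f n * min 2 (real n * x)) \<le> K * ell x"
proof -
  obtain A where A: "0 < A" "\<And>n. 0 < n \<Longrightarrow> tail n \<le> A / real n" by (rule tail_bound) (rule that)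
  define K where "K = 1 + 3 * A"
  show ?thesis
  proof (rule that[of K])
    show "0 < K" using A by (simp add: K_def)
    fix x :: real assume x: "0 \<le> x" "x \<le> 2"
    show "(\<Sum>n. f n * min 2 (real n * x)) \<le> K * ell x"
    proof (cases "x = 0")
      case True
      then show ?thesis by simp
    next
      case False
      then have x0: "0 < x" using x by simp
      define N where "N = nat \<lceil>2 / x\<rceil>"
      have N: "2 / x \<le> real N" unfolding N_def by linarith
      have N0: "0 < N" using N x0 by (cases "N = 0") auto
      have N1: "real N \<le> 2 * (2 / x)"
      proof -
        have "1 \<le> 2 / x" using x x0 by simp
        then show ?thesis unfolding N_def by linarith
      qed
      have l0: "0 \<le> ln (2 / x)" using x x0 by simp
      have "summable (\<lambda>n. f n * min 2 (real n * x))"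
      proof (rule summable_comparison_test')
        show "summable (\<lambda>n. f n * 2)" using f_sums by (intro summable_mult2) (auto simp: sums_iff)
        show "norm (f n * min 2 (real n * x)) \<le> f n * 2" for n
          using f_nonneg[of n] x by (simp add: abs_mult mult_left_mono)
      qed
      then have "(\<Sum>n. f n * min 2 (real n * x)) =
          (\<Sum>n. f (n + Suc N) * min 2 (real (n + Suc N) * x)) + (\<Sum>n\<le>N. f n * min 2 (real n * x))"
        using suminf_split_initial_segment[of _ "Suc N"] by (simp only: lessThan_Suc_atMost)
      also have "\<dots> \<le> 2 * tail N + x * (\<Sum>j<N. tail j)"
      proof (rule add_mono)
        have s: "(\<lambda>n. f (n + Suc N) * 2) sums (tail N * 2)" by (intro sums_mult2 tail_sums)
        have le: "f (n + Suc N) * min 2 (real (n + Suc N) * x) \<le> f (n + Suc N) * 2" for n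
          using f_nonneg by (intro mult_left_mono) auto
        have "summable (\<lambda>n. f (n + Suc N) * min 2 (real (n + Suc N) * x))"
          by (rule summable_comparison_test'[OF sums_summable[OF s]])
             (use le f_nonneg x in \<open>auto simp: abs_mult\<close>)
        from suminf_le[OF le this sums_summable[OF s]]
        show "(\<Sum>n. f (n + Suc N) * min 2 (real (n + Suc N) * x)) \<le> 2 * tail N"
          using sums_unique[OF s] by (simp add: mult.commute)
        have "(\<Sum>n\<le>N. f n * min 2 (real n * x)) \<le> (\<Sum>n\<le>N. x * (real n * f n))"
        proof (rule sum_mono)
          fix n
          have "f n * min 2 (real n * x) \<le> f n * (real n * x)"
            using f_nonneg by (intro mult_left_mono) auto
          then show "f n * min 2 (real n * x) \<le> x * (real n * f n)" by (simp add: mult_ac)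
        qed
        also have "\<dots> \<le> x * (\<Sum>j<N. tail j)"
          unfolding sum_distrib_left[symmetric] using truncated_mean x by (intro mult_left_mono)
        finally show "(\<Sum>n\<le>N. f n * min 2 (real n * x)) \<le> x * (\<Sum>j<N. tail j)" .
      qed
      also have "\<dots> \<le> A * x + x * (1 + A * (2 + ln (2 / x)))"
      proof (intro add_mono mult_left_mono)
        have "tail N \<le> A / real N" by (rule A(2)[OF N0])
        also have "\<dots> \<le> A / (2 / x)" using N N0 x0 A(1) by (intro divide_left_mono) auto
        finally show "2 * tail N \<le> A * x" by simp
        have "(\<Sum>j<N. tail j) \<le> 1 + A * harm N"
        proof -
          obtain M where M: "N = Suc M" using N0 by (cases N) auto
          have "(\<Sum>j<N. tail j) = 1 + (\<Sum>j=1..M. tail j)"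
            unfolding M by (subst sum.lessThan_Suc_shift) (simp add: sum.atLeast1_atMost_eq)
          also have "(\<Sum>j=1..M. tail j) \<le> (\<Sum>j=1..M. A * inverse (real j))"
            using A(2) by (intro sum_mono) (auto simp: field_simps)
          also have "\<dots> = A * harm M" by (simp add: harm_def sum_distrib_left)
          also have "\<dots> \<le> A * harm N" using A(1) M by (intro mult_left_mono harm_mono) auto
          finally show ?thesis by simp
        qed
        moreover have "harm N \<le> 1 + ln (real N)"
        proof -
          obtain M where M: "N = Suc M" using N0 by (cases N) auto
          show ?thesis using decseqD[OF decseq_harm_diff_ln, of 0 M] M by (simp add: harm_expand)
        qed
        moreover have "ln (real N) \<le> 1 + ln (2 / x)"
        proof -
          have "ln (real N) \<le> ln (2 * (2 / x))" using N1 N0 x0 by (subst ln_le_cancel_iff) auto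
          also have "\<dots> = ln 2 + ln (2 / x)" using x0 by (subst ln_mult) auto
          finally show ?thesis using ln2_le_25_over_36 by linarith
        qed
        ultimately have "(\<Sum>j<N. tail j) \<le> 1 + A * harm N" "harm N \<le> 2 + ln (2 / x)" by linarith+
        then show "(\<Sum>j<N. tail j) \<le> 1 + A * (2 + ln (2 / x))"
          using mult_left_mono[of "harm N" "2 + ln (2 / x)" A] A(1) by linarith
      qed (use x in auto)
      also have "\<dots> \<le> K * ell x"
      proof -
        have "x * (1 + 3 * A + A * ln (2 / x)) \<le> x * ((1 + 3 * A) * (1 + ln (2 / x)))"
          using x l0 A(1) by (intro mult_left_mono) (auto simp: algebra_simps)
        then show ?thesis by (simp add: K_def ell_def algebra_simps)
      qed
      finally show ?thesis .
    qed
  qed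
qed

text \<open>
  This estimate serves every power series whose coefficients are dominated by \<open>f\<close>, in
  particular the operator-valued one, since \<open>|z\<^sup>n - w\<^sup>n| \<le> min 2 (n |z - w|)\<close> in the closed
  disc.
\<close>

lemma power_modulus:
  obtains K where "0 < K" "\<And>z w :: complex. cmod z \<le> 1 \<Longrightarrow> cmod w \<le> 1 \<Longrightarrow>
      summable (\<lambda>n. f n * cmod (z ^ n - w ^ n)) \<and>
      (\<Sum>n. f n * cmod (z ^ n - w ^ n)) \<le> K * ell (cmod (z - w))"
proof -
  obtain K where K: "0 < K"
    "\<And>x. 0 \<le> x \<Longrightarrow> x \<le> 2 \<Longrightarrow> (\<Sum>n. f n * min 2 (real n * x)) \<le> K * ell x"
    by (rule truncated_mean_modulus) (rule that)
  show ?thesis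
  proof (rule that[OF K(1)], goal_cases)
    case (1 z w)
    define x where "x = cmod (z - w)"
    have x: "0 \<le> x" "x \<le> 2"
      using norm_triangle_ineq4[of z w] 1 by (auto simp: x_def)
    have le: "f n * cmod (z ^ n - w ^ n) \<le> f n * min 2 (real n * x)" for n
    proof (intro mult_left_mono f_nonneg min.boundedI)
      have "cmod (z ^ n - w ^ n) \<le> cmod z ^ n + cmod w ^ n"
        using norm_triangle_ineq4[of "z ^ n" "w ^ n"] by (simp add: norm_power)
      also have "\<dots> \<le> 1 + 1" using 1 by (intro add_mono power_le_one) auto
      finally show "cmod (z ^ n - w ^ n) \<le> 2" by simp
      show "cmod (z ^ n - w ^ n) \<le> real n * x"
        unfolding x_def using 1 by (intro norm_power_diff)
    qed
    have s: "summable (\<lambda>n. f n * min 2 (real n * x))"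
    proof (rule summable_comparison_test')
      show "summable (\<lambda>n. f n * 2)" using f_sums by (intro summable_mult2) (auto simp: sums_iff)
      show "norm (f n * min 2 (real n * x)) \<le> f n * 2" for n
        using f_nonneg[of n] x by (simp add: abs_mult mult_left_mono)
    qed
    have s': "summable (\<lambda>n. f n * cmod (z ^ n - w ^ n))"
      by (rule summable_comparison_test'[OF s]) (use le f_nonneg in \<open>auto simp: abs_mult\<close>)
    from suminf_le[OF le s' s] K(2)[OF x] s' show ?case by (simp add: x_def)
  qed
qed

definition psi :: "complex \<Rightarrow> complex" where
  "psi z = (\<Sum>n. of_real (f n) * z ^ n)"

lemma psi_sums: "cmod z \<le> 1 \<Longrightarrow> (\<lambda>n. of_real (f n) * z ^ n) sums psi z"
proof -
  assume z: "cmod z \<le> 1"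
  have "summable (\<lambda>n. norm (of_real (f n) * z ^ n))"
  proof (rule summable_comparison_test')
    show "summable f" using f_sums by (auto simp: sums_iff)
    show "norm (norm (of_real (f n) * z ^ n)) \<le> f n" for n
      using f_nonneg[of n] z mult_left_mono[OF power_le_one[of "cmod z" n], of "f n"]
      by (simp add: norm_mult norm_power)
  qed
  then show ?thesis unfolding psi_def by (rule summable_sums[OF summable_norm_cancel])
qed

lemma psi_1 [simp]: "psi 1 = 1"
proof -
  have "(\<lambda>n. of_real (f n)) sums (of_real 1 :: complex)"
    using f_sums by (rule sums_of_real)
  then show ?thesis by (simp add: psi_def sums_iff)
qed

lemma psi_modulus:
  obtains K where "0 < K" "\<And>z w. cmod z \<le> 1 \<Longrightarrow> cmod w \<le> 1 \<Longrightarrow>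
    cmod (psi z - psi w) \<le> K * ell (cmod (z - w))"
proof -
  obtain K where K: "0 < K" "\<And>z w :: complex. cmod z \<le> 1 \<Longrightarrow> cmod w \<le> 1 \<Longrightarrow>
      summable (\<lambda>n. f n * cmod (z ^ n - w ^ n)) \<and>
      (\<Sum>n. f n * cmod (z ^ n - w ^ n)) \<le> K * ell (cmod (z - w))"
    by (rule power_modulus) (rule that)
  show ?thesis
  proof (rule that[OF K(1)])
    fix z w :: complex assume zw: "cmod z \<le> 1" "cmod w \<le> 1"
    have "cmod (psi z - psi w) \<le> (\<Sum>n. f n * cmod (z ^ n - w ^ n))"
    proof (rule norm_sums_le)
      show "(\<lambda>n. of_real (f n) * z ^ n - of_real (f n) * w ^ n) sums (psi z - psi w)"
        using zw by (intro sums_diff psi_sums)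
      show "(\<lambda>n. f n * cmod (z ^ n - w ^ n)) sums (\<Sum>n. f n * cmod (z ^ n - w ^ n))"
        using K(2)[OF zw] by (simp add: summable_sums)
      show "cmod (of_real (f n) * z ^ n - of_real (f n) * w ^ n) \<le> f n * cmod (z ^ n - w ^ n)" for n
        using f_nonneg[of n] by (simp add: norm_mult flip: right_diff_distrib)
    qed
    then show "cmod (psi z - psi w) \<le> K * ell (cmod (z - w))" using K(2)[OF zw] by linarith
  qed
qed

text \<open>
  Summation by parts: \<open>\<tau>\<close> is the generating function of the tails.
\<close>

lemma one_minus_psi_factor:
  assumes z: "cmod z < 1"
  obtains \<tau> where "1 - psi z = (1 - z) * \<tau>" "(\<lambda>n. of_real (tail n) * z ^ n) sums \<tau>"
proof -
  have tl1: "tail n \<le> 1" for n using f_nonneg by (simp add: tail_def sum_nonneg)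
  have "summable (\<lambda>n. norm (of_real (tail n) * z ^ n))"
  proof (rule summable_comparison_test')
    show "summable (\<lambda>n. cmod z ^ n)" using z by (intro summable_geometric) auto
    show "norm (norm (of_real (tail n) * z ^ n)) \<le> cmod z ^ n" for n
      using tl1[of n] tail_nonneg[of n] mult_right_mono[of "tail n" 1 "cmod z ^ n"]
      by (simp add: norm_mult norm_power)
  qed
  then obtain \<tau> where \<tau>: "(\<lambda>n. of_real (tail n) * z ^ n) sums \<tau>"
    by (rule that[OF summable_sums[OF summable_norm_cancel]])
  have 1: "(\<lambda>n. of_real (tail (Suc n)) * z ^ Suc n) sums (\<tau> - 1)"
    using \<tau> by (subst sums_Suc_iff) simp
  have 2: "(\<lambda>n. z * (of_real (tail n) * z ^ n)) sums (z * \<tau>)"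
    by (intro sums_mult \<tau>)
  have 3: "(\<lambda>n. of_real (f (Suc n)) * z ^ Suc n) sums (psi z)"
    using psi_sums[of z] z by (subst sums_Suc_iff) simp
  have "(\<lambda>n. z * (of_real (tail n) * z ^ n) - of_real (tail (Suc n)) * z ^ Suc n) sums (z * \<tau> - (\<tau> - 1))"
    by (intro sums_diff 1 2)
  moreover have "(\<lambda>n. z * (of_real (tail n) * z ^ n) - of_real (tail (Suc n)) * z ^ Suc n) =
      (\<lambda>n. of_real (f (Suc n)) * z ^ Suc n)"
    by (simp add: tail_Suc algebra_simps)
  ultimately have "psi z = z * \<tau> - (\<tau> - 1)" using 3 sums_unique2 by metis
  then show ?thesis using that[of \<tau>] \<tau> by (simp add: algebra_simps)
qed

text \<open>
  The leading part \<open>c \<Sum>\<^sub>n z\<^sup>n / n = - c log (1 - z)\<close> of the tail series has real part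
  \<open>c log (1 / |1 - z|)\<close>; the remaining series converges absolutely.
\<close>

lemma Re_tail_series_ge:
  assumes z: "cmod z < 1" and \<tau>: "(\<lambda>n. of_real (tail n) * z ^ n) sums \<tau>"
  shows "c * (ln (1 / cmod (1 - z)) - (\<Sum>n. \<bar>H n\<bar>)) \<le> Re \<tau>"
proof -
  have z1: "1 - z \<noteq> 0" using z by auto
  have "(\<lambda>n. - ((- (- z)) ^ n) / of_nat n) sums Ln (1 + (- z))"
    using z by (intro Ln_series') simp
  then have L: "(\<lambda>n. z ^ n / of_nat n) sums - Ln (1 - z)"
    using sums_minus by fastforce
  have summ: "summable (\<lambda>n. norm (of_real (H n) * z ^ n))"
  proof (rule summable_comparison_test'[OF summable_abs_H])
    show "norm (norm (of_real (H n) * z ^ n)) \<le> \<bar>H n\<bar>" for n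
      using z mult_left_mono[OF power_le_one[of "cmod z" n], of "\<bar>H n\<bar>"]
      by (simp add: norm_mult norm_power)
  qed
  then obtain h where h: "(\<lambda>n. of_real (H n) * z ^ n) sums h"
    by (rule that[OF summable_sums[OF summable_norm_cancel]])
  have "cmod h \<le> (\<Sum>n. \<bar>H n\<bar>)"
  proof (rule norm_sums_le[OF h summable_sums[OF summable_abs_H]])
    show "cmod (of_real (H n) * z ^ n) \<le> \<bar>H n\<bar>" for n
      using z mult_left_mono[OF power_le_one[of "cmod z" n], of "\<bar>H n\<bar>"]
      by (simp add: norm_mult norm_power)
  qed
  then have h_ge: "- (\<Sum>n. \<bar>H n\<bar>) \<le> Re h" using abs_Re_le_cmod[of h] by linarith
  have "(\<lambda>n. if n = 0 then 1 else 0 :: complex) sums 1"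
    using sums_If_finite_set[of "{0::nat}" "\<lambda>_. 1::complex"] by simp
  then have "(\<lambda>n. (if n = 0 then 1 else 0) + of_real c * (z ^ n / of_nat n + of_real (H n) * z ^ n))
      sums (1 + of_real c * (- Ln (1 - z) + h))"
    by (intro sums_add sums_mult L h)
  moreover have "(if n = 0 then 1 else 0) + of_real c * (z ^ n / of_nat n + of_real (H n) * z ^ n) =
      of_real (tail n) * z ^ n" for n
    using tail_eq[of n] by (cases "n = 0") (auto simp: algebra_simps)
  ultimately have "\<tau> = 1 + of_real c * (- Ln (1 - z) + h)"
    using \<tau> sums_unique2 by fastforce
  then have "Re \<tau> = 1 + c * (ln (1 / cmod (1 - z)) + Re h)"
    using z1 by (simp add: Re_Ln ln_div)
  also have "\<dots> \<ge> c * (ln (1 / cmod (1 - z)) - (\<Sum>n. \<bar>H n\<bar>))"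
  proof -
    have "c * (ln (1 / cmod (1 - z)) - (\<Sum>n. \<bar>H n\<bar>)) \<le> c * (ln (1 / cmod (1 - z)) + Re h)"
      using h_ge c_pos by (intro mult_left_mono) auto
    then show ?thesis by linarith
  qed
  finally show ?thesis .
qed

lemma one_minus_psi_lower_bound_near_1:
  obtains \<delta> where "0 < \<delta>" "\<And>z. cmod z < 1 \<Longrightarrow> cmod (1 - z) \<le> \<delta> \<Longrightarrow>
    c / 2 * ell (cmod (1 - z)) \<le> cmod (1 - psi z)"
proof -
  define S where "S = (\<Sum>n. \<bar>H n\<bar>)"
  have S0: "0 \<le> S" unfolding S_def by (intro suminf_nonneg summable_abs_H) auto
  show ?thesis
  \<comment> \<open>For such \<open>x = |1 - z|\<close> the logarithm \<open>log (1/x)\<close> is at least \<open>2 S + 2\<close>, so that half of it absorbs both \<open>S\<close>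
    and the constants in \<open>ell\<close>.\<close>
  proof (rule that[of "exp (- (2 * S + 2))"])
    fix z assume z: "cmod z < 1" "cmod (1 - z) \<le> exp (- (2 * S + 2))"
    define x where "x = cmod (1 - z)"
    have x0: "0 < x" using z by (auto simp: x_def)
    have "ln x \<le> ln (exp (- (2 * S + 2)))"
      using z(2) x0 by (subst ln_le_cancel_iff) (auto simp: x_def)
    then have lx: "2 * S + 2 \<le> ln (1 / x)" using x0 by (simp add: ln_div)
    obtain \<tau> where \<tau>: "1 - psi z = (1 - z) * \<tau>" "(\<lambda>n. of_real (tail n) * z ^ n) sums \<tau>"
      using one_minus_psi_factor[OF z(1)] by blast
    have "c / 2 * (1 + ln (2 / x)) \<le> c * (ln (1 / x) - S)"
    proof -
      have "ln (2 / x) = ln 2 + ln (1 / x)" using x0 by (simp add: ln_div)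
      then have "1 + ln (2 / x) \<le> 2 * (ln (1 / x) - S)"
        using lx ln2_le_25_over_36 unfolding distrib_left[of 2] right_diff_distrib by linarith
      then have "c / 2 * (1 + ln (2 / x)) \<le> c / 2 * (2 * (ln (1 / x) - S))"
        using c_pos by (intro mult_left_mono) auto
      then show ?thesis by (simp add: algebra_simps)
    qed
    also have "\<dots> \<le> Re \<tau>" unfolding x_def S_def by (rule Re_tail_series_ge[OF z(1) \<tau>(2)])
    also have "\<dots> \<le> cmod \<tau>" by (rule complex_Re_le_cmod)
    finally have "x * (c / 2 * (1 + ln (2 / x))) \<le> x * cmod \<tau>"
      using x0 by (intro mult_left_mono) auto
    then show "c / 2 * ell (cmod (1 - z)) \<le> cmod (1 - psi z)"
      by (simp add: \<tau>(1) norm_mult ell_def x_def mult_ac)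
  qed simp
qed

end

section \<open>The increments of the scalar renewal sequence\<close>

lemma continuous_on_ell_modulus:
  fixes g :: "'a::metric_space \<Rightarrow> 'b::metric_space"
  assumes "0 < K" "\<And>z w. z \<in> S \<Longrightarrow> w \<in> S \<Longrightarrow> dist (g z) (g w) \<le> K * ell (dist z w)"
  shows "continuous_on S g"
  unfolding continuous_on_iff
proof (intro ballI allI impI)
  fix w e assume w: "w \<in> S" and e: "0 < (e::real)"
  have "\<forall>\<^sub>F x in at_right 0. ell x < e / K"
    using e assms(1) by (intro order_tendstoD(2)[OF ell_tendsto_0]) auto
  then obtain d where d: "0 < d" "\<And>x. 0 < x \<Longrightarrow> x < d \<Longrightarrow> ell x < e / K"
    by (auto simp: eventually_at_right_field)
  have "dist (g z) (g w) < e" if "z \<in> S" "dist z w < d" for z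
  proof (cases "z = w")
    case False
    then have "ell (dist z w) < e / K" using that by (intro d) auto
    then show ?thesis using assms(2)[OF that(1) w] assms(1) by (simp add: field_simps)
  qed (use e in simp)
  then show "\<exists>d>0. \<forall>z\<in>S. dist z w < d \<longrightarrow> dist (g z) (g w) < e" using d(1) by blast
qed

text \<open>
  From \<open>G z - G w = G z (A w - A z) G w\<close>, once \<open>G\<close> is known to be locally bounded, which
  follows from the same identity.
\<close>

lemma continuous_on_two_sided_inverse:
  fixes A G :: "'a::topological_space \<Rightarrow> 'b::{real_normed_algebra, monoid_mult}"
  assumes A: "continuous_on S A"
    and inv: "\<And>z. z \<in> S \<Longrightarrow> G z * A z = 1" "\<And>z. z \<in> S \<Longrightarrow> A z * G z = 1"
  shows "continuous_on S G"
  unfolding continuous_on_def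
proof
  fix w assume w: "w \<in> S"
  have diff: "G z - G w = G z * (A w - A z) * G w" if "z \<in> S" for z
  proof -
    have "G z * (A w - A z) * G w = G z * (A w * G w) - (G z * A z) * G w"
      by (simp add: algebra_simps)
    then show ?thesis using inv that w by simp
  qed
  have lim: "((\<lambda>z. norm (A w - A z)) \<longlongrightarrow> 0) (at w within S)"
  proof -
    have "((\<lambda>z. norm (A w - A z)) \<longlongrightarrow> norm (A w - A w)) (at w within S)"
      using A w by (intro tendsto_intros) (auto simp: continuous_on_def)
    then show ?thesis by simp
  qed
  have "((\<lambda>z. norm (A w - A z) * norm (G w)) \<longlongrightarrow> 0 * norm (G w)) (at w within S)"
    by (intro tendsto_intros lim)
  then have "\<forall>\<^sub>F z in at w within S. norm (A w - A z) * norm (G w) < 1 / 2"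
    by (rule order_tendstoD) simp
  moreover have "\<forall>\<^sub>F z in at w within S. z \<in> S"
    by (simp add: eventually_at_topological) blast
  ultimately have ev: "\<forall>\<^sub>F z in at w within S. norm (G z - G w) \<le> 2 * norm (G w) * norm (A w - A z) * norm (G w)"
  proof eventually_elim
    case (elim z)
    have n: "norm (G z - G w) \<le> norm (G z) * norm (A w - A z) * norm (G w)"
      unfolding diff[OF elim(2)]
      by (intro order.trans[OF norm_mult_ineq] mult_right_mono norm_mult_ineq) auto
    have "norm (G z) \<le> norm (G w) + norm (G z - G w)"
      using norm_triangle_sub[of "G z" "G w"] by simp
    also have "\<dots> \<le> norm (G w) + norm (G z) * (1 / 2)"
      using n elim(1) mult_left_mono[of "norm (A w - A z) * norm (G w)" "1 / 2" "norm (G z)"]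
      by (simp add: mult.assoc)
    finally have "norm (G z) \<le> 2 * norm (G w)" by simp
    then have "norm (G z) * (norm (A w - A z) * norm (G w)) \<le> 2 * norm (G w) * (norm (A w - A z) * norm (G w))"
      by (intro mult_right_mono) auto
    then show ?case using n by (simp add: mult.assoc)
  qed
  have "((\<lambda>z. 2 * norm (G w) * norm (A w - A z) * norm (G w)) \<longlongrightarrow> 2 * norm (G w) * 0 * norm (G w)) (at w within S)"
    by (intro tendsto_intros lim)
  then have "((\<lambda>z. 2 * norm (G w) * norm (A w - A z) * norm (G w)) \<longlongrightarrow> 0) (at w within S)"
    by simp
  with ev have "((\<lambda>z. G z - G w) \<longlongrightarrow> 0) (at w within S)"
    by (rule Lim_null_comparison)
  then show "(G \<longlongrightarrow> G w) (at w within S)" by (rule LIM_zero_cancel)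
qed

lemma compact_disc_minus_ball: "compact {z :: complex. cmod z \<le> 1 \<and> \<delta> \<le> cmod (1 - z)}"
proof -
  have "{z :: complex. cmod z \<le> 1 \<and> \<delta> \<le> cmod (1 - z)} = cball 0 1 \<inter> {z. \<delta> \<le> cmod (1 - z)}"
    by auto
  moreover have "closed {z. \<delta> \<le> cmod (1 - z)}"
    by (intro closed_Collect_le continuous_intros)
  ultimately show ?thesis by (simp add: compact_Int_closed)
qed

text \<open>
  A rotation by \<open>h \<le> |1 - z| / 2\<close> moves \<open>z\<close> by at most \<open>h\<close> and at most halves the distance to
  \<open>1\<close>.
\<close>

lemma ell_rotation:
  assumes "cmod z < 1" "0 < h" "2 * h \<le> cmod (1 - z)"
  shows "ell (cmod (z - z * cis h)) \<le> ell h" "ell (cmod (1 - z)) / 2 \<le> ell (cmod (1 - z * cis h))"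
proof -
  have x2: "cmod (1 - z) \<le> 2" using norm_triangle_ineq4[of 1 z] assms(1) by simp
  have "cmod (z - z * cis h) = cmod z * cmod (1 - cis h)"
    by (simp flip: norm_mult) (simp add: algebra_simps)
  also have "\<dots> \<le> 1 * h"
    using assms norm_one_minus_cis_le[of h] by (intro mult_mono) auto
  finally have d: "cmod (z - z * cis h) \<le> h" by simp
  then show "ell (cmod (z - z * cis h)) \<le> ell h"
    using assms x2 by (intro ell_mono) auto
  have "cmod (1 - z) \<le> cmod (1 - z * cis h) + cmod (z - z * cis h)"
    using norm_triangle_ineq[of "1 - z * cis h" "z * cis h - z"] by (simp add: norm_minus_commute)
  then have "cmod (1 - z) / 2 \<le> cmod (1 - z * cis h)" using d assms(3) by linarith
  moreover have "cmod (1 - z * cis h) \<le> 2"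
    using norm_triangle_ineq4[of 1 "z * cis h"] assms(1) by (simp add: norm_mult)
  ultimately have "ell (cmod (1 - z) / 2) \<le> ell (cmod (1 - z * cis h))"
    by (intro ell_mono) auto
  then show "ell (cmod (1 - z)) / 2 \<le> ell (cmod (1 - z * cis h))"
    using ell_half_ge[of "cmod (1 - z)"] by simp
qed

lemma renewal_seq_of_real:
  "renewal_seq (\<lambda>n. of_real (f n) :: 'a::{real_algebra_1}) n = of_real (renewal_seq f n)"
proof (induction n rule: less_induct)
  case (less n)
  then show ?case
    by (subst (1 2) renewal_seq.simps) (auto intro!: sum.cong)
qed

lemma scalar_algebra_complex: "scalar_algebra (\<lambda>z :: complex. z)"
  by (rule scalar_algebra.intro) (auto simp: bounded_linear_ident)

locale aperiodic_renewal_tail = renewal_tail +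
  assumes psi_neq_1: "cmod z \<le> 1 \<Longrightarrow> z \<noteq> 1 \<Longrightarrow> psi z \<noteq> 1"
begin

abbreviation u :: "nat \<Rightarrow> real" where "u \<equiv> renewal_seq f"

lemma u_bounds: "0 \<le> u n \<and> u n \<le> 1"
proof (induction n rule: less_induct)
  case (less n)
  show ?case
  proof (cases "n = 0")
    case False
    have u: "u n = (\<Sum>k = 1..n. u (n - k) * f k)" using False by (subst renewal_seq.simps) simp
    have "u n \<le> (\<Sum>k = 1..n. 1 * f k)"
      unfolding u using less f_nonneg False by (intro sum_mono mult_right_mono) auto
    also have "\<dots> \<le> (\<Sum>k\<le>n. f k)" using f_nonneg by (auto intro!: sum_mono2)
    also have "\<dots> \<le> 1" using tail_nonneg[of n] by (simp add: tail_def)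
    finally show ?thesis
      using less f_nonneg False unfolding u by (auto intro!: sum_nonneg)
  qed simp
qed

text \<open>
  Near \<open>1\<close> this is the logarithmic lower bound; away from \<open>1\<close> it follows from compactness and
  aperiodicity.
\<close>

lemma one_minus_psi_lower_bound:
  obtains \<kappa> where "0 < \<kappa>" "\<And>z. cmod z < 1 \<Longrightarrow> \<kappa> * ell (cmod (1 - z)) \<le> cmod (1 - psi z)"
proof -
  obtain \<delta> where \<delta>: "0 < \<delta>" "\<And>z. cmod z < 1 \<Longrightarrow> cmod (1 - z) \<le> \<delta> \<Longrightarrow>
    c / 2 * ell (cmod (1 - z)) \<le> cmod (1 - psi z)"
    by (rule one_minus_psi_lower_bound_near_1) (rule that)
  obtain K where K: "0 < K" "\<And>z w. cmod z \<le> 1 \<Longrightarrow> cmod w \<le> 1 \<Longrightarrow>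
    cmod (psi z - psi w) \<le> K * ell (cmod (z - w))"
    by (rule psi_modulus) (rule that)
  define D where "D = {z :: complex. cmod z \<le> 1 \<and> \<delta> \<le> cmod (1 - z)}"
  have cont: "continuous_on D psi"
    by (rule continuous_on_ell_modulus[OF K(1)]) (use K(2) in \<open>auto simp: D_def dist_norm\<close>)
  obtain m where m: "0 < m" "\<And>z. z \<in> D \<Longrightarrow> m \<le> cmod (1 - psi z)"
  proof (cases "D = {}")
    case False
    have "compact D" unfolding D_def by (rule compact_disc_minus_ball)
    then obtain z0 where z0: "z0 \<in> D" "\<And>z. z \<in> D \<Longrightarrow> cmod (1 - psi z0) \<le> cmod (1 - psi z)"
      using continuous_attains_inf[of D "\<lambda>z. cmod (1 - psi z)"] False cont
      by (fastforce intro!: continuous_intros)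
    have "z0 \<noteq> 1" using z0(1) \<delta>(1) by (auto simp: D_def)
    then have "psi z0 \<noteq> 1" using psi_neq_1[of z0] z0(1) by (auto simp: D_def)
    then show ?thesis using that[of "cmod (1 - psi z0)"] z0(2) by simp
  qed (use that[of 1] in simp)
  show ?thesis
  proof (rule that[of "min (c / 2) (m / 2)"])
    show "0 < min (c / 2) (m / 2)" using c_pos m by simp
    fix z assume z: "cmod z < 1"
    have x2: "cmod (1 - z) \<le> 2" using norm_triangle_ineq4[of 1 z] z by simp
    have l0: "0 \<le> ell (cmod (1 - z))" using x2 by (intro ell_nonneg) auto
    show "min (c / 2) (m / 2) * ell (cmod (1 - z)) \<le> cmod (1 - psi z)"
    proof (cases "cmod (1 - z) \<le> \<delta>")
      case True
      have "min (c / 2) (m / 2) * ell (cmod (1 - z)) \<le> c / 2 * ell (cmod (1 - z))"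
        using l0 by (intro mult_right_mono) auto
      then show ?thesis using \<delta>(2)[OF z True] by linarith
    next
      case False
      have "min (c / 2) (m / 2) * ell (cmod (1 - z)) \<le> m / 2 * 2"
        using l0 ell_le_2[of "cmod (1 - z)"] x2 m(1) c_pos by (intro mult_mono) auto
      moreover have "m \<le> cmod (1 - psi z)" using m(2)[of z] False z by (auto simp: D_def)
      ultimately show ?thesis by simp
    qed
  qed
qed

lemma one_minus_psi_neq_0: "cmod z < 1 \<Longrightarrow> 1 - psi z \<noteq> 0"
  using psi_neq_1[of z] by force

lemma u_sums:
  assumes z: "cmod z < 1"
  shows "(\<lambda>n. of_real (u n) * z ^ n) sums (1 / (1 - psi z))"
proof -
  interpret cx: scalar_algebra "\<lambda>z::complex. z"
    by (rule scalar_algebra_complex)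
  define r where "r = cmod z"
  have r: "0 \<le> r" "r < 1" using z by (auto simp: r_def)
  have s1: "summable (\<lambda>n. norm (of_real (f n) :: complex) * r ^ n)"
  proof (rule summable_comparison_test')
    show "summable f" using f_sums by (auto simp: sums_iff)
    show "norm (norm (of_real (f n) :: complex) * r ^ n) \<le> f n" for n
      using f_nonneg[of n] r mult_left_mono[OF power_le_one[of r n], of "f n"] by simp
  qed
  have s2: "summable (\<lambda>n. norm (renewal_seq (\<lambda>n. of_real (f n) :: complex) n) * r ^ n)"
  proof (rule summable_comparison_test')
    show "summable (\<lambda>n. r ^ n)" using r by (intro summable_geometric) auto
    show "norm (norm (renewal_seq (\<lambda>n. of_real (f n) :: complex) n) * r ^ n) \<le> r ^ n" for n
      using u_bounds[of n] r mult_right_mono[of "u n" 1 "r ^ n"] by (simp add: renewal_seq_of_real)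
  qed
  have psi_eq: "cx.gen (\<lambda>n. of_real (f n)) z = psi z"
    by (simp add: cx.gen_def psi_def mult.commute)
  have "cx.gen (renewal_seq (\<lambda>n. of_real (f n))) z * (1 - cx.gen (\<lambda>n. of_real (f n)) z) = 1"
    by (rule cx.gen_renewal_seq[OF _ s1 s2]) (simp_all add: r_def)
  then have "cx.gen (renewal_seq (\<lambda>n. of_real (f n))) z * (1 - psi z) = 1"
    unfolding psi_eq .
  then have "cx.gen (renewal_seq (\<lambda>n. of_real (f n))) z = 1 / (1 - psi z)"
    by (subst nonzero_eq_divide_eq[OF one_minus_psi_neq_0[OF z]])
  moreover have "(\<lambda>n. z ^ n * renewal_seq (\<lambda>n. of_real (f n)) n) sums cx.gen (renewal_seq (\<lambda>n. of_real (f n))) z"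
    by (rule cx.gen_sums[OF s2]) (simp add: r_def)
  moreover have "z ^ n * renewal_seq (\<lambda>n. of_real (f n)) n = of_real (u n) * z ^ n" for n
    unfolding renewal_seq_of_real by (rule mult.commute)
  ultimately show ?thesis by (simp only:)
qed

text \<open>
  The oscillation bound comes from \<open>1/a - 1/b = (b - a) / (a b)\<close>: the numerator is controlled
  by the modulus of continuity of \<open>\<psi>\<close>, each factor of the denominator by the lower bound.
\<close>

lemma inverse_one_minus_psi_bounds:
  obtains K where "0 < K" "\<And>z. cmod z < 1 \<Longrightarrow> cmod (1 / (1 - psi z)) \<le> K / ell (cmod (1 - z))"
   "\<And>z h. cmod z < 1 \<Longrightarrow> 0 < h \<Longrightarrow> 2 * h \<le> cmod (1 - z) \<Longrightarrow>
     cmod (1 / (1 - psi z) - 1 / (1 - psi (z * cis h))) \<le> K * ell h / (ell (cmod (1 - z)))\<^sup>2"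
proof -
  obtain \<kappa> where \<kappa>: "0 < \<kappa>" "\<And>z. cmod z < 1 \<Longrightarrow> \<kappa> * ell (cmod (1 - z)) \<le> cmod (1 - psi z)"
    by (rule one_minus_psi_lower_bound) (rule that)
  obtain L where L: "0 < L" "\<And>z w. cmod z \<le> 1 \<Longrightarrow> cmod w \<le> 1 \<Longrightarrow>
    cmod (psi z - psi w) \<le> L * ell (cmod (z - w))"
    by (rule psi_modulus) (rule that)
  define K where "K = max (1 / \<kappa>) (2 * L / \<kappa>\<^sup>2)"
  have x: "0 < ell (cmod (1 - z))" if "cmod z < 1" for z
    using that norm_triangle_ineq4[of 1 z] by (intro ell_pos) auto
  show ?thesis
  proof (rule that[of K])
    show "0 < K" using \<kappa> by (auto simp: K_def less_max_iff_disj)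
    have b: "cmod (1 / (1 - psi z)) \<le> 1 / (\<kappa> * ell (cmod (1 - z)))" if "cmod z < 1" for z
      using \<kappa> x[OF that] that by (auto simp: norm_divide intro!: divide_left_mono mult_pos_pos order.strict_trans2[OF _ \<kappa>(2)])
    show "cmod (1 / (1 - psi z)) \<le> K / ell (cmod (1 - z))" if z: "cmod z < 1" for z
    proof -
      have "1 / (\<kappa> * ell (cmod (1 - z))) = (1 / \<kappa>) / ell (cmod (1 - z))" by simp
      also have "\<dots> \<le> K / ell (cmod (1 - z))"
        using x[OF z] by (intro divide_right_mono) (auto simp: K_def)
      finally show ?thesis using b[OF z] by linarith
    qed
    fix z h assume z: "cmod z < 1" "0 < h" "2 * h \<le> cmod (1 - z)"
    define w where "w = z * cis h"
    have w: "cmod w < 1" using z by (simp add: w_def norm_mult)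
    note rot = ell_rotation[OF z, folded w_def]
    have x2: "cmod (1 - z) \<le> 2" using norm_triangle_ineq4[of 1 z] z by simp
    have h0: "0 \<le> ell h" using z x2 by (intro ell_nonneg) auto
    have "1 / (1 - psi z) - 1 / (1 - psi w) = (psi z - psi w) * (1 / (1 - psi z)) * (1 / (1 - psi w))"
      using one_minus_psi_neq_0[OF z(1)] one_minus_psi_neq_0[OF w] by (simp add: field_simps)
    also have "cmod \<dots> \<le> (L * ell h) * (1 / (\<kappa> * ell (cmod (1 - z)))) * (1 / (\<kappa> * (ell (cmod (1 - z)) / 2)))"
      unfolding norm_mult
    proof (intro mult_mono mult_nonneg_nonneg)
      show "cmod (psi z - psi w) \<le> L * ell h"
        using L(2)[of z w] z w rot(1) mult_left_mono[OF rot(1), of L] L(1) by linarith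
      show "cmod (1 / (1 - psi z)) \<le> 1 / (\<kappa> * ell (cmod (1 - z)))" by (rule b[OF z(1)])
      have "cmod (1 / (1 - psi w)) \<le> 1 / (\<kappa> * ell (cmod (1 - w)))" by (rule b[OF w])
      also have "\<dots> \<le> 1 / (\<kappa> * (ell (cmod (1 - z)) / 2))"
        using rot(2) x[OF z(1)] x[OF w] \<kappa>(1) by (intro divide_left_mono mult_left_mono mult_pos_pos) auto
      finally show "cmod (1 / (1 - psi w)) \<le> 1 / (\<kappa> * (ell (cmod (1 - z)) / 2))" .
    qed (use L \<kappa> x[OF z(1)] h0 in auto)
    also have "\<dots> = (2 * L / \<kappa>\<^sup>2) * (ell h / (ell (cmod (1 - z)))\<^sup>2)"
      by (simp add: power2_eq_square mult_ac)
    also have "\<dots> \<le> K * (ell h / (ell (cmod (1 - z)))\<^sup>2)"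
      using h0 by (intro mult_right_mono) (auto simp: K_def)
    finally show "cmod (1 / (1 - psi z) - 1 / (1 - psi (z * cis h))) \<le> K * ell h / (ell (cmod (1 - z)))\<^sup>2"
      by (simp add: w_def)
  qed
qed

text \<open>
  The increments are the coefficients of \<open>(1 - z) / (1 - \<psi>(z))\<close>, which stays bounded at \<open>1\<close>,
  so the coefficient decay applies to them although it does not apply to \<open>u\<close> itself.
\<close>

lemma u_increments: "(\<lambda>n. u (Suc n) - u n) \<in> O(\<lambda>n. 1 / sqrt (real n * ln (real n)))"
proof -
  interpret cx: scalar_algebra "\<lambda>z::complex. z"
    by (rule scalar_algebra_complex)
  obtain K where K: "0 < K" "\<And>z. cmod z < 1 \<Longrightarrow> cmod (1 / (1 - psi z)) \<le> K / ell (cmod (1 - z))"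
   "\<And>z h. cmod z < 1 \<Longrightarrow> 0 < h \<Longrightarrow> 2 * h \<le> cmod (1 - z) \<Longrightarrow>
     cmod (1 / (1 - psi z) - 1 / (1 - psi (z * cis h))) \<le> K * ell h / (ell (cmod (1 - z)))\<^sup>2"
    by (rule inverse_one_minus_psi_bounds) (rule that)
  define d where "d n = (if n = 0 then 1 else u n - u (n - 1))" for n
  have d_sums: "(\<lambda>n. z ^ n * of_real (d n)) sums ((1 - z) * (1 / (1 - psi z)))" if z: "cmod z < 1" for z
  proof -
    let ?U = "1 / (1 - psi z)"
    have "(\<lambda>n. of_real (u (Suc n)) * z ^ Suc n) sums (?U - 1)"
      using u_sums[OF z] by (subst sums_Suc_iff) simp
    moreover have "(\<lambda>n. z * (of_real (u n) * z ^ n)) sums (z * ?U)"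
      by (intro sums_mult u_sums z)
    ultimately have "(\<lambda>n. of_real (u (Suc n)) * z ^ Suc n - z * (of_real (u n) * z ^ n)) sums (?U - 1 - z * ?U)"
      by (rule sums_diff)
    then have "(\<lambda>n. z ^ Suc n * of_real (d (Suc n))) sums (?U - 1 - z * ?U)"
      by (simp add: d_def algebra_simps)
    then have "(\<lambda>n. z ^ n * of_real (d n)) sums (?U - 1 - z * ?U + 1)"
      by (subst (asm) sums_Suc_iff) (simp add: d_def)
    then show ?thesis by (simp add: diff_divide_distrib)
  qed
  have gen_d: "cx.gen (\<lambda>n. of_real (d n)) z = (1 - z) * (1 / (1 - psi z))" if "cmod z < 1" for z
    using d_sums[OF that] by (simp add: cx.gen_def sums_iff)
  have x: "0 < cmod (1 - z)" "cmod (1 - z) \<le> 2" if "cmod z < 1" for z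
    using that norm_triangle_ineq4[of 1 z] by auto
  have "(\<lambda>n. norm (of_real (d n) :: complex)) \<in> O(\<lambda>n. 1 / sqrt (real n * ln (real n)))"
  proof (rule cx.coefficient_decay[where K = "4 * K"])
    show "summable (\<lambda>m. norm (of_real (d m) :: complex) * r ^ m)" if "0 \<le> r" "r < 1" for r
    proof (rule summable_comparison_test')
      show "summable (\<lambda>m. 1 * r ^ m)" using that by (intro summable_mult summable_geometric) auto
      fix m
      have "\<bar>d m\<bar> \<le> 1" using u_bounds[of m] u_bounds[of "m - 1"] by (auto simp: d_def)
      then show "norm (norm (of_real (d m) :: complex) * r ^ m) \<le> 1 * r ^ m"
        using that mult_right_mono[of "\<bar>d m\<bar>" 1 "r ^ m"] by simp
    qed
    show "0 \<le> 4 * K" using K by simp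
    have small: "cmod (1 - z) * cmod (1 / (1 - psi z)) \<le> K" if z: "cmod z < 1" for z
    proof -
      have l: "0 < ell (cmod (1 - z))" "cmod (1 - z) \<le> ell (cmod (1 - z))"
        using x[OF z] ell_pos ell_ge_self by auto
      have "cmod (1 - z) * cmod (1 / (1 - psi z)) \<le> ell (cmod (1 - z)) * (K / ell (cmod (1 - z)))"
        using l by (intro mult_mono K(2) z) auto
      then show ?thesis using l by simp
    qed
    show "norm (cx.gen (\<lambda>n. of_real (d n)) z) \<le> 4 * K" if z: "cmod z < 1" for z
      using small[OF z] K(1) by (simp add: gen_d[OF z] norm_divide)
    fix z h assume z: "cmod z < 1" "0 < h" "2 * h \<le> cmod (1 - z)"
    define w where "w = z * cis h"
    have w: "cmod w < 1" using z by (simp add: w_def norm_mult)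
    define l where "l = ell (cmod (1 - z))"
    have l: "0 < l" "l \<le> 2" "cmod (1 - z) \<le> 2"
      using x[OF z(1)] ell_pos ell_le_2 by (auto simp: l_def)
    have hl: "h \<le> ell h" "0 \<le> ell h" using z x[OF z(1)] ell_ge_self[of h] by auto
    have zw: "cmod (w - z) \<le> h"
    proof -
      have "cmod (w - z) = cmod z * cmod (1 - cis h)"
        by (simp flip: norm_mult) (simp add: w_def algebra_simps norm_minus_commute)
      also have "\<dots> \<le> 1 * h"
        using z norm_one_minus_cis_le[of h] by (intro mult_mono) auto
      finally show ?thesis by simp
    qed
    have split: "(1 - z) * U - (1 - w) * V = (w - z) * U + (1 - w) * (U - V)" for U V
      by (simp add: algebra_simps)
    have "(1 - z) * (1 / (1 - psi z)) - (1 - w) * (1 / (1 - psi w)) =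
        (w - z) * (1 / (1 - psi z)) + (1 - w) * (1 / (1 - psi z) - 1 / (1 - psi w))"
      by (rule split)
    also have "cmod \<dots> \<le> h * (K / l) + 2 * (K * ell h / l\<^sup>2)"
    proof (rule order.trans[OF norm_triangle_ineq], unfold norm_mult, intro add_mono mult_mono)
      show "cmod (1 / (1 - psi z)) \<le> K / l" unfolding l_def by (rule K(2)[OF z(1)])
      show "cmod (1 - w) \<le> 2" using x[OF w] by simp
      show "cmod (1 / (1 - psi z) - 1 / (1 - psi w)) \<le> K * ell h / l\<^sup>2"
        unfolding w_def l_def by (rule K(3)[OF z])
    qed (use zw z in auto)
    also have "h * (K / l) \<le> 2 * (K * ell h / l\<^sup>2)"
    proof -
      have "h * (K / l) = h * K * l / l\<^sup>2" using l by (simp add: power2_eq_square)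
      also have "\<dots> \<le> ell h * K * 2 / l\<^sup>2"
        using l hl K(1) z by (intro divide_right_mono mult_mono) auto
      finally show ?thesis by (simp add: mult_ac)
    qed
    finally have "cmod ((1 - z) * (1 / (1 - psi z)) - (1 - w) * (1 / (1 - psi w))) \<le> 4 * K * ell h / l\<^sup>2"
      by simp
    then show "norm (cx.gen (\<lambda>n. of_real (d n)) z - cx.gen (\<lambda>n. of_real (d n)) (z * cis h))
        \<le> 4 * K * ell h / (ell (cmod (1 - z)))\<^sup>2"
      using gen_d[OF z(1)] gen_d[OF w] by (simp add: w_def l_def)
  qed
  then have "d \<in> O(\<lambda>n. 1 / sqrt (real n * ln (real n)))" by simp
  then have "(\<lambda>n. d (Suc n)) \<in> O(\<lambda>n. 1 / sqrt (real (Suc n) * ln (real (Suc n))))"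
    by (rule landau_o.big.compose) (rule filterlim_Suc)
  moreover have "(\<lambda>n. 1 / sqrt (real (Suc n) * ln (real (Suc n)))) \<in> O(\<lambda>n. 1 / sqrt (real n * ln (real n)))"
    by real_asymp
  ultimately have "(\<lambda>n. d (Suc n)) \<in> O(\<lambda>n. 1 / sqrt (real n * ln (real n)))"
    by (rule landau_o.big_trans)
  then show ?thesis by (simp add: d_def)
qed

end

section \<open>Comparison of operator and scalar renewal sequences\<close>

text \<open>
  \<open>P\<close> plays the role of the spectral projection of \<open>R(1)\<close> for the simple eigenvalue \<open>1\<close>, and
  \<open>S1\<close> that of the reduced resolvent, the inverse of \<open>1 - R(1)\<close> on the complement of the
  eigenspace. The operators \<open>R n\<close> need not commute with \<open>P\<close>; only their compressions to its
  range are known.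
\<close>

locale operator_renewal = scalar_algebra \<sigma> + renewal_tail f c q H
  for \<sigma> :: "complex \<Rightarrow> 'x::{real_normed_algebra, monoid_mult, banach}"
    and f c q H +
  fixes R :: "nat \<Rightarrow> 'x" and P S1 :: 'x and C :: real
  assumes R_0: "R 0 = 0" and R_bound: "norm (R n) \<le> C * f n"
    and P_idem: "P * P = P" and P_neq_0: "P \<noteq> 0"
    and P_R_P: "P * R n * P = f n *\<^sub>R P"
    and P_R1: "P * gen R 1 = P" and R1_P: "gen R 1 * P = P"
    and S1: "S1 * (1 - gen R 1) = 1 - P"
    and invertible: "cmod z \<le> 1 \<Longrightarrow> z \<noteq> 1 \<Longrightarrow>
        \<exists>G. G * (1 - gen R z) = 1 \<and> (1 - gen R z) * G = 1"
begin

interpretation scal: bounded_linear \<sigma> by (rule scal_linear)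

lemma summable_R: "summable (\<lambda>n. norm (R n))"
proof (rule summable_comparison_test')
  show "summable (\<lambda>n. C * f n)" using f_sums by (intro summable_mult) (auto simp: sums_iff)
  show "norm (norm (R n)) \<le> C * f n" for n using R_bound by simp
qed

lemma gen_R_sums: "cmod z \<le> 1 \<Longrightarrow> (\<lambda>n. \<sigma> (z ^ n) * R n) sums gen R z"
  using gen_sums[of R 1 z] summable_R by simp

lemma gen_R_modulus:
  obtains K where "0 < K" "\<And>z w. cmod z \<le> 1 \<Longrightarrow> cmod w \<le> 1 \<Longrightarrow>
    norm (gen R z - gen R w) \<le> K * ell (cmod (z - w))"
proof -
  obtain K where K: "0 < K" "\<And>z w :: complex. cmod z \<le> 1 \<Longrightarrow> cmod w \<le> 1 \<Longrightarrow>
      summable (\<lambda>n. f n * cmod (z ^ n - w ^ n)) \<and>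
      (\<Sum>n. f n * cmod (z ^ n - w ^ n)) \<le> K * ell (cmod (z - w))"
    by (rule power_modulus) (rule that)
  define B where "B = scal_bound * max C 1"
  have B: "0 < B" using scal_bound_props(1) by (simp add: B_def)
  show ?thesis
  proof (rule that[of "B * K"])
    show "0 < B * K" using B K by simp
    fix z w :: complex assume zw: "cmod z \<le> 1" "cmod w \<le> 1"
    have "norm (gen R z - gen R w) \<le> B * (\<Sum>n. f n * cmod (z ^ n - w ^ n))"
    proof (rule norm_sums_le)
      show "(\<lambda>n. \<sigma> (z ^ n) * R n - \<sigma> (w ^ n) * R n) sums (gen R z - gen R w)"
        using zw by (intro sums_diff gen_R_sums)
      show "(\<lambda>n. B * (f n * cmod (z ^ n - w ^ n))) sums (B * (\<Sum>n. f n * cmod (z ^ n - w ^ n)))"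
        using K(2)[OF zw] by (intro sums_mult summable_sums) simp
      fix n
      have "norm (\<sigma> (z ^ n) * R n - \<sigma> (w ^ n) * R n) = norm (\<sigma> (z ^ n - w ^ n) * R n)"
        by (simp add: scal.diff left_diff_distrib)
      also have "\<dots> \<le> scal_bound * (cmod (z ^ n - w ^ n) * norm (R n))"
        by (rule scal_bound_props)
      also have "\<dots> \<le> scal_bound * (cmod (z ^ n - w ^ n) * (max C 1 * f n))"
        using scal_bound_props(1) f_nonneg[of n]
        by (intro mult_left_mono order.trans[OF R_bound] mult_right_mono) auto
      finally show "norm (\<sigma> (z ^ n) * R n - \<sigma> (w ^ n) * R n) \<le> B * (f n * cmod (z ^ n - w ^ n))"
        by (simp add: B_def mult_ac)
    qed
    also have "\<dots> \<le> B * (K * ell (cmod (z - w)))"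
      using K(2)[OF zw] B by (intro mult_left_mono) auto
    finally show "norm (gen R z - gen R w) \<le> B * K * ell (cmod (z - w))" by simp
  qed
qed

lemma P_gen_R_P: "cmod z \<le> 1 \<Longrightarrow> P * gen R z * P = \<sigma> (psi z) * P"
proof -
  assume z: "cmod z \<le> 1"
  have "bounded_linear (\<lambda>x. P * x * P)"
    by (intro bounded_linear_mult_const bounded_linear_const_mult bounded_linear_ident)
  from bounded_linear.sums[OF this gen_R_sums[OF z]]
  have "(\<lambda>n. P * (\<sigma> (z ^ n) * R n) * P) sums (P * gen R z * P)" .
  moreover have "P * (\<sigma> (z ^ n) * R n) * P = \<sigma> (of_real (f n) * z ^ n) * P" for n
  proof -
    have "P * (\<sigma> (z ^ n) * R n) * P = \<sigma> (z ^ n) * (P * R n * P)"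
      by (simp add: scal_left_commute[of P] mult.assoc)
    also have "\<dots> = \<sigma> (z ^ n) * (\<sigma> (of_real (f n)) * P)"
      by (simp add: P_R_P scal_of_real)
    also have "\<dots> = \<sigma> (of_real (f n) * z ^ n) * P"
      by (simp only: scal_mult[symmetric] mult.assoc[symmetric] mult.commute)
    finally show ?thesis .
  qed
  ultimately have "(\<lambda>n. \<sigma> (of_real (f n) * z ^ n) * P) sums (P * gen R z * P)" by simp
  moreover have "(\<lambda>n. \<sigma> (of_real (f n) * z ^ n) * P) sums (\<sigma> (psi z) * P)"
    by (intro sums_mult2 scal.sums psi_sums z)
  ultimately show ?thesis by (rule sums_unique2)
qed

text \<open>
  If \<open>\<psi>(z) = 1\<close>, the average of the \<open>z\<^sup>n\<close> with weights \<open>f n\<close> is an extreme point of the disc,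
  so \<open>z\<^sup>n = 1\<close> whenever \<open>f n \<noteq> 0\<close>. Then \<open>R(z) = R(1)\<close>, contradicting the invertibility of
  \<open>1 - R(z)\<close>.
\<close>

lemma aperiodic:
  assumes z: "cmod z \<le> 1" "z \<noteq> 1"
  shows "psi z \<noteq> 1"
proof
  assume "psi z = 1"
  have Re_le: "Re (z ^ n) \<le> 1" for n
    using complex_Re_le_cmod[of "z ^ n"] power_le_one[of "cmod z" n] z by (simp add: norm_power)
  have "(\<lambda>n. f n * Re (z ^ n)) sums 1"
    using sums_Re[OF psi_sums[OF z(1)]] \<open>psi z = 1\<close> by simp
  from sums_diff[OF f_sums this] have s: "(\<lambda>n. f n * (1 - Re (z ^ n))) sums 0"
    by (simp add: right_diff_distrib)
  have zero: "f n * (1 - Re (z ^ n)) = 0" for n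
    using suminf_eq_zero_iff[of "\<lambda>n. f n * (1 - Re (z ^ n))"] s Re_le f_nonneg
    by (auto simp: sums_iff)
  have "\<sigma> (z ^ n) * R n = \<sigma> (1 ^ n) * R n" for n
  proof (cases "f n = 0")
    case True
    then have "R n = 0" using R_bound[of n] by simp
    then show ?thesis by simp
  next
    case False
    then have Re1: "Re (z ^ n) = 1" using zero[of n] by simp
    have "(cmod (z ^ n))\<^sup>2 \<le> 1" using z by (simp add: norm_power power_le_one)
    then have "Im (z ^ n) = 0" using Re1 by (simp add: cmod_power2)
    then have "z ^ n = 1" using Re1 by (simp add: complex_eq_iff)
    then show ?thesis by simp
  qed
  then have "gen R z = gen R 1" by (simp only: gen_def)
  moreover obtain G where "G * (1 - gen R z) = 1" using invertible[OF z] by blast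
  ultimately have "P = G * ((1 - gen R 1) * P)" by (simp flip: mult.assoc)
  then have "P = 0" using R1_P by (simp add: left_diff_distrib)
  then show False using P_neq_0 by simp
qed

sublocale aperiodic_renewal_tail f c q H
  by unfold_locales (rule aperiodic)

definition res :: "complex \<Rightarrow> 'x" where
  "res z = (SOME G. G * (1 - gen R z) = 1 \<and> (1 - gen R z) * G = 1)"

lemma res:
  assumes "cmod z \<le> 1" "z \<noteq> 1"
  shows "res z * (1 - gen R z) = 1" "(1 - gen R z) * res z = 1"
  using someI_ex[OF invertible[OF assms]] by (simp_all add: res_def)

lemma continuous_on_gen_R: "S \<subseteq> cball 0 1 \<Longrightarrow> continuous_on S (gen R)"
proof -
  assume S: "S \<subseteq> cball 0 1"
  obtain K where K: "0 < K" "\<And>z w. cmod z \<le> 1 \<Longrightarrow> cmod w \<le> 1 \<Longrightarrow>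
    norm (gen R z - gen R w) \<le> K * ell (cmod (z - w))" by (rule gen_R_modulus) (rule that)
  show ?thesis
    by (rule continuous_on_ell_modulus[OF K(1)]) (use S K(2) in \<open>auto simp: dist_norm subset_iff\<close>)
qed

lemma res_bounded_on_compact:
  assumes "compact S" "S \<subseteq> cball 0 1 - {1}"
  obtains B where "\<And>z. z \<in> S \<Longrightarrow> norm (res z) \<le> B"
proof -
  have "continuous_on S res"
  proof (rule continuous_on_two_sided_inverse)
    show "continuous_on S (\<lambda>z. 1 - gen R z)"
      using assms(2) by (intro continuous_intros continuous_on_gen_R) auto
    fix z assume "z \<in> S"
    then have z: "cmod z \<le> 1" "z \<noteq> 1" using assms(2) by auto
    show "res z * (1 - gen R z) = 1" "(1 - gen R z) * res z = 1" by (rule res[OF z])+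
  qed
  then have "bounded (res ` S)" using assms(1) by (intro compact_imp_bounded compact_continuous_image)
  then show ?thesis using that by (auto simp: bounded_iff)
qed

text \<open>
  Let \<open>G\<close> be the inverse of \<open>1 - R(z)\<close>, \<open>E = (1 - P) G\<close> and \<open>\<Delta> = R(z) - R(1)\<close>. Compressing the
  equation for \<open>G\<close> by \<open>P\<close> gives \<open>P G = (1 - \<psi>(z))\<^sup>-\<^sup>1 (P + P \<Delta> E)\<close>, and applying the reduced
  resolvent gives \<open>E = S1 + S1 \<Delta> G\<close>. Since \<open>\<Delta>\<close> is at most of the order
  \<open>|1 - z| log (1 / |1 - z|)\<close> and \<open>(1 - \<psi>(z))\<^sup>-\<^sup>1\<close> at most of the inverse order, the first
  equation bounds the difference by a multiple of \<open>E\<close>. Inserted into the second one, this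
  bounds \<open>E\<close> by a constant plus a small multiple of itself near \<open>z = 1\<close>; elsewhere \<open>G\<close> is
  bounded by compactness.
\<close>

lemma res_diff_bounded:
  obtains B where "\<And>z. cmod z < 1 \<Longrightarrow> norm (res z - \<sigma> (1 / (1 - psi z)) * P) \<le> B"
proof -
  obtain K where K: "0 < K" "\<And>z w. cmod z \<le> 1 \<Longrightarrow> cmod w \<le> 1 \<Longrightarrow>
    norm (gen R z - gen R w) \<le> K * ell (cmod (z - w))" by (rule gen_R_modulus) (rule that)
  obtain U where U: "0 < U" "\<And>z. cmod z < 1 \<Longrightarrow> cmod (1 / (1 - psi z)) \<le> U / ell (cmod (1 - z))"
    by (rule inverse_one_minus_psi_bounds) (rule that)
  define M where "M = 1 + scal_bound * U * norm P * K"
  have M1: "1 \<le> M" using scal_bound_props(1) U(1) K(1) by (simp add: M_def)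
  define N where "N = norm S1 * M"
  have N0: "0 \<le> N" using M1 by (simp add: N_def)
  define D where "D z = res z - \<sigma> (1 / (1 - psi z)) * P" for z
  define e where "e z = norm ((1 - P) * res z)" for z
  have x: "0 < ell (cmod (1 - z))" "cmod (1 - z) \<le> 2" if "cmod z < 1" for z
    using that norm_triangle_ineq4[of 1 z] by (auto intro!: ell_pos)
  have u_ell: "cmod (1 / (1 - psi z)) * (K * ell (cmod (1 - z))) \<le> U * K" if z: "cmod z < 1" for z
  proof -
    have "cmod (1 / (1 - psi z)) * (K * ell (cmod (1 - z))) \<le> U / ell (cmod (1 - z)) * (K * ell (cmod (1 - z)))"
      using x[OF z] K(1) by (intro mult_right_mono U(2) z) auto
    then show ?thesis using x[OF z] by simp
  qed
  have \<Delta>: "norm (gen R z - gen R 1) \<le> K * ell (cmod (1 - z))" if "cmod z < 1" for z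
    using K(2)[of z 1] that by (simp add: norm_minus_commute)
  have D: "norm (D z) \<le> M * e z" if z: "cmod z < 1" for z
  proof -
    define \<Delta>z where "\<Delta>z = gen R z - gen R 1"
    define E where "E = (1 - P) * res z"
    have z1: "cmod z \<le> 1" "z \<noteq> 1" using z by auto
    \<comment> \<open>The \<open>P\<close>-component of the inverse.\<close>
    have "P = P * ((1 - gen R z) * res z)" using res(2)[OF z1] by simp
    also have "\<dots> = - (P * \<Delta>z * res z)"
      by (simp add: \<Delta>z_def right_diff_distrib left_diff_distrib P_R1 flip: mult.assoc)
    also have "res z = P * res z + E"
      by (simp add: E_def left_diff_distrib)
    also have "- (P * \<Delta>z * (P * res z + E)) = - ((P * \<Delta>z * (P * P)) * res z) - P * \<Delta>z * E"
      by (simp add: P_idem distrib_left mult.assoc)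
    also have "P * \<Delta>z * (P * P) = \<sigma> (psi z - 1) * P"
      using P_gen_R_P[OF z1(1)] P_idem
      by (simp add: \<Delta>z_def right_diff_distrib left_diff_distrib P_R1 P_idem scal.diff scal_1)
    finally have "P + P * \<Delta>z * E = - (\<sigma> (psi z - 1) * P * res z)"
      by (simp only: eq_diff_eq)
    also have "\<dots> = \<sigma> (1 - psi z) * (P * res z)"
      by (simp add: scal.diff left_diff_distrib mult.assoc)
    finally have "P + P * \<Delta>z * E = \<sigma> (1 - psi z) * (P * res z)" .
    then have "\<sigma> (1 / (1 - psi z)) * (P + P * \<Delta>z * E) = P * res z"
      using one_minus_psi_neq_0[OF z] by (simp add: scal_1 flip: mult.assoc scal_mult)
    then have "D z = E + \<sigma> (1 / (1 - psi z)) * (P * \<Delta>z * E)"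
      unfolding D_def using \<open>res z = P * res z + E\<close> by (simp add: distrib_left algebra_simps)
    moreover have "norm (\<sigma> (1 / (1 - psi z)) * (P * \<Delta>z * E)) \<le> (M - 1) * norm E"
    proof -
      have PE: "norm (P * \<Delta>z * E) \<le> norm P * (K * ell (cmod (1 - z))) * norm E"
        using \<Delta>[OF z] unfolding \<Delta>z_def
        by (intro order.trans[OF norm_mult_ineq] mult_right_mono order.trans[OF norm_mult_ineq] mult_left_mono) auto
      have "norm (\<sigma> (1 / (1 - psi z)) * (P * \<Delta>z * E)) \<le>
          scal_bound * (cmod (1 / (1 - psi z)) * norm (P * \<Delta>z * E))"
        by (rule scal_bound_props)
      also have "\<dots> \<le> scal_bound * (cmod (1 / (1 - psi z)) * (norm P * (K * ell (cmod (1 - z))) * norm E))"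
        using scal_bound_props(1) by (intro mult_left_mono PE) auto
      also have "\<dots> =
          scal_bound * norm P * norm E * (cmod (1 / (1 - psi z)) * (K * ell (cmod (1 - z))))"
        by (simp add: mult_ac)
      also have "\<dots> \<le> scal_bound * norm P * norm E * (U * K)"
        using u_ell[OF z] scal_bound_props(1) by (intro mult_left_mono) auto
      finally show ?thesis
        using scal_bound_props(1) by (simp add: M_def mult_ac mult_left_mono)
    qed
    ultimately have "norm (D z) \<le> norm E + (M - 1) * norm E"
      using norm_triangle_ineq[of E] by (metis add_left_mono order.trans)
    then show ?thesis by (simp add: e_def E_def algebra_simps)
  qed
  have e: "e z \<le> N + norm S1 * M * K * ell (cmod (1 - z)) * e z" if z: "cmod z < 1" for z
  proof -
    define \<Delta>z where "\<Delta>z = gen R z - gen R 1"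
    have z1: "cmod z \<le> 1" "z \<noteq> 1" using z by auto
    \<comment> \<open>The complementary component.\<close>
    have "S1 = S1 * ((1 - gen R z) * res z)" using res(2)[OF z1] by simp
    also have "\<dots> = (S1 * (1 - gen R 1)) * res z - S1 * \<Delta>z * res z"
      by (simp add: \<Delta>z_def algebra_simps)
    also have "S1 * (1 - gen R 1) = 1 - P" by (rule S1)
    finally have EG: "(1 - P) * res z = S1 + S1 * \<Delta>z * res z" by (simp add: algebra_simps)
    have rz: "res z = D z + \<sigma> (1 / (1 - psi z)) * P" by (simp add: D_def)
    have e1: "e z \<le> norm S1 + norm (S1 * \<Delta>z * res z)"
      unfolding e_def EG by (rule norm_triangle_ineq)
    have "norm (S1 * \<Delta>z * res z) \<le>
        (norm S1 * (K * ell (cmod (1 - z)))) * (M * e z + scal_bound * (cmod (1 / (1 - psi z)) * norm P))"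
    proof (rule order.trans[OF norm_mult_ineq], intro mult_mono)
      show "norm (S1 * \<Delta>z) \<le> norm S1 * (K * ell (cmod (1 - z)))"
        using \<Delta>[OF z] unfolding \<Delta>z_def by (intro order.trans[OF norm_mult_ineq] mult_left_mono) auto
      show "norm (res z) \<le> M * e z + scal_bound * (cmod (1 / (1 - psi z)) * norm P)"
        unfolding rz by (intro order.trans[OF norm_triangle_ineq] add_mono D[OF z] scal_bound_props(2))
    qed (use x[OF z] K(1) in auto)
    also have "\<dots> = norm S1 * M * K * ell (cmod (1 - z)) * e z +
        norm S1 * scal_bound * norm P * (cmod (1 / (1 - psi z)) * (K * ell (cmod (1 - z))))"
      by (simp add: algebra_simps)
    also have "\<dots> \<le> norm S1 * M * K * ell (cmod (1 - z)) * e z + norm S1 * scal_bound * norm P * (U * K)"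
      using u_ell[OF z] scal_bound_props(1) by (intro add_left_mono mult_left_mono) auto
    finally have e2: "norm (S1 * \<Delta>z * res z) \<le> norm S1 * M * K * ell (cmod (1 - z)) * e z + norm S1 * scal_bound * norm P * (U * K)" .
    have "N = norm S1 + norm S1 * scal_bound * norm P * (U * K)"
      by (simp add: N_def M_def algebra_simps)
    then show ?thesis using e1 e2 by linarith
  qed
  define s where "s = 1 / (2 * (norm S1 * M * K + 1))"
  have s: "0 < s" "norm S1 * M * K * s \<le> 1 / 2"
    using M1 K(1) by (auto simp: s_def field_simps add_pos_nonneg)
  have "\<forall>\<^sub>F x in at_right 0. ell x < s"
    using s by (intro order_tendstoD(2)[OF ell_tendsto_0])
  then obtain \<delta> where \<delta>: "0 < \<delta>" "\<And>x. 0 < x \<Longrightarrow> x < \<delta> \<Longrightarrow> ell x < s"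
    by (auto simp: eventually_at_right_field)
  obtain B where B: "\<And>z. cmod z \<le> 1 \<Longrightarrow> \<delta> \<le> cmod (1 - z) \<Longrightarrow> norm (res z) \<le> B"
  proof (rule res_bounded_on_compact[OF compact_disc_minus_ball[of \<delta>]])
    show "{z. cmod z \<le> 1 \<and> \<delta> \<le> cmod (1 - z)} \<subseteq> cball 0 1 - {1}" using \<delta>(1) by auto
  qed (use that in auto)
  have e_bound: "e z \<le> max (2 * N) (norm (1 - P) * B)" if z: "cmod z < 1" for z
  proof (cases "cmod (1 - z) < \<delta>")
    case True
    have "norm S1 * M * K * ell (cmod (1 - z)) * e z \<le> norm S1 * M * K * s * e z"
    proof (intro mult_right_mono mult_left_mono)
      have "z \<noteq> 1" using z by auto
      then show "ell (cmod (1 - z)) \<le> s" using \<delta>(2)[of "cmod (1 - z)"] True by auto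
    qed (use M1 K(1) in \<open>auto simp: e_def\<close>)
    also have "\<dots> \<le> 1 / 2 * e z" using s by (intro mult_right_mono) (auto simp: e_def)
    finally have "e z \<le> 2 * N" using e[OF z] by linarith
    then show ?thesis by linarith
  next
    case False
    then have "norm (res z) \<le> B" using B z by auto
    then have "e z \<le> norm (1 - P) * B"
      unfolding e_def by (intro order.trans[OF norm_mult_ineq] mult_left_mono) auto
    then show ?thesis by linarith
  qed
  show ?thesis
  proof (rule that)
    fix z assume z: "cmod z < 1"
    have "norm (D z) \<le> M * max (2 * N) (norm (1 - P) * B)"
      using M1 by (intro order.trans[OF D[OF z]] mult_left_mono e_bound z) auto
    then show "norm (res z - \<sigma> (1 / (1 - psi z)) * P) \<le> M * max (2 * N) (norm (1 - P) * B)"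
      by (simp add: D_def)
  qed
qed

abbreviation T :: "nat \<Rightarrow> 'x" where "T \<equiv> renewal_seq R"

lemma summable_T: "0 \<le> r \<Longrightarrow> r < 1 \<Longrightarrow> summable (\<lambda>n. norm (T n) * r ^ n)"
proof (rule summable_renewal_seq[where G = res, OF R_0 summable_R])
  show "(1 - gen R z) * res z = 1" if "cmod z < 1" for z
    by (rule res(2)) (use that in auto)
  show "\<exists>B. \<forall>z. cmod z \<le> r \<longrightarrow> norm (res z) \<le> B" if r: "r < 1" for r
  proof -
    obtain B where "\<And>z. z \<in> cball 0 r \<Longrightarrow> norm (res z) \<le> B"
      by (rule res_bounded_on_compact[of "cball 0 r"]) (use r that in auto)
    then show ?thesis by (intro exI[of _ B]) auto
  qed
qed

lemma gen_T:
  assumes z: "cmod z < 1"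
  shows "gen T z = res z"
proof -
  have s: "summable (\<lambda>n. norm (R n) * cmod z ^ n)"
  proof (rule summable_comparison_test'[OF summable_R])
    show "norm (norm (R n) * cmod z ^ n) \<le> norm (R n)" for n
      using z mult_left_mono[OF power_le_one[of "cmod z" n], of "norm (R n)"] by simp
  qed
  have "gen T z * (1 - gen R z) = 1"
    using z by (intro gen_renewal_seq[where r = "cmod z"] R_0 s summable_T) auto
  then have "gen T z * ((1 - gen R z) * res z) = res z" by (simp flip: mult.assoc)
  moreover have "(1 - gen R z) * res z = 1" by (rule res(2)) (use z in auto)
  ultimately show ?thesis by simp
qed

text \<open>
  Both generating functions have a singularity of order \<open>1 / (|1 - z| log (1 / |1 - z|))\<close> at
  \<open>1\<close>, and both satisfy the oscillation hypothesis of the coefficient lemma; but only their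
  difference is bounded, as that lemma also requires.
\<close>

theorem renewal_seq_approx:
  "(\<lambda>n. norm (T n - u n *\<^sub>R P)) \<in> O(\<lambda>n. 1 / sqrt (real n * ln (real n)))"
proof -
  obtain B where B: "\<And>z. cmod z < 1 \<Longrightarrow> norm (res z - \<sigma> (1 / (1 - psi z)) * P) \<le> B"
    by (rule res_diff_bounded) (rule that)
  obtain K where K: "0 < K" "\<And>z w. cmod z \<le> 1 \<Longrightarrow> cmod w \<le> 1 \<Longrightarrow>
    norm (gen R z - gen R w) \<le> K * ell (cmod (z - w))" by (rule gen_R_modulus) (rule that)
  obtain U where U: "0 < U" "\<And>z. cmod z < 1 \<Longrightarrow> cmod (1 / (1 - psi z)) \<le> U / ell (cmod (1 - z))"
   "\<And>z h. cmod z < 1 \<Longrightarrow> 0 < h \<Longrightarrow> 2 * h \<le> cmod (1 - z) \<Longrightarrow>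
     cmod (1 / (1 - psi z) - 1 / (1 - psi (z * cis h))) \<le> U * ell h / (ell (cmod (1 - z)))\<^sup>2"
    by (rule inverse_one_minus_psi_bounds) (rule that)
  have B0: "0 \<le> B" using order.trans[OF norm_ge_zero B[of 0]] by simp
  have x: "0 < ell (cmod (1 - z))" "cmod (1 - z) \<le> 2" "ell (cmod (1 - z)) \<le> 2" if "cmod z < 1" for z
    using that norm_triangle_ineq4[of 1 z] by (auto intro!: ell_pos ell_le_2)
  have uP_summable: "summable (\<lambda>n. norm (u n *\<^sub>R P) * r ^ n)" if r: "0 \<le> r" "r < 1" for r
  proof (rule summable_comparison_test')
    show "summable (\<lambda>n. norm P * r ^ n)" using r by (intro summable_mult summable_geometric) auto
    show "norm (norm (u n *\<^sub>R P) * r ^ n) \<le> norm P * r ^ n" for n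
      using u_bounds[of n] r mult_right_mono[of "u n" 1 "norm P"]
      by (simp add: mult_right_mono)
  qed
  have gen_uP: "gen (\<lambda>n. u n *\<^sub>R P) z = \<sigma> (1 / (1 - psi z)) * P" if z: "cmod z < 1" for z
  proof -
    have "(\<lambda>n. \<sigma> (of_real (u n) * z ^ n) * P) sums (\<sigma> (1 / (1 - psi z)) * P)"
      by (intro sums_mult2 scal.sums u_sums z)
    moreover have "\<sigma> (of_real (u n) * z ^ n) * P = \<sigma> (z ^ n) * (u n *\<^sub>R P)" for n
    proof -
      have "\<sigma> (of_real (u n) * z ^ n) * P = \<sigma> (z ^ n) * (\<sigma> (of_real (u n)) * P)"
        by (simp only: mult.assoc[symmetric] scal_mult[symmetric] mult.commute)
      then show ?thesis by (simp only: scal_of_real)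
    qed
    ultimately show ?thesis by (simp add: gen_def sums_iff)
  qed
  define G where "G = B + scal_bound * U * norm P"
  define a where "a n = T n - u n *\<^sub>R P" for n
  have gen_a: "gen a z = res z - \<sigma> (1 / (1 - psi z)) * P" if z: "cmod z < 1" for z
    unfolding a_def
    using gen_diff[OF summable_T uP_summable, of "cmod z" z] z by (simp add: gen_T gen_uP)
  have res_bound: "norm (res z) \<le> 2 * G / ell (cmod (1 - z))" if z: "cmod z < 1" for z
  proof -
    have "norm (res z) \<le> norm (\<sigma> (1 / (1 - psi z)) * P) + norm (res z - \<sigma> (1 / (1 - psi z)) * P)"
      by (rule norm_triangle_sub)
    also have "\<dots> \<le> scal_bound * (U / ell (cmod (1 - z)) * norm P) + B"
      using scal_bound_props(1)
      by (intro add_mono B z order.trans[OF scal_bound_props(2)] mult_left_mono mult_right_mono U(2)) auto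
    also have "\<dots> \<le> scal_bound * (U / ell (cmod (1 - z)) * norm P) + B * (2 / ell (cmod (1 - z)))"
      using x[OF z] B0 mult_left_mono[of 1 "2 / ell (cmod (1 - z))" B] by simp
    also have "\<dots> = (scal_bound * U * norm P + 2 * B) / ell (cmod (1 - z))"
      by (simp add: add_divide_distrib mult_ac)
    also have "\<dots> \<le> 2 * G / ell (cmod (1 - z))"
      using x[OF z] scal_bound_props(1) U(1) by (intro divide_right_mono) (auto simp: G_def)
    finally show ?thesis .
  qed
  have G0: "0 \<le> G" using B0 scal_bound_props(1) U(1) by (simp add: G_def)
  define W where "W = 8 * G\<^sup>2 * K + G"
  have "(\<lambda>n. norm (a n)) \<in> O(\<lambda>n. 1 / sqrt (real n * ln (real n)))"
  proof (rule coefficient_decay[where K = W])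
    show "summable (\<lambda>m. norm (a m) * r ^ m)" if r: "0 \<le> r" "r < 1" for r
    proof (rule summable_comparison_test'[OF summable_add[OF summable_T[OF r] uP_summable[OF r]]])
      fix m
      have "norm (a m) * r ^ m \<le> (norm (T m) + norm (u m *\<^sub>R P)) * r ^ m"
        unfolding a_def using r by (intro mult_right_mono norm_triangle_ineq4) auto
      then show "norm (norm (a m) * r ^ m) \<le> norm (T m) * r ^ m + norm (u m *\<^sub>R P) * r ^ m"
        using r by (simp add: distrib_right)
    qed
    have G_le_W: "G \<le> W" using K(1) by (simp add: W_def)
    show "0 \<le> W" using G0 G_le_W by simp
    show "norm (gen a z) \<le> W" if z: "cmod z < 1" for z
    proof -
      have "B \<le> G" using scal_bound_props(1) U(1) by (simp add: G_def)
      then show ?thesis using B[OF z] G_le_W by (simp add: gen_a[OF z])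
    qed
    fix z h assume z: "cmod z < 1" "0 < h" "2 * h \<le> cmod (1 - z)"
    define w where "w = z * cis h"
    have w: "cmod w < 1" using z by (simp add: w_def norm_mult)
    define l where "l = ell (cmod (1 - z))"
    have l: "0 < l" using x[OF z(1)] by (simp add: l_def)
    note rot = ell_rotation[OF z, folded w_def]
    have hl: "0 \<le> ell h" using z x[OF z(1)] ell_nonneg[of h] by auto
    have "norm (res z - res w) \<le> (2 * G / l) * (K * ell h) * (2 * G / (l / 2))"
    proof -
      have "res z * (1 - gen R z) = 1" by (rule res(1)) (use z in auto)
      moreover have "(1 - gen R w) * res w = 1" by (rule res(2)) (use w in auto)
      ultimately have "res z - res w = res z * ((1 - gen R w) * res w) - (res z * (1 - gen R z)) * res w"
        by simp
      also have "\<dots> = res z * (gen R z - gen R w) * res w" by (simp add: algebra_simps)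
      also have "norm \<dots> \<le> norm (res z) * norm (gen R z - gen R w) * norm (res w)"
        by (intro order.trans[OF norm_mult_ineq] mult_right_mono norm_mult_ineq) auto
      also have "\<dots> \<le> (2 * G / l) * (K * ell h) * (2 * G / (l / 2))"
      proof (intro mult_mono mult_nonneg_nonneg)
        show "norm (res z) \<le> 2 * G / l" unfolding l_def by (rule res_bound[OF z(1)])
        show "norm (gen R z - gen R w) \<le> K * ell h"
          using K(2)[of z w] z w mult_left_mono[OF rot(1), of K] K(1) by linarith
        have "norm (res w) \<le> 2 * G / ell (cmod (1 - w))" by (rule res_bound[OF w])
        also have "\<dots> \<le> 2 * G / (l / 2)"
          using rot(2) G0 l x[OF w] by (intro divide_left_mono) (auto simp: l_def)
        finally show "norm (res w) \<le> 2 * G / (l / 2)" .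
      qed (use G0 l K(1) hl in auto)
      finally show ?thesis .
    qed
    also have "\<dots> = 8 * G\<^sup>2 * K * ell h / l\<^sup>2"
      by (simp add: power2_eq_square mult_ac)
    finally have 1: "norm (res z - res w) \<le> 8 * G\<^sup>2 * K * ell h / l\<^sup>2" .
    have "norm (\<sigma> (1 / (1 - psi z)) * P - \<sigma> (1 / (1 - psi w)) * P) =
        norm (\<sigma> (1 / (1 - psi z) - 1 / (1 - psi w)) * P)"
      by (simp only: scal.diff left_diff_distrib)
    also have "\<dots> \<le> scal_bound * (U * ell h / l\<^sup>2 * norm P)"
      unfolding l_def w_def using scal_bound_props(1)
      by (intro order.trans[OF scal_bound_props(2)] mult_left_mono mult_right_mono U(3) z) auto
    also have "\<dots> = (scal_bound * U * norm P) * ell h / l\<^sup>2" by (simp add: mult_ac)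
    also have "\<dots> \<le> G * ell h / l\<^sup>2"
      using hl B0 by (intro divide_right_mono mult_right_mono) (auto simp: G_def)
    finally have 2: "norm (\<sigma> (1 / (1 - psi z)) * P - \<sigma> (1 / (1 - psi w)) * P) \<le> G * ell h / l\<^sup>2" .
    have "gen a z - gen a w = (res z - res w) - (\<sigma> (1 / (1 - psi z)) * P - \<sigma> (1 / (1 - psi w)) * P)"
      by (simp add: gen_a[OF z(1)] gen_a[OF w])
    also have "norm \<dots> \<le> 8 * G\<^sup>2 * K * ell h / l\<^sup>2 + G * ell h / l\<^sup>2"
      by (intro order.trans[OF norm_triangle_ineq4] add_mono 1 2)
    also have "\<dots> = W * ell h / l\<^sup>2" by (simp add: W_def algebra_simps add_divide_distrib)
    finally show "norm (gen a z - gen a (z * cis h)) \<le> W * ell h / (ell (cmod (1 - z)))\<^sup>2"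
      by (simp add: w_def l_def)
  qed
  then show ?thesis by (simp add: a_def)
qed

end

section \<open>An explicit model sequence\<close>

text \<open>
  The coefficient of \<open>z\<^sup>n\<close> in the binomial series of \<open>(1 - z)\<^sup>s\<^sup>-\<^sup>1\<close>.
\<close>

definition binom_prod :: "nat \<Rightarrow> real \<Rightarrow> real" where
  "binom_prod n s = (\<Prod>k = 1..n. 1 - s / real k)"

lemma binom_prod_0 [simp]: "binom_prod 0 s = 1"
  by (simp add: binom_prod_def)

lemma binom_prod_Suc: "binom_prod (Suc n) s = (1 - s / real (Suc n)) * binom_prod n s"
  by (simp add: binom_prod_def)

lemma binom_prod_at_0 [simp]: "binom_prod n 0 = 1"
  by (simp add: binom_prod_def)

lemma binom_prod_at_1: "0 < n \<Longrightarrow> binom_prod n 1 = 0"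
  by (auto simp: binom_prod_def intro!: bexI[of _ 1])

lemma binom_prod_bounds:
  assumes "0 \<le> s" "s \<le> 1"
  shows "0 \<le> binom_prod n s" "binom_prod n s \<le> 1"
  unfolding binom_prod_def
  using assms by (auto intro!: prod_nonneg prod_le_1 simp: field_simps)

lemma continuous_on_binom_prod [continuous_intros]: "continuous_on S (binom_prod n)"
  unfolding binom_prod_def[abs_def] by (intro continuous_intros) auto

text \<open>
  Coefficientwise form of \<open>d/ds (1 - z)\<^sup>s\<^sup>-\<^sup>1 = log (1 - z) (1 - z)\<^sup>s\<^sup>-\<^sup>1\<close>.
\<close>

lemma binom_prod_has_derivative:
  "(binom_prod n has_real_derivative - (\<Sum>j = 1..n. binom_prod (n - j) s / real j)) (at s within S)"
proof (induction n)
  case 0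
  then show ?case by (simp add: binom_prod_def[abs_def])
next
  case (Suc n)
  have scale: "real (Suc m) * ((1 - s / real (Suc m)) * p) = (real (Suc m) - s) * p" for m p
    by (simp add: field_simps)
  define q where "q m = (\<Sum>j = 1..m. binom_prod (m - j) s / real j)" for m
  have "real (Suc n) * q (Suc n) =
      (\<Sum>j = 1..Suc n. real (Suc n - j) * binom_prod (Suc n - j) s / real j) + (\<Sum>j = 1..Suc n. binom_prod (Suc n - j) s)"
    unfolding q_def sum_distrib_left sum.distrib[symmetric]
    by (intro sum.cong) (auto simp: field_simps of_nat_diff)
  also have "(\<Sum>j = 1..Suc n. real (Suc n - j) * binom_prod (Suc n - j) s / real j) =
      (\<Sum>j = 1..n. (real (Suc n - j) - s) * binom_prod (n - j) s / real j)"
  proof -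
    have "(\<Sum>j = 1..Suc n. real (Suc n - j) * binom_prod (Suc n - j) s / real j) =
        (\<Sum>j = 1..n. real (Suc n - j) * binom_prod (Suc n - j) s / real j)"
      by simp
    also have "\<dots> = (\<Sum>j = 1..n. (real (Suc n - j) - s) * binom_prod (n - j) s / real j)"
    proof (rule sum.cong[OF refl])
      fix j assume "j \<in> {1..n}"
      then have "Suc n - j = Suc (n - j)" by auto
      then show "real (Suc n - j) * binom_prod (Suc n - j) s / real j =
          (real (Suc n - j) - s) * binom_prod (n - j) s / real j"
        by (simp only: binom_prod_Suc scale)
    qed
    finally show ?thesis .
  qed
  also have "(\<Sum>j = 1..n. (real (Suc n - j) - s) * binom_prod (n - j) s / real j) =
      (real (Suc n) - s) * q n - (\<Sum>j = 1..n. binom_prod (n - j) s)"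
    unfolding q_def sum_distrib_left sum_subtractf[symmetric]
    by (intro sum.cong) (auto simp: field_simps of_nat_diff)
  also have "(\<Sum>j = 1..n. binom_prod (n - j) s) = (\<Sum>i<n. binom_prod i s)"
    by (rule sum.reindex_bij_witness[of _ "\<lambda>i. n - i" "\<lambda>j. n - j"]) auto
  also have "(\<Sum>j = 1..Suc n. binom_prod (Suc n - j) s) = (\<Sum>i<Suc n. binom_prod i s)"
    by (rule sum.reindex_bij_witness[of _ "\<lambda>i. Suc n - i" "\<lambda>j. Suc n - j"]) auto
  \<comment> \<open>Splitting \<open>n + 1 = (n + 1 - j) + j\<close> in \<open>(n + 1) q(n + 1)\<close> leaves a recurrence for \<open>q\<close>; the remaining
    sums of \<open>binom_prod i s\<close> cancel up to one term.\<close>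
  finally have "real (Suc n) * q (Suc n) = (real (Suc n) - s) * q n + binom_prod n s" by simp
  moreover have "Q = (1 - s / N) * q + b / N" if "N * Q = (N - s) * q + b" "N \<noteq> 0" for N Q q b :: real
    using that by (simp add: field_simps)
  ultimately have q_Suc: "q (Suc n) = (1 - s / real (Suc n)) * q n + binom_prod n s / real (Suc n)"
    by simp
  have "((\<lambda>s. (1 - s / real (Suc n)) * binom_prod n s) has_real_derivative
      (0 - 1 / real (Suc n)) * binom_prod n s + (- q n) * (1 - s / real (Suc n))) (at s within S)"
    unfolding q_def by (intro DERIV_mult DERIV_diff Suc DERIV_const DERIV_cdivide DERIV_ident)
  moreover have "(0 - 1 / real (Suc n)) * binom_prod n s + (- q n) * (1 - s / real (Suc n)) = - q (Suc n)"
    unfolding q_Suc by (simp add: algebra_simps)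
  ultimately show ?case
    by (simp add: q_def binom_prod_Suc[abs_def])
qed

text \<open>
  The integral over \<open>[0, \<infinity>)\<close> of \<open>e\<^sup>-\<^sup>a\<^sup>s (1 - z)\<^sup>s\<^sup>-\<^sup>1\<close> would be \<open>1 / ((1 - z) (a - log (1 - z)))\<close>.
  Stopping at \<open>s = 1\<close> avoids any question of convergence, and it affects the renewal equation
  at index \<open>0\<close> only, since \<open>(1 - z)\<^sup>s\<^sup>-\<^sup>1\<close> is constant in \<open>z\<close> at \<open>s = 1\<close>.
\<close>

definition model_seq :: "real \<Rightarrow> nat \<Rightarrow> real" where
  "model_seq a n = integral {0..1} (\<lambda>s. exp (- (a * s)) * binom_prod n s)"

lemma model_integrable:
  "(\<lambda>s. exp (- (a * s)) * binom_prod n s) integrable_on {0..1}"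
  by (intro integrable_continuous_real continuous_intros)

text \<open>
  The left-hand side is the integral of minus the derivative of \<open>e\<^sup>-\<^sup>a\<^sup>s p\<^sub>n(s)\<close>, where \<open>p\<^sub>n\<close> is
  the binomial product; \<open>p\<^sub>n(0) = 1\<close> and \<open>p\<^sub>n(1) = 0\<close>.
\<close>

lemma model_seq_renewal:
  assumes n: "0 < n"
  shows "a * model_seq a n + (\<Sum>j = 1..n. model_seq a (n - j) / real j) = 1"
proof -
  define g where "g s = exp (- (a * s)) * (a * binom_prod n s + (\<Sum>j = 1..n. binom_prod (n - j) s / real j))" for s
  have "(g has_integral (- (exp (- (a * 1)) * binom_prod n 1) - - (exp (- (a * 0)) * binom_prod n 0))) {0..1}"
  proof (rule fundamental_theorem_of_calculus)
    fix s :: real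
    have "((\<lambda>s. exp (- (a * s))) has_real_derivative exp (- (a * s)) * (- a)) (at s within {0..1})"
      by (auto intro!: derivative_eq_intros)
    from DERIV_minus[OF DERIV_mult[OF this binom_prod_has_derivative[of n]]]
    have "((\<lambda>s. - (exp (- (a * s)) * binom_prod n s)) has_real_derivative g s) (at s within {0..1})"
      by (simp add: g_def algebra_simps)
    then show "((\<lambda>s. - (exp (- (a * s)) * binom_prod n s)) has_vector_derivative g s) (at s within {0..1})"
      by (simp add: has_real_derivative_iff_has_vector_derivative)
  qed simp
  then have 1: "(g has_integral 1) {0..1}" using n by (simp add: binom_prod_at_1)
  have "((\<lambda>s. a * (exp (- (a * s)) * binom_prod n s) +
        (\<Sum>j = 1..n. exp (- (a * s)) * binom_prod (n - j) s / real j)) has_integral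
      (a * model_seq a n + (\<Sum>j = 1..n. model_seq a (n - j) / real j))) {0..1}"
    unfolding model_seq_def
    by (intro has_integral_add has_integral_mult_right has_integral_sum has_integral_divide
        integrable_integral model_integrable) auto
  also have "(\<lambda>s. a * (exp (- (a * s)) * binom_prod n s) +
        (\<Sum>j = 1..n. exp (- (a * s)) * binom_prod (n - j) s / real j)) = g"
    by (simp add: g_def distrib_left sum_distrib_left mult_ac fun_eq_iff)
  finally show ?thesis using 1 has_integral_unique by blast
qed

lemma model_increment:
  "model_seq a (Suc n) - model_seq a n =
     - integral {0..1} (\<lambda>s. exp (- (a * s)) * (s * binom_prod n s)) / real (Suc n)"
proof -
  have i: "(\<lambda>s. exp (- (a * s)) * (s * binom_prod n s)) integrable_on {0..1}"
    by (intro integrable_continuous_real continuous_intros)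
  have "model_seq a (Suc n) - model_seq a n =
      integral {0..1} (\<lambda>s. exp (- (a * s)) * binom_prod (Suc n) s - exp (- (a * s)) * binom_prod n s)"
    unfolding model_seq_def by (intro integral_diff[symmetric] model_integrable)
  also have "(\<lambda>s. exp (- (a * s)) * binom_prod (Suc n) s - exp (- (a * s)) * binom_prod n s) =
      (\<lambda>s. (- 1 / real (Suc n)) * (exp (- (a * s)) * (s * binom_prod n s)))"
    unfolding binom_prod_Suc by (rule ext) (simp add: field_simps)
  also have "integral {0..1} \<dots> = (- 1 / real (Suc n)) * integral {0..1} (\<lambda>s. exp (- (a * s)) * (s * binom_prod n s))"
    by (rule integral_mult_right)
  finally show ?thesis by simp
qed

lemma exp_minus_mult_le: "0 \<le> s \<Longrightarrow> s \<le> 1 \<Longrightarrow> exp (- (a * s)) \<le> exp \<bar>a\<bar>" for a s :: real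
proof -
  assume s: "0 \<le> s" "s \<le> 1"
  have "- (a * s) \<le> \<bar>a\<bar> * s" using s by (metis abs_ge_minus_self abs_mult abs_of_nonneg)
  also have "\<dots> \<le> \<bar>a\<bar>" using s by (simp add: mult_left_le)
  finally show ?thesis by simp
qed

lemma model_increment_bound: "\<bar>model_seq a (Suc n) - model_seq a n\<bar> \<le> exp \<bar>a\<bar> / real (Suc n)"
proof -
  have "norm (integral {0..1} (\<lambda>s. exp (- (a * s)) * (s * binom_prod n s))) \<le> exp \<bar>a\<bar> * (1 - 0)"
  proof (rule integral_bound)
    fix s :: real assume s: "s \<in> {0..1}"
    have "s * binom_prod n s \<le> 1 * 1"
      using s binom_prod_bounds[of s n] by (intro mult_mono) auto
    then have "exp (- (a * s)) * (s * binom_prod n s) \<le> exp \<bar>a\<bar> * 1"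
      using s binom_prod_bounds[of s n] exp_minus_mult_le[of s a] by (intro mult_mono) auto
    then show "norm (exp (- (a * s)) * (s * binom_prod n s)) \<le> exp \<bar>a\<bar>"
      using s binom_prod_bounds[of s n] by (simp add: abs_mult)
  qed (auto intro!: continuous_intros)
  then show ?thesis unfolding model_increment by (simp add: divide_right_mono)
qed

lemma model_second_increment_bound:
  "\<bar>(model_seq a (Suc (Suc n)) - model_seq a (Suc n)) - (model_seq a (Suc n) - model_seq a n)\<bar>
     \<le> 2 * exp \<bar>a\<bar> / (real (Suc n))\<^sup>2"
proof -
  define h where "h s = exp (- (a * s)) * (s * (1 + s) * binom_prod n s)" for s
  have i: "(\<lambda>s. exp (- (a * s)) * (s * binom_prod n s)) integrable_on {0..1}" for n
    by (intro integrable_continuous_real continuous_intros)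
  have "(model_seq a (Suc (Suc n)) - model_seq a (Suc n)) - (model_seq a (Suc n) - model_seq a n) =
      (1 / real (Suc n)) * integral {0..1} (\<lambda>s. exp (- (a * s)) * (s * binom_prod n s))
      - (1 / real (Suc (Suc n))) * integral {0..1} (\<lambda>s. exp (- (a * s)) * (s * binom_prod (Suc n) s))"
    unfolding model_increment by simp
  also have "\<dots> = integral {0..1} (\<lambda>s. (1 / real (Suc n)) * (exp (- (a * s)) * (s * binom_prod n s))
      - (1 / real (Suc (Suc n))) * (exp (- (a * s)) * (s * binom_prod (Suc n) s)))"
    unfolding integral_mult_right[symmetric]
    by (intro integral_diff[symmetric] integrable_continuous_real continuous_intros)
  also have "(\<lambda>s. (1 / real (Suc n)) * (exp (- (a * s)) * (s * binom_prod n s))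
      - (1 / real (Suc (Suc n))) * (exp (- (a * s)) * (s * binom_prod (Suc n) s))) =
      (\<lambda>s. (1 / (real (Suc n) * real (Suc (Suc n)))) * h s)"
  proof
    fix s
    have alg: "1 / N * (e * (s * p)) - 1 / (N + 1) * (e * (s * ((1 - s / N) * p))) =
        1 / (N * (N + 1)) * (e * (s * (1 + s) * p))" if "0 < N" for N e p :: real
      using that by (simp add: divide_simps) algebra
    show "1 / real (Suc n) * (exp (- (a * s)) * (s * binom_prod n s))
        - 1 / real (Suc (Suc n)) * (exp (- (a * s)) * (s * binom_prod (Suc n) s)) =
      1 / (real (Suc n) * real (Suc (Suc n))) * h s"
      using alg[of "real (Suc n)" "exp (- (a * s))" "binom_prod n s"]
      by (simp only: binom_prod_Suc h_def of_nat_Suc[of "Suc n"] add.commute[of 1])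
  qed
  also have "integral {0..1} \<dots> = (1 / (real (Suc n) * real (Suc (Suc n)))) * integral {0..1} h"
    by (rule integral_mult_right)
  finally have eq: "(model_seq a (Suc (Suc n)) - model_seq a (Suc n)) - (model_seq a (Suc n) - model_seq a n) =
      (1 / (real (Suc n) * real (Suc (Suc n)))) * integral {0..1} h" .
  have "norm (integral {0..1} h) \<le> (2 * exp \<bar>a\<bar>) * (1 - 0)"
  proof (rule integral_bound)
    fix s :: real assume s: "s \<in> {0..1}"
    have "s * (1 + s) * binom_prod n s \<le> 1 * 2 * 1"
      using s binom_prod_bounds[of s n] by (intro mult_mono) auto
    then have "exp (- (a * s)) * (s * (1 + s) * binom_prod n s) \<le> exp \<bar>a\<bar> * 2"
      using s binom_prod_bounds[of s n] exp_minus_mult_le[of s a] by (intro mult_mono) auto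
    then show "norm (h s) \<le> 2 * exp \<bar>a\<bar>"
      using s binom_prod_bounds[of s n] by (simp add: h_def abs_mult)
  qed (auto simp: h_def[abs_def] intro!: continuous_intros)
  then have "\<bar>(1 / (real (Suc n) * real (Suc (Suc n)))) * integral {0..1} h\<bar> \<le>
      (1 / (real (Suc n) * real (Suc n))) * (2 * exp \<bar>a\<bar>)"
    unfolding abs_mult by (intro mult_mono) (auto intro!: divide_left_mono mult_left_mono)
  then show ?thesis unfolding eq by (simp add: power2_eq_square)
qed

lemma binom_prod_upper:
  assumes "0 \<le> s" "s \<le> 1"
  shows "binom_prod n s \<le> exp (- (s * harm n))"
proof -
  have "binom_prod n s \<le> (\<Prod>k = 1..n. exp (- (s / real k)))"
    unfolding binom_prod_def
  proof (rule prod_mono)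
    fix k assume "k \<in> {1..n}"
    then show "0 \<le> 1 - s / real k \<and> 1 - s / real k \<le> exp (- (s / real k))"
      using assms exp_ge_add_one_self[of "- (s / real k)"] by (auto simp: field_simps)
  qed
  also have "\<dots> = exp (- (s * harm n))"
    by (simp add: exp_sum[symmetric] harm_def sum_distrib_left sum_negf divide_inverse)
  finally show ?thesis .
qed

text \<open>
  From \<open>1 - x \<ge> e\<^sup>-\<^sup>x (1 - x\<^sup>2)\<close>, factor by factor, and \<open>\<Prod> (1 - x\<^sub>k\<^sup>2) \<ge> 1 - \<Sum> x\<^sub>k\<^sup>2\<close>.
\<close>

lemma binom_prod_lower:
  assumes "0 \<le> s" "s \<le> 1"
  shows "exp (- (s * harm n)) * (1 - s\<^sup>2 * (\<Sum>k = 1..n. 1 / (real k)\<^sup>2)) \<le> binom_prod n s"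
proof (induction n)
  case (Suc n)
  define x where "x = s / real (Suc n)"
  have x: "0 \<le> x" "x \<le> 1" using assms by (auto simp: x_def field_simps)
  define Z where "Z = s\<^sup>2 * (\<Sum>k = 1..n. 1 / (real k)\<^sup>2)"
  have Z: "0 \<le> Z" by (simp add: Z_def sum_nonneg)
  have x_le: "exp (- x) * (1 - x\<^sup>2) \<le> 1 - x"
  proof -
    have "exp (- x) * (1 + x) \<le> exp (- x) * exp x"
      using exp_ge_add_one_self[of x] by (intro mult_left_mono) auto
    then have "exp (- x) * (1 + x) \<le> 1" by (simp flip: exp_add)
    then have "(exp (- x) * (1 + x)) * (1 - x) \<le> 1 * (1 - x)"
      using x by (intro mult_right_mono) auto
    then show ?thesis by (simp add: power2_eq_square algebra_simps)
  qed
  have "s * harm (Suc n) = s * harm n + x"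
    by (simp add: x_def harm_Suc distrib_left divide_inverse)
  moreover have "s\<^sup>2 * (\<Sum>k = 1..Suc n. 1 / (real k)\<^sup>2) = Z + x\<^sup>2"
    by (simp add: Z_def x_def distrib_left power_divide)
  ultimately have "exp (- (s * harm (Suc n))) * (1 - s\<^sup>2 * (\<Sum>k = 1..Suc n. 1 / (real k)\<^sup>2)) =
      exp (- (s * harm n)) * exp (- x) * (1 - (Z + x\<^sup>2))"
    by (simp flip: exp_add)
  also have "\<dots> \<le> exp (- (s * harm n)) * exp (- x) * ((1 - Z) * (1 - x\<^sup>2))"
    using Z by (intro mult_left_mono) (auto simp: algebra_simps)
  also have "\<dots> = (exp (- (s * harm n)) * (1 - Z)) * (exp (- x) * (1 - x\<^sup>2))" by simp
  also have "\<dots> \<le> binom_prod n s * (exp (- x) * (1 - x\<^sup>2))"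
    using Suc x by (intro mult_right_mono) (auto simp: Z_def abs_square_le_1)
  also have "\<dots> \<le> binom_prod n s * (1 - x)"
    using x_le binom_prod_bounds[OF assms] by (intro mult_left_mono)
  finally show ?case by (simp add: binom_prod_Suc x_def mult.commute)
qed (simp add: harm_expand)

lemma sum_inverse_squares_le_2: "(\<Sum>k = 1..n. 1 / (real k)\<^sup>2) \<le> 2"
proof -
  have "(\<Sum>k = 1..Suc n. 1 / (real k)\<^sup>2) \<le> 2 - 1 / real (Suc n)" for n
  proof (induction n)
    case (Suc n)
    have "1 / (real (Suc (Suc n)))\<^sup>2 \<le> 1 / real (Suc n) - 1 / real (Suc (Suc n))"
    proof -
      have "1 / (real (Suc (Suc n)))\<^sup>2 \<le> 1 / (real (Suc n) * real (Suc (Suc n)))"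
        unfolding power2_eq_square by (intro divide_left_mono mult_right_mono) auto
      also have "\<dots> = 1 / real (Suc n) - 1 / real (Suc (Suc n))" by (simp add: field_simps)
      finally show ?thesis .
    qed
    then show ?case using Suc by simp
  qed simp
  from this[of "n - 1"] show ?thesis
    by (cases n) (auto intro: order.trans)
qed

text \<open>
  The binomial product is \<open>e\<^sup>-\<^sup>s\<^sup>h (1 + O(s\<^sup>2))\<close> with \<open>h\<close> the harmonic number, and the integral is
  concentrated on \<open>s\<close> of order \<open>1/A\<close> with \<open>A = a + h\<close>, so the correction has relative size
  \<open>O(A\<^sup>-\<^sup>2)\<close>. The absence of a linear term in \<open>s\<close> is what makes \<open>1 / (a + h)\<close> exact to second
  order.
\<close>

lemma model_seq_asymp:
  assumes A: "0 < a + harm n"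
  shows "\<bar>model_seq a n - 1 / (a + harm n)\<bar> \<le> 6 / (a + harm n) ^ 3"
proof -
  define A where "A = a + (harm n :: real)"
  have A0: "0 < A" using A by (simp add: A_def)
  have I0: "((\<lambda>s. exp (- (A * s))) has_integral ((1 - exp (- A)) / A)) {0..1}"
  proof -
    have "((\<lambda>s. exp (- (A * s))) has_integral (- exp (- (A * 1)) / A - - exp (- (A * 0)) / A)) {0..1}"
    proof (rule fundamental_theorem_of_calculus)
      show "((\<lambda>s. - exp (- (A * s)) / A) has_vector_derivative exp (- (A * s))) (at s within {0..1})" for s
        unfolding has_real_derivative_iff_has_vector_derivative[symmetric]
        using A0 by (auto intro!: derivative_eq_intros)
    qed simp
    then show ?thesis by (simp add: diff_divide_distrib)
  qed
  define Fa where "Fa s = - exp (- (A * s)) * (s\<^sup>2 / A + 2 * s / A\<^sup>2 + 2 / A ^ 3)" for s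
  have I2: "((\<lambda>s. exp (- (A * s)) * s\<^sup>2) has_integral (Fa 1 - Fa 0)) {0..1}"
  proof (rule fundamental_theorem_of_calculus)
    show "(Fa has_vector_derivative exp (- (A * s)) * s\<^sup>2) (at s within {0..1})" for s
      unfolding has_real_derivative_iff_has_vector_derivative[symmetric] Fa_def[abs_def]
      using A0 by (auto intro!: derivative_eq_intros simp: field_simps power2_eq_square power3_eq_cube)
  qed simp
  have I2_le: "Fa 1 - Fa 0 \<le> 2 / A ^ 3"
    using A0 by (simp add: Fa_def)
  have M: "((\<lambda>s. exp (- (a * s)) * binom_prod n s) has_integral model_seq a n) {0..1}"
    unfolding model_seq_def by (intro integrable_integral model_integrable)
  have split: "exp (- (A * s)) = exp (- (a * s)) * exp (- (s * harm n))" for s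
    by (simp add: A_def algebra_simps flip: exp_add)
  have upper: "model_seq a n \<le> (1 - exp (- A)) / A"
  proof (rule has_integral_le[OF M I0])
    fix s :: real assume "s \<in> {0..1}"
    then show "exp (- (a * s)) * binom_prod n s \<le> exp (- (A * s))"
      unfolding split using binom_prod_upper[of s n] by (intro mult_left_mono) auto
  qed
  have lower: "(1 - exp (- A)) / A - 2 * (Fa 1 - Fa 0) \<le> model_seq a n"
  proof (rule has_integral_le[OF has_integral_diff[OF I0 has_integral_mult_right[OF I2]] M])
    fix s :: real assume s: "s \<in> {0..1}"
    have "exp (- (A * s)) - 2 * (exp (- (A * s)) * s\<^sup>2) =
        exp (- (a * s)) * (exp (- (s * harm n)) * (1 - s\<^sup>2 * 2))"
      unfolding split by (simp add: algebra_simps)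
    also have "\<dots> \<le> exp (- (a * s)) * (exp (- (s * harm n)) * (1 - s\<^sup>2 * (\<Sum>k = 1..n. 1 / (real k)\<^sup>2)))"
      using sum_inverse_squares_le_2 by (intro mult_left_mono diff_left_mono) auto
    also have "\<dots> \<le> exp (- (a * s)) * binom_prod n s"
      using s binom_prod_lower[of s n] by (intro mult_left_mono) auto
    finally show "exp (- (A * s)) - 2 * (exp (- (A * s)) * s\<^sup>2) \<le> exp (- (a * s)) * binom_prod n s" .
  qed
  have expA: "exp (- A) / A \<le> 2 / A ^ 3"
  proof -
    have "A\<^sup>2 / 2 \<le> exp A" using exp_lower_Taylor_quadratic[of A] A0 by simp
    then have "exp (- A) \<le> 2 / A\<^sup>2" using A0 by (simp add: exp_minus field_simps)
    then have "exp (- A) / A \<le> 2 / A\<^sup>2 / A" using A0 by (intro divide_right_mono) auto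
    then show ?thesis by (simp add: power2_eq_square power3_eq_cube)
  qed
  have "0 \<le> exp (- A) / A" using A0 by simp
  with upper have "model_seq a n \<le> 1 / A" by (simp add: diff_divide_distrib)
  moreover have "1 / A - 6 / A ^ 3 \<le> model_seq a n"
    using lower I2_le expA by (simp add: diff_divide_distrib)
  ultimately show ?thesis using A0 unfolding A_def[symmetric] by (simp add: abs_le_iff)
qed

section \<open>Asymptotics of the scalar renewal sequence\<close>

lemma bigo_all_pos:
  fixes b g :: "nat \<Rightarrow> real"
  assumes "b \<in> O(g)" "\<And>n. 0 < n \<Longrightarrow> 0 < g n"
  obtains K where "0 < K" "\<And>n. 0 < n \<Longrightarrow> \<bar>b n\<bar> \<le> K * g n"
proof -
  obtain C where C: "C > 0" "\<forall>\<^sub>F n in sequentially. \<bar>b n\<bar> \<le> C * \<bar>g n\<bar>"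
    using assms(1) by (elim landau_o.bigE) auto
  then obtain N where N: "\<And>n. n \<ge> N \<Longrightarrow> \<bar>b n\<bar> \<le> C * \<bar>g n\<bar>"
    by (auto simp: eventually_sequentially)
  define K where "K = C + (\<Sum>n<N. \<bar>b n\<bar> / \<bar>g n\<bar>)"
  have s: "0 \<le> (\<Sum>n<N. \<bar>b n\<bar> / \<bar>g n\<bar>)" by (intro sum_nonneg) auto
  show ?thesis
  proof (rule that[of K])
    show "0 < K" using C s by (simp add: K_def)
    fix n :: nat assume n: "0 < n"
    show "\<bar>b n\<bar> \<le> K * g n"
    proof (cases "n \<ge> N")
      case True
      have "\<bar>b n\<bar> \<le> C * g n" using N[OF True] assms(2)[OF n] by simp
      also have "\<dots> \<le> K * g n" using s assms(2)[OF n] by (intro mult_right_mono) (auto simp: K_def)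
      finally show ?thesis .
    next
      case False
      then have "\<bar>b n\<bar> / \<bar>g n\<bar> \<le> (\<Sum>n<N. \<bar>b n\<bar> / \<bar>g n\<bar>)"
        by (intro member_le_sum) auto
      then have "\<bar>b n\<bar> / g n \<le> K" using C assms(2)[OF n] by (simp add: K_def)
      then show ?thesis using assms(2)[OF n] by (simp add: field_simps)
    qed
  qed
qed

text \<open>
  Half of the excess \<open>2\<eta>\<close> in the exponent secures convergence, the other half gives the rate.
\<close>

lemma tail_sum_power_le:
  fixes b :: "nat \<Rightarrow> real"
  assumes \<eta>: "0 < \<eta>" and b: "\<And>k. 0 < k \<Longrightarrow> \<bar>b k\<bar> \<le> C * real k powr (- 1 - 2 * \<eta>)"
  obtains Z where "0 \<le> Z" "summable (\<lambda>k. \<bar>b k\<bar>)"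
    "\<And>N. 0 < N \<Longrightarrow> (\<Sum>k. \<bar>b (k + N)\<bar>) \<le> Z * real N powr (- \<eta>)"
proof -
  have C0: "0 \<le> C" using order.trans[OF abs_ge_zero b[of 1]] by simp
  define p where "p k = real k powr (- 1 - \<eta>)" for k
  have p: "summable p" unfolding p_def[abs_def] using \<eta> by (simp add: summable_real_powr_iff)
  have le: "\<bar>b (k + N)\<bar> \<le> C * (p (k + N) * real N powr (- \<eta>))" if "0 < N" for k N
  proof -
    have e: "- 1 - 2 * \<eta> = (- 1 - \<eta>) + (- \<eta>)" by simp
    have "real (k + N) powr (- 1 - 2 * \<eta>) = p (k + N) * real (k + N) powr (- \<eta>)"
      unfolding e p_def by (rule powr_add)
    also have "\<dots> \<le> p (k + N) * real N powr (- \<eta>)"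
      using that \<eta> by (intro mult_left_mono powr_mono2') (auto simp: p_def)
    finally have "C * real (k + N) powr (- 1 - 2 * \<eta>) \<le> C * (p (k + N) * real N powr (- \<eta>))"
      using C0 by (rule mult_left_mono)
    then show ?thesis using b[of "k + N"] that by simp
  qed
  have summ: "summable (\<lambda>k. C * (p (k + N) * real N powr (- \<eta>)))" for N
    using p by (intro summable_mult summable_mult2) (simp add: summable_iff_shift)
  have summ_b: "summable (\<lambda>k. \<bar>b (k + N)\<bar>)" if "0 < N" for N
    by (rule summable_comparison_test'[OF summ[of N]]) (use le that in auto)
  show ?thesis
  proof (rule that[of "C * suminf p"])
    show "0 \<le> C * suminf p" using C0 p by (intro mult_nonneg_nonneg suminf_nonneg) (auto simp: p_def)
    show "summable (\<lambda>k. \<bar>b k\<bar>)" using summ_b[of 1] summable_Suc_iff[of "\<lambda>k. \<bar>b k\<bar>"] by simp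
    fix N :: nat assume N: "0 < N"
    have "(\<Sum>k. \<bar>b (k + N)\<bar>) \<le> (\<Sum>k. C * (p (k + N) * real N powr (- \<eta>)))"
      using N by (intro suminf_le le summ_b summ)
    also have "\<dots> = C * ((\<Sum>k. p (k + N)) * real N powr (- \<eta>))"
      using p by (subst suminf_mult) (auto simp: suminf_mult2 summable_iff_shift intro!: summable_mult2)
    also have "(\<Sum>k. p (k + N)) \<le> suminf p"
    proof -
      have "0 \<le> (\<Sum>i<N. p i)" by (intro sum_nonneg) (simp add: p_def)
      then show ?thesis using suminf_minus_initial_segment[OF p, of N] by linarith
    qed
    finally show "(\<Sum>k. \<bar>b (k + N)\<bar>) \<le> C * suminf p * real N powr (- \<eta>)"
      using C0 by (simp add: mult_left_mono mult_right_mono mult.assoc)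
  qed
qed

context aperiodic_renewal_tail
begin

text \<open>
  The value at \<open>z = 1\<close> of \<open>1/c + \<Sum>\<^sub>n H(n) z\<^sup>n\<close>, the part of the tail series of \<open>1 - \<psi>\<close> that is
  continuous at \<open>1\<close>, divided by \<open>c\<close>.
\<close>

definition shift :: real where "shift = 1 / c + suminf H"

abbreviation v :: "nat \<Rightarrow> real" where "v \<equiv> model_seq shift"

text \<open>
  The convolution of the tails with the model sequence. Its generating function is
  \<open>\<tau>(z) V(z) / c\<close>, where \<open>\<tau>\<close> belongs to the tails and \<open>V\<close> to the model. For an exact model it
  would be \<open>1 / (1 - z)\<close>, i.e. \<open>w = 1\<close>; the differences \<open>xi\<close> measure the deviation.
\<close>

definition w :: "nat \<Rightarrow> real" where "w n = (\<Sum>j\<le>n. tail j * v (n - j)) / c"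

definition xi :: "nat \<Rightarrow> real" where "xi n = w n - (if n = 0 then 0 else w (n - 1))"

lemma summable_H: "summable H"
  using summable_abs_H by (rule summable_rabs_cancel)

lemma sum_xi: "(\<Sum>k\<le>n. xi k) = w n"
  by (induction n) (auto simp: xi_def)

text \<open>
  In generating functions: \<open>U (1 - z) \<tau> = 1\<close> because \<open>1 - \<psi> = (1 - z) \<tau>\<close>, and \<open>xi\<close> belongs to
  \<open>(1 - z) \<tau> V / c\<close>.
\<close>

lemma v_conv_xi: "v n / c = (\<Sum>k\<le>n. u (n - k) * xi k)"
proof -
  define U F W V where "U = Abs_fps u" and "F = Abs_fps f" and "W = Abs_fps tail"
    and "V = Abs_fps (\<lambda>n. v n / c)"
  have "U = 1 + U * F"
  proof (rule fps_ext)
    fix n show "fps_nth U n = fps_nth (1 + U * F) n"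
      using renewal_seq_conv[of f n] by (simp add: U_def F_def fps_mult_nth atLeast0AtMost)
  qed
  then have UF: "U * (1 - F) = 1" by (simp add: algebra_simps)
  have "W * (1 - fps_X) = 1 - F"
  proof (rule fps_ext)
    fix n show "fps_nth (W * (1 - fps_X)) n = fps_nth (1 - F) n"
      by (cases n) (simp_all add: W_def F_def right_diff_distrib tail_Suc)
  qed
  then have "U * (W * (1 - fps_X)) = 1" using UF by simp
  moreover have "U * (W * V * (1 - fps_X)) = (U * (W * (1 - fps_X))) * V" by (simp only: mult_ac)
  ultimately have UV: "U * (W * V * (1 - fps_X)) = V" by simp
  have "fps_nth (W * V * (1 - fps_X)) k = xi k" for k
  proof -
    have WV: "fps_nth (W * V) m = w m" for m
      by (simp add: W_def V_def w_def fps_mult_nth atLeast0AtMost sum_divide_distrib)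
    show ?thesis using WV[of 0] by (cases k) (simp_all add: right_diff_distrib WV xi_def)
  qed
  then have "fps_nth (U * (W * V * (1 - fps_X))) n = (\<Sum>i\<le>n. u i * xi (n - i))"
    by (subst fps_mult_nth) (simp add: atLeast0AtMost U_def)
  also have "\<dots> = (\<Sum>k\<le>n. u (n - k) * xi k)"
    by (rule sum.reindex_bij_witness[of _ "\<lambda>k. n - k" "\<lambda>i. n - i"]) auto
  finally have "fps_nth V n = (\<Sum>k\<le>n. u (n - k) * xi k)" unfolding UV .
  then show ?thesis by (simp add: V_def)
qed

text \<open>
  The renewal equation of the model cancels the contribution of \<open>1/n\<close> to the tails; \<open>shift\<close> is
  chosen such that what remains is the convolution of \<open>H\<close> with \<open>v\<close> minus its value for
  constant \<open>v\<close>.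
\<close>

lemma w_eq:
  assumes "0 < n"
  shows "w n = 1 + (\<Sum>j\<le>n. H j * v (n - j)) - suminf H * v n"
proof -
  have "(\<Sum>j\<le>n. tail j * v (n - j)) = v n + (\<Sum>j = 1..n. tail j * v (n - j))"
    by (subst sum.atMost_shift) (simp add: sum.atLeast1_atMost_eq lessThan_Suc_atMost)
  also have "(\<Sum>j = 1..n. tail j * v (n - j)) =
      c * (\<Sum>j = 1..n. v (n - j) / real j) + c * (\<Sum>j = 1..n. H j * v (n - j))"
    unfolding sum_distrib_left sum.distrib[symmetric]
    by (intro sum.cong) (auto simp: tail_eq algebra_simps)
  also have "(\<Sum>j = 1..n. H j * v (n - j)) = (\<Sum>j\<le>n. H j * v (n - j))"
    by (intro sum.mono_neutral_left) (auto simp: not_le)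
  also have "(\<Sum>j = 1..n. v (n - j) / real j) = 1 - shift * v n"
    using model_seq_renewal[OF assms, of shift] by simp
  finally have "w n = v n / c + (1 - shift * v n) + (\<Sum>j\<le>n. H j * v (n - j))"
    using c_pos by (simp add: w_def add_divide_distrib)
  moreover have "shift * x = x / c + suminf H * x" for x by (simp add: shift_def distrib_right)
  from this[of "v n"] have "shift * v n = v n / c + suminf H * v n" .
  ultimately show ?thesis by linarith
qed

text \<open>
  The decay exponent is reduced to at most \<open>2\<close>, so that the decay of the second differences of
  the model never limits the estimates that follow.
\<close>

lemma H_power_bound:
  obtains \<delta> K where "0 < \<delta>" "\<delta> \<le> 1 / 2" "0 < K"
    "\<And>j. 0 < j \<Longrightarrow> \<bar>H j\<bar> \<le> K * real j powr (- 1 - 2 * \<delta>)"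
proof -
  define \<delta> where "\<delta> = min ((q - 1) / 2) (1 / 2)"
  obtain K where K: "0 < K" "\<And>n. 0 < n \<Longrightarrow> \<bar>H n\<bar> \<le> K * real n powr (- q)"
    by (rule bigo_all_pos[OF H_bigo]) (auto intro: that)
  show ?thesis
  proof (rule that[of \<delta> K])
    show "0 < \<delta>" "\<delta> \<le> 1 / 2" using q_gt_1 by (auto simp: \<delta>_def)
    fix j :: nat assume j: "0 < j"
    have "real j powr (- q) \<le> real j powr (- 1 - 2 * \<delta>)"
      using j by (intro powr_mono) (auto simp: \<delta>_def min_def field_simps)
    then show "\<bar>H j\<bar> \<le> K * real j powr (- 1 - 2 * \<delta>)"
      using K(1) by (intro order.trans[OF K(2)[OF j]] mult_left_mono) auto
  qed (rule K(1))
qed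

text \<open>
  The first increments of the model are \<open>O(1/n)\<close> and the second ones \<open>O(1/n\<^sup>2)\<close>, which gives
  the better bound while \<open>n - j\<close> is comparable with \<open>n\<close>.
\<close>

lemma v_increment_diff:
  assumes "0 < j" "j < n"
  shows "2 * j \<le> n \<Longrightarrow> \<bar>(v (n - j) - v (n - j - 1)) - (v n - v (n - 1))\<bar> \<le> 8 * exp \<bar>shift\<bar> * real j / (real n)\<^sup>2"
    "\<bar>(v (n - j) - v (n - j - 1)) - (v n - v (n - 1))\<bar> \<le> 2 * exp \<bar>shift\<bar> / real (n - j)"
proof -
  define g where "g m = v m - v (m - 1)" for m
  define E where "E = exp \<bar>shift\<bar>"
  have g1: "\<bar>g m\<bar> \<le> E / real m" if "0 < m" for m
    using that model_increment_bound[of shift "m - 1"] by (simp add: g_def E_def)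
  have "\<bar>g (n - j) - g n\<bar> \<le> \<bar>g (n - j)\<bar> + \<bar>g n\<bar>" by (rule abs_triangle_ineq4)
  also have "\<dots> \<le> E / real (n - j) + E / real (n - j)"
  proof (rule add_mono)
    show "\<bar>g (n - j)\<bar> \<le> E / real (n - j)" using assms by (intro g1) auto
    have "\<bar>g n\<bar> \<le> E / real n" using assms by (intro g1) auto
    also have "\<dots> \<le> E / real (n - j)" using assms by (intro divide_left_mono) (auto simp: E_def)
    finally show "\<bar>g n\<bar> \<le> E / real (n - j)" .
  qed
  finally show "\<bar>(v (n - j) - v (n - j - 1)) - (v n - v (n - 1))\<bar> \<le> 2 * exp \<bar>shift\<bar> / real (n - j)"
    by (simp add: g_def E_def)
  assume j2: "2 * j \<le> n"
  have "g n - g (n - j) = (\<Sum>i<j. g (n - j + Suc i) - g (n - j + i))"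
    using assms by (subst sum_lessThan_telescope) simp
  then have "\<bar>g n - g (n - j)\<bar> \<le> (\<Sum>i<j. \<bar>g (n - j + Suc i) - g (n - j + i)\<bar>)"
    by (simp only: sum_abs)
  also have "\<dots> \<le> (\<Sum>i<j. 8 * E / (real n)\<^sup>2)"
  proof (rule sum_mono)
    fix i assume "i \<in> {..<j}"
    obtain m where m: "n - j + i = Suc m" using assms by (cases "n - j + i") auto
    have "\<bar>g (n - j + Suc i) - g (n - j + i)\<bar> \<le> 2 * E / (real (n - j + i))\<^sup>2"
      using model_second_increment_bound[of shift m] m by (simp add: g_def E_def)
    also have "\<dots> \<le> 2 * E / (real n / 2)\<^sup>2"
      using assms j2 by (intro divide_left_mono power_mono mult_pos_pos) (auto simp: E_def)
    also have "\<dots> = 8 * E / (real n)\<^sup>2" by (simp add: power_divide)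
    finally show "\<bar>g (n - j + Suc i) - g (n - j + i)\<bar> \<le> 8 * E / (real n)\<^sup>2" .
  qed
  finally show "\<bar>(v (n - j) - v (n - j - 1)) - (v n - v (n - 1))\<bar> \<le> 8 * exp \<bar>shift\<bar> * real j / (real n)\<^sup>2"
    by (simp add: g_def E_def abs_minus_commute mult_ac)
qed

text \<open>
  With \<open>g\<close> the increments of \<open>v\<close>, the difference of two values of \<open>w\<close> is
  \<open>H\<^sub>n v\<^sub>0 + \<Sum>\<^sub>j\<^sub><\<^sub>n H\<^sub>j (g\<^sub>n\<^sub>-\<^sub>j - g\<^sub>n) - g\<^sub>n \<Sum>\<^sub>j\<^sub>\<ge>\<^sub>n H\<^sub>j\<close>. In the middle sum the cancellation \<open>g\<^sub>n\<^sub>-\<^sub>j - g\<^sub>n\<close>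
  is used for \<open>2j \<le> n\<close>, and the decay of \<open>H\<^sub>j\<close> for larger \<open>j\<close>.
\<close>

lemma xi_power_bound:
  obtains \<delta> C where "0 < \<delta>" "\<And>n. 0 < n \<Longrightarrow> \<bar>xi n\<bar> \<le> C * real n powr (- 1 - 2 * \<delta>)"
proof -
  obtain \<delta> K where \<delta>: "0 < \<delta>" "\<delta> \<le> 1 / 2" and K: "0 < K"
    "\<And>j. 0 < j \<Longrightarrow> \<bar>H j\<bar> \<le> K * real j powr (- 1 - 2 * \<delta>)"
    by (rule H_power_bound) (rule that)
  obtain Z where Z: "0 \<le> Z" "\<And>N. 0 < N \<Longrightarrow> (\<Sum>k. \<bar>H (k + N)\<bar>) \<le> Z * real N powr (- \<delta>)"
    by (rule tail_sum_power_le[OF \<delta>(1) K(2)]) (auto intro: that)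
  define E where "E = exp \<bar>shift\<bar>"
  have E0: "0 < E" by (simp add: E_def)
  define p where "p k = real k powr (- 1 - \<delta>)" for k :: nat
  have p: "summable p" "\<And>k. 0 \<le> p k"
    unfolding p_def[abs_def] using \<delta> by (simp_all add: summable_real_powr_iff)
  define C where "C = K * \<bar>v 0\<bar> + (8 * E * K * suminf p + 8 * E * K * (1 + 1 / \<delta>)) + Z * E + \<bar>xi 1\<bar>"
  have C_ge: "\<bar>xi 1\<bar> \<le> C"
    using K(1) E0 p Z(1) \<delta>(1) by (simp add: C_def suminf_nonneg)
  have bound: "\<bar>xi n\<bar> \<le> C * p n" if n: "2 \<le> n" for n
  proof -
    define g where "g m = v m - v (m - 1)" for m
    have H_le: "\<bar>H j\<bar> \<le> K * real j powr (- 1 - 2 * \<delta>)" if "0 < j" for j using K(2)[OF that] .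
    have powr_le: "real n powr (- 1 - 2 * \<delta>) \<le> p n"
      using n \<delta> unfolding p_def by (intro powr_mono) auto
    have "(\<Sum>j\<le>n. H j * v (n - j)) = H n * v 0 + (\<Sum>j<n. H j * v (n - j))"
      by (simp flip: lessThan_Suc_atMost)
    moreover have "(\<Sum>j\<le>n - 1. H j * v (n - 1 - j)) = (\<Sum>j<n. H j * v (n - j - 1))"
      using n by (intro sum.cong) (auto simp: diff_right_commute)
    ultimately have "xi n = H n * v 0 + (\<Sum>j<n. H j * g (n - j)) - suminf H * g n"
      using n w_eq[of n] w_eq[of "n - 1"]
      by (simp add: xi_def g_def right_diff_distrib sum_subtractf)
    also have "\<dots> = H n * v 0 + (\<Sum>j<n. H j * (g (n - j) - g n)) - (suminf H - (\<Sum>j<n. H j)) * g n"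
      by (simp add: right_diff_distrib left_diff_distrib sum_subtractf flip: sum_distrib_right)
    finally have "\<bar>xi n\<bar> \<le> \<bar>H n * v 0\<bar> + \<bar>\<Sum>j<n. H j * (g (n - j) - g n)\<bar> + \<bar>(suminf H - (\<Sum>j<n. H j)) * g n\<bar>"
      by linarith
    also have "\<dots> \<le> K * \<bar>v 0\<bar> * p n + (8 * E * K * suminf p + 8 * E * K * (1 + 1 / \<delta>)) * p n + Z * E * p n"
    proof (intro add_mono)
      have "\<bar>H n\<bar> \<le> K * p n"
        using n K(1) by (intro order.trans[OF H_le] mult_left_mono powr_le) auto
      then have "\<bar>H n\<bar> * \<bar>v 0\<bar> \<le> K * p n * \<bar>v 0\<bar>" by (intro mult_right_mono) auto
      then show "\<bar>H n * v 0\<bar> \<le> K * \<bar>v 0\<bar> * p n" by (simp add: abs_mult mult_ac)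
    next
      have term_le: "\<bar>H j * (g (n - j) - g n)\<bar> \<le>
          8 * E * K * p n * p j + 8 * E * K * real n powr (- 1 - 2 * \<delta>) * inverse (real (n - j))"
        if j: "j < n" for j
      proof (cases "j = 0")
        case True
        then show ?thesis using E0 K(1) p by simp
      next
        case False
        then have j0: "0 < j" by simp
        have nn: "0 \<le> 8 * E * K * p n * p j" "0 \<le> 8 * E * K * real n powr (- 1 - 2 * \<delta>) * inverse (real (n - j))"
          using E0 K(1) p by auto
        show ?thesis
        proof (cases "2 * j \<le> n")
          case True
          have "\<bar>H j * (g (n - j) - g n)\<bar> \<le> K * real j powr (- 1 - 2 * \<delta>) * (8 * E * real j / (real n)\<^sup>2)"
            unfolding abs_mult g_def E_def
            using K(1) by (intro mult_mono H_le v_increment_diff(1) j j0 True) auto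
          also have "\<dots> = 8 * E * K * (real j powr (- 1 - 2 * \<delta>) * real j / (real n)\<^sup>2)" by simp
          also have "real j powr (- 1 - 2 * \<delta>) * real j / (real n)\<^sup>2 \<le> p n * p j"
          proof -
            have "real j powr (- 1 - 2 * \<delta>) * real j = real j powr (- 2 * \<delta>)"
              using j0 by (simp add: powr_mult_base' mult.commute powr_diff powr_minus divide_simps)
            also have "\<dots> = p j * real j powr (1 - \<delta>)"
              by (simp add: p_def flip: powr_add)
            also have "\<dots> \<le> p j * real n powr (1 - \<delta>)"
              using j \<delta> p by (intro mult_left_mono powr_mono2) auto
            finally have "real j powr (- 1 - 2 * \<delta>) * real j / (real n)\<^sup>2 \<le> p j * real n powr (1 - \<delta>) / (real n)\<^sup>2"
              by (intro divide_right_mono) auto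
            also have "real n powr (1 - \<delta>) / (real n)\<^sup>2 = p n"
            proof -
              have "p n = real n powr ((1 - \<delta>) - 2)" by (simp add: p_def)
              also have "\<dots> = real n powr (1 - \<delta>) / real n powr 2" by (rule powr_diff)
              also have "real n powr 2 = (real n)\<^sup>2" using n by (simp add: powr_numeral)
              finally show ?thesis ..
            qed
            then have "p j * real n powr (1 - \<delta>) / (real n)\<^sup>2 = p n * p j"
              by (simp flip: times_divide_eq_right)
            finally show ?thesis .
          qed
          finally have "\<bar>H j * (g (n - j) - g n)\<bar> \<le> 8 * E * K * p n * p j"
            using E0 K(1) by (simp add: mult.assoc mult_left_mono)
          then show ?thesis using nn by linarith
        next
          case False
          have "\<bar>H j * (g (n - j) - g n)\<bar> \<le> K * real j powr (- 1 - 2 * \<delta>) * (2 * E / real (n - j))"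
            unfolding abs_mult g_def E_def
            using K(1) by (intro mult_mono H_le v_increment_diff(2) j j0) auto
          also have "\<dots> \<le> K * (4 * real n powr (- 1 - 2 * \<delta>)) * (2 * E / real (n - j))"
          proof (intro mult_right_mono mult_left_mono)
            have "real j powr (- 1 - 2 * \<delta>) \<le> (real n / 2) powr (- 1 - 2 * \<delta>)"
              using False n \<delta> by (intro powr_mono2') auto
            also have "\<dots> = real n powr (- 1 - 2 * \<delta>) * 2 powr (1 + 2 * \<delta>)"
            proof -
              have e: "1 + 2 * \<delta> = - (- 1 - 2 * \<delta>)" by simp
              have "(2::real) powr (1 + 2 * \<delta>) = 1 / 2 powr (- 1 - 2 * \<delta>)"
                unfolding e by (rule powr_minus_divide)
              then show ?thesis by (simp add: powr_divide)
            qed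
            also have "\<dots> \<le> real n powr (- 1 - 2 * \<delta>) * 2 powr 2"
              using \<delta> by (intro mult_left_mono powr_mono) auto
            finally show "real j powr (- 1 - 2 * \<delta>) \<le> 4 * real n powr (- 1 - 2 * \<delta>)"
              by simp
          qed (use K(1) E0 in auto)
          also have "\<dots> = 8 * E * K * real n powr (- 1 - 2 * \<delta>) * inverse (real (n - j))"
            by (simp add: divide_inverse mult_ac)
          finally show ?thesis using nn by linarith
        qed
      qed
      have "\<bar>\<Sum>j<n. H j * (g (n - j) - g n)\<bar> \<le> (\<Sum>j<n. \<bar>H j * (g (n - j) - g n)\<bar>)" by (rule sum_abs)
      also have "\<dots> \<le> (\<Sum>j<n. 8 * E * K * p n * p j + 8 * E * K * real n powr (- 1 - 2 * \<delta>) * inverse (real (n - j)))"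
        by (intro sum_mono term_le) auto
      also have "\<dots> = 8 * E * K * p n * (\<Sum>j<n. p j) + 8 * E * K * real n powr (- 1 - 2 * \<delta>) * (\<Sum>j<n. inverse (real (n - j)))"
        by (simp add: sum.distrib sum_distrib_left)
      also have "(\<Sum>j<n. inverse (real (n - j))) = harm n"
        unfolding harm_def by (rule sum.reindex_bij_witness[of _ "\<lambda>k. n - k" "\<lambda>j. n - j"]) auto
      also have "8 * E * K * p n * (\<Sum>j<n. p j) + 8 * E * K * real n powr (- 1 - 2 * \<delta>) * harm n \<le>
          8 * E * K * p n * suminf p + 8 * E * K * ((1 + 1 / \<delta>) * p n)"
      proof (intro add_mono mult_left_mono)
        show "(\<Sum>j<n. p j) \<le> suminf p" using p by (intro sum_le_suminf) auto
        obtain m where m: "n = Suc m" using n by (cases n) auto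
        have "harm n \<le> 1 + ln (real n)"
          using decseqD[OF decseq_harm_diff_ln, of 0 m] m by (simp add: harm_expand)
        also have "\<dots> \<le> real n powr \<delta> + real n powr \<delta> / \<delta>"
          using n \<delta> by (intro add_mono ln_powr_bound ge_one_powr_ge_zero) auto
        also have "\<dots> = (1 + 1 / \<delta>) * real n powr \<delta>" by (simp add: distrib_right)
        finally have "real n powr (- 1 - 2 * \<delta>) * harm n \<le> real n powr (- 1 - 2 * \<delta>) * ((1 + 1 / \<delta>) * real n powr \<delta>)"
          by (intro mult_left_mono) auto
        also have "\<dots> = (1 + 1 / \<delta>) * (real n powr (- 1 - 2 * \<delta>) * real n powr \<delta>)" by simp
        also have "real n powr (- 1 - 2 * \<delta>) * real n powr \<delta> = p n"
        proof -
          have e: "- 1 - 2 * \<delta> + \<delta> = - 1 - \<delta>" by simp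
          show ?thesis unfolding p_def powr_add[symmetric] e ..
        qed
        finally show "8 * E * K * real n powr (- 1 - 2 * \<delta>) * harm n \<le> 8 * E * K * ((1 + 1 / \<delta>) * p n)"
          using E0 K(1) by (simp add: mult.assoc)
      qed (use E0 K(1) p in auto)
      finally show "\<bar>\<Sum>j<n. H j * (g (n - j) - g n)\<bar> \<le> (8 * E * K * suminf p + 8 * E * K * (1 + 1 / \<delta>)) * p n"
        by (simp add: algebra_simps)
    next
      have "\<bar>suminf H - (\<Sum>j<n. H j)\<bar> = \<bar>\<Sum>k. H (k + n)\<bar>"
        using suminf_minus_initial_segment[OF summable_H, of n] by simp
      also have "\<dots> \<le> (\<Sum>k. \<bar>H (k + n)\<bar>)"
        using summable_abs_H by (intro summable_rabs) (simp add: summable_iff_shift[of "\<lambda>k. \<bar>H k\<bar>"])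
      also have "\<dots> \<le> Z * real n powr (- \<delta>)" using n by (intro Z) auto
      finally have 1: "\<bar>suminf H - (\<Sum>j<n. H j)\<bar> \<le> Z * real n powr (- \<delta>)" .
      have 2: "\<bar>g n\<bar> \<le> E / real n"
        using n model_increment_bound[of shift "n - 1"] by (simp add: g_def E_def)
      have "\<bar>(suminf H - (\<Sum>j<n. H j)) * g n\<bar> \<le> Z * real n powr (- \<delta>) * (E / real n)"
        unfolding abs_mult using 1 2 Z(1) by (intro mult_mono) auto
      also have "\<dots> = Z * E * p n"
        using n by (simp add: p_def powr_diff powr_minus divide_simps)
      finally show "\<bar>(suminf H - (\<Sum>j<n. H j)) * g n\<bar> \<le> Z * E * p n" .
    qed
    also have "\<dots> \<le> C * p n"
      using p by (simp add: C_def algebra_simps)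
    finally show ?thesis .
  qed
  show ?thesis
  proof (rule that[of "\<delta> / 2" C])
    fix n :: nat assume n: "0 < n"
    show "\<bar>xi n\<bar> \<le> C * real n powr (- 1 - 2 * (\<delta> / 2))"
    proof (cases "n = 1")
      case True
      then show ?thesis using C_ge by simp
    next
      case False
      then show ?thesis using bound[of n] n by (simp add: p_def)
    qed
  qed (use \<delta> in simp)
qed

end

text \<open>
  \<open>h\<^sub>n - log n\<close> decreases and \<open>h\<^sub>n - log n - 1/n\<close> increases to Euler's constant, where \<open>h\<^sub>n\<close> is
  the harmonic number.
\<close>

lemma harm_minus_ln_bounds:
  assumes "0 < n"
  shows "0 \<le> harm n - ln (real n) - euler_mascheroni" "harm n - ln (real n) - euler_mascheroni \<le> 1 / real n"
proof -
  have "euler_mascheroni \<le> harm n - ln (real n)"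
    using euler_mascheroni_sequence_decreasing[OF assms]
    by (intro tendsto_upperbound[OF euler_mascheroni_LIMSEQ] eventually_sequentiallyI[of n]) auto
  then show "0 \<le> harm n - ln (real n) - euler_mascheroni" by simp
  have mono: "harm n - ln (real n) - 1 / real n \<le> harm k - ln (real k) - 1 / real k" if "n \<le> k" for k
    using that
  proof (induction k rule: dec_induct)
    case (step k)
    then have k: "0 < k" using assms by simp
    have "ln (real (Suc k)) - ln (real k) \<le> 1 / real k"
      using ln_diff_le_inverse[of "real k"] k by (simp add: add.commute)
    then show ?case using step by (simp add: harm_Suc divide_inverse)
  qed simp
  have "harm n - ln (real n) - 1 / real n \<le> euler_mascheroni"
    by (intro tendsto_lowerbound[OF euler_mascheroni_LIMSEQ] eventually_sequentiallyI[of n] order.trans[OF mono]) auto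
  then show "harm n - ln (real n) - euler_mascheroni \<le> 1 / real n" by simp
qed

lemma bigo_cmult:
  fixes g h :: "nat \<Rightarrow> real"
  shows "g \<in> O(h) \<Longrightarrow> (\<lambda>n. k * g n) \<in> O(h)"
  by (cases "k = 0") auto

context aperiodic_renewal_tail
begin

lemma harm_plus_at_top: "filterlim (\<lambda>n. a + harm n :: real) at_top sequentially"
  by (intro filterlim_tendsto_add_at_top[OF tendsto_const harm_at_top])

lemma v_tendsto_0: "v \<longlonglongrightarrow> 0"
proof -
  define A where "A n = shift + (harm n :: real)" for n
  have A: "filterlim A at_top sequentially" unfolding A_def by (rule harm_plus_at_top)
  have "((\<lambda>x::real. 1 / x + 6 / x ^ 3) \<longlongrightarrow> 0) at_top" by real_asymp
  then have lim: "(\<lambda>n. 1 / A n + 6 / A n ^ 3) \<longlonglongrightarrow> 0" by (rule filterlim_compose[OF _ A])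
  show ?thesis
  proof (rule Lim_null_comparison[OF _ lim])
    have "\<forall>\<^sub>F n in sequentially. 0 < A n" using A by (simp add: filterlim_at_top_dense)
    then show "\<forall>\<^sub>F n in sequentially. norm (v n) \<le> 1 / A n + 6 / A n ^ 3"
    proof eventually_elim
      case (elim n)
      have "\<bar>v n\<bar> \<le> \<bar>1 / A n\<bar> + \<bar>v n - 1 / A n\<bar>" by linarith
      then show ?case using model_seq_asymp[of shift n] elim by (simp add: A_def)
    qed
  qed
qed

text \<open>
  The convolution of the summable \<open>H\<close> with the null sequence \<open>v\<close> tends to \<open>0\<close>.
\<close>

lemma w_tendsto_1: "w \<longlonglongrightarrow> 1"
proof -
  obtain B where B: "\<And>n. \<bar>v n\<bar> \<le> B"
    using convergent_imp_Bseq[OF convergentI[OF v_tendsto_0]] by (auto simp: Bseq_def)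
  define a where "a j n = (if j \<le> n then H j * v (n - j) else 0)" for j n
  have lim_a: "a j \<longlonglongrightarrow> 0" for j
  proof -
    have "(\<lambda>n. a j (n + j)) \<longlonglongrightarrow> H j * 0"
      unfolding a_def using tendsto_mult_left[OF v_tendsto_0, of "H j"] by simp
    then have "(\<lambda>n. a j (n + j)) \<longlonglongrightarrow> 0" by simp
    then show ?thesis by (rule LIMSEQ_offset)
  qed
  have bound: "norm (a j n) \<le> \<bar>H j\<bar> * B" for j n
    using B[of "n - j"] B[of 0] by (auto simp: a_def abs_mult intro: mult_left_mono)
  have "(\<lambda>n. \<Sum>j. a j n) \<longlonglongrightarrow> (\<Sum>j. 0)"
  proof (rule tannerys_theorem[OF lim_a, where M = "\<lambda>j. \<bar>H j\<bar> * B", THEN conjunct2, THEN conjunct2])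
    show "\<forall>\<^sub>F (k, n) in at_top \<times>\<^sub>F sequentially. norm (a k n) \<le> \<bar>H k\<bar> * B"
      using bound by (intro always_eventually) auto
    show "summable (\<lambda>j. \<bar>H j\<bar> * B)" by (intro summable_mult2 summable_abs_H)
  qed simp
  moreover have "(\<Sum>j. a j n) = (\<Sum>j\<le>n. H j * v (n - j))" for n
    by (subst suminf_finite[of "{..n}"]) (auto simp: a_def)
  ultimately have conv: "(\<lambda>n. \<Sum>j\<le>n. H j * v (n - j)) \<longlonglongrightarrow> 0" by simp
  have "(\<lambda>n. 1 + (\<Sum>j\<le>n. H j * v (n - j)) - suminf H * v n) \<longlonglongrightarrow> 1 + 0 - suminf H * 0"
    by (intro tendsto_intros conv v_tendsto_0)
  then have lim: "(\<lambda>n. 1 + (\<Sum>j\<le>n. H j * v (n - j)) - suminf H * v n) \<longlonglongrightarrow> 1" by simp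
  show ?thesis
  proof (rule Lim_transform_eventually[OF lim])
    show "\<forall>\<^sub>F n in sequentially. 1 + (\<Sum>j\<le>n. H j * v (n - j)) - suminf H * v n = w n"
      using eventually_gt_at_top[of 0] by eventually_elim (rule w_eq[symmetric])
  qed
qed

text \<open>
  As \<open>xi\<close> sums to \<open>1\<close>, \<open>v\<^sub>n / c - u\<^sub>n\<close> is the sum over \<open>k \<le> n\<close> of \<open>(u\<^sub>n\<^sub>-\<^sub>k - u\<^sub>n) xi\<^sub>k\<close> up to the
  tail of \<open>xi\<close>. For \<open>k\<close> up to \<open>K = n\<^sup>1\<^sup>/\<^sup>4\<close> the increments \<open>O(n\<^sup>-\<^sup>1\<^sup>/\<^sup>2)\<close> of \<open>u\<close> make the difference
  small, for larger \<open>k\<close> the power decay of \<open>xi\<close> suffices; any positive exponent of \<open>n\<close> below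
  \<open>1/2\<close> would do.
\<close>

lemma model_seq_approx:
  "(\<lambda>n. v n / c - u n) \<in> O(\<lambda>n. 1 / ln (real n) ^ 3)"
proof -
  obtain \<delta> C where \<delta>: "0 < \<delta>" and C: "\<And>n. 0 < n \<Longrightarrow> \<bar>xi n\<bar> \<le> C * real n powr (- 1 - 2 * \<delta>)"
    by (rule xi_power_bound) (rule that)
  obtain Z where Z: "0 \<le> Z" "summable (\<lambda>k. \<bar>xi k\<bar>)"
    "\<And>N. 0 < N \<Longrightarrow> (\<Sum>k. \<bar>xi (k + N)\<bar>) \<le> Z * real N powr (- \<delta>)"
    by (rule tail_sum_power_le[OF \<delta> C]) (auto intro: that)
  define X where "X = (\<Sum>k. \<bar>xi k\<bar>)"
  have X0: "0 \<le> X" unfolding X_def using Z(2) by (intro suminf_nonneg) auto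
  have "(\<lambda>n. u (Suc n) - u n) \<in> O(\<lambda>n. 1 / sqrt (real n))"
    by (rule landau_o.big_trans[OF u_increments]) real_asymp
  then obtain D where D: "0 < D" "\<And>n. 0 < n \<Longrightarrow> \<bar>u (Suc n) - u n\<bar> \<le> D * (1 / sqrt (real n))"
    by (rule bigo_all_pos) (auto intro: that)
  have tail_xi: "\<bar>w K - 1\<bar> \<le> Z * real (Suc K) powr (- \<delta>)" for K
  proof -
    have "xi sums 1"
      unfolding sums_def_le using w_tendsto_1 by (simp add: sum_xi)
    then have "(\<Sum>k. xi (k + Suc K)) = 1 - w K"
      using suminf_minus_initial_segment[of xi "Suc K"] by (simp add: sums_iff lessThan_Suc_atMost sum_xi)
    then have "\<bar>w K - 1\<bar> = \<bar>\<Sum>k. xi (k + Suc K)\<bar>" by simp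
    also have "\<dots> \<le> (\<Sum>k. \<bar>xi (k + Suc K)\<bar>)"
      using Z(2) by (intro summable_rabs) (simp only: summable_iff_shift[of "\<lambda>k. \<bar>xi k\<bar>"])
    also have "\<dots> \<le> Z * real (Suc K) powr (- \<delta>)" by (rule Z(3)) simp
    finally show ?thesis .
  qed
  have u_close: "\<bar>u (n - k) - u n\<bar> \<le> real k * (2 * D / sqrt (real n))" if k: "2 * k \<le> n" "0 < n" for k n
  proof -
    have "u n - u (n - k) = (\<Sum>i<k. u (n - k + Suc i) - u (n - k + i))"
      using k by (subst sum_lessThan_telescope) simp
    then have "\<bar>u n - u (n - k)\<bar> \<le> (\<Sum>i<k. \<bar>u (n - k + Suc i) - u (n - k + i)\<bar>)"
      by (simp only: sum_abs)
    also have "\<dots> \<le> (\<Sum>i<k. 2 * D / sqrt (real n))"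
    proof (rule sum_mono)
      fix i assume "i \<in> {..<k}"
      have "\<bar>u (n - k + Suc i) - u (n - k + i)\<bar> \<le> D * (1 / sqrt (real (n - k + i)))"
        using D(2)[of "n - k + i"] k by simp
      also have "\<dots> \<le> D * (1 / sqrt (real n / 4))"
        using k D(1) by (intro mult_left_mono divide_left_mono) auto
      also have "sqrt (real n / 4) = sqrt (real n) / 2" by (simp add: real_sqrt_divide)
      finally show "\<bar>u (n - k + Suc i) - u (n - k + i)\<bar> \<le> 2 * D / sqrt (real n)" by (simp add: mult.commute)
    qed
    finally show ?thesis by (simp add: abs_minus_commute)
  qed
  have split_bound: "\<bar>v n / c - u n\<bar> \<le>
      2 * Z * real (Suc K) powr (- \<delta>) + real K * (2 * D / sqrt (real n)) * X"
    if K: "2 * K \<le> n" "0 < n" for n K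
  proof -
    have "{..n} = {..K} \<union> {Suc K..n}" using K by auto
    then have "v n / c = (\<Sum>k\<le>K. u (n - k) * xi k) + (\<Sum>k = Suc K..n. u (n - k) * xi k)"
      unfolding v_conv_xi by (simp add: sum.union_disjoint)
    also have "(\<Sum>k\<le>K. u (n - k) * xi k) = u n * w K + (\<Sum>k\<le>K. (u (n - k) - u n) * xi k)"
      by (simp add: sum_xi[symmetric] sum_distrib_left left_diff_distrib sum_subtractf)
    finally have "v n / c - u n = u n * (w K - 1) + (\<Sum>k\<le>K. (u (n - k) - u n) * xi k)
        + (\<Sum>k = Suc K..n. u (n - k) * xi k)" by (simp add: algebra_simps)
    moreover have "\<bar>u n * (w K - 1)\<bar> \<le> 1 * (Z * real (Suc K) powr (- \<delta>))"
      unfolding abs_mult using u_bounds[of n] by (intro mult_mono tail_xi) auto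
    moreover have "\<bar>\<Sum>k\<le>K. (u (n - k) - u n) * xi k\<bar> \<le> real K * (2 * D / sqrt (real n)) * X"
    proof -
      have "\<bar>\<Sum>k\<le>K. (u (n - k) - u n) * xi k\<bar> \<le> (\<Sum>k\<le>K. \<bar>(u (n - k) - u n) * xi k\<bar>)" by (rule sum_abs)
      also have "\<dots> \<le> (\<Sum>k\<le>K. real K * (2 * D / sqrt (real n)) * \<bar>xi k\<bar>)"
      proof (rule sum_mono)
        fix k assume k: "k \<in> {..K}"
        have "\<bar>u (n - k) - u n\<bar> \<le> real k * (2 * D / sqrt (real n))" using k K by (intro u_close) auto
        also have "\<dots> \<le> real K * (2 * D / sqrt (real n))" using k D(1) by (intro mult_right_mono) auto
        finally show "\<bar>(u (n - k) - u n) * xi k\<bar> \<le> real K * (2 * D / sqrt (real n)) * \<bar>xi k\<bar>"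
          unfolding abs_mult by (intro mult_right_mono) auto
      qed
      also have "\<dots> = real K * (2 * D / sqrt (real n)) * (\<Sum>k\<le>K. \<bar>xi k\<bar>)" by (simp add: sum_distrib_left)
      also have "\<dots> \<le> real K * (2 * D / sqrt (real n)) * X"
        unfolding X_def using D(1) Z(2) by (intro mult_left_mono sum_le_suminf) auto
      finally show ?thesis .
    qed
    moreover have "\<bar>\<Sum>k = Suc K..n. u (n - k) * xi k\<bar> \<le> Z * real (Suc K) powr (- \<delta>)"
    proof -
      have "\<bar>\<Sum>k = Suc K..n. u (n - k) * xi k\<bar> \<le> (\<Sum>k = Suc K..n. \<bar>u (n - k) * xi k\<bar>)" by (rule sum_abs)
      also have "\<dots> \<le> (\<Sum>k = Suc K..n. \<bar>xi k\<bar>)"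
      proof (rule sum_mono)
        fix k
        show "\<bar>u (n - k) * xi k\<bar> \<le> \<bar>xi k\<bar>"
          using u_bounds[of "n - k"] mult_right_mono[of "u (n - k)" 1 "\<bar>xi k\<bar>"] by (simp add: abs_mult)
      qed
      also have "\<dots> = (\<Sum>k<n - K. \<bar>xi (k + Suc K)\<bar>)"
        using K by (intro sum.reindex_bij_witness[of _ "\<lambda>k. k + Suc K" "\<lambda>k. k - Suc K"]) auto
      also have "\<dots> \<le> (\<Sum>k. \<bar>xi (k + Suc K)\<bar>)"
        using Z(2) by (intro sum_le_suminf) (simp_all only: summable_iff_shift[of "\<lambda>k. \<bar>xi k\<bar>"], auto)
      also have "\<dots> \<le> Z * real (Suc K) powr (- \<delta>)" by (rule Z(3)) simp
      finally show ?thesis .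
    qed
    ultimately show ?thesis by linarith
  qed
  define b where "b n = 2 * Z * (real n powr (1 / 4)) powr (- \<delta>) + real n powr (1 / 4) * (2 * D / sqrt (real n)) * X" for n
  have "(\<lambda>n. v n / c - u n) \<in> O(b)"
  proof (rule landau_o.big_mono)
    have "\<forall>\<^sub>F n in sequentially. 2 * real n powr (1 / 4) \<le> real n" by real_asymp
    then show "\<forall>\<^sub>F n in sequentially. norm (v n / c - u n) \<le> norm (b n)"
      using eventually_gt_at_top[of 0]
    proof eventually_elim
      case (elim n)
      define K where "K = nat \<lfloor>real n powr (1 / 4)\<rfloor>"
      have K: "real K \<le> real n powr (1 / 4)" "real n powr (1 / 4) \<le> real (Suc K)"
        unfolding K_def by (auto simp: of_nat_nat) linarith+
      have "2 * K \<le> n" using K(1) elim by linarith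
      then have "\<bar>v n / c - u n\<bar> \<le> 2 * Z * real (Suc K) powr (- \<delta>) + real K * (2 * D / sqrt (real n)) * X"
        using elim by (intro split_bound) auto
      also have "\<dots> \<le> b n"
        unfolding b_def using K \<delta> Z(1) D(1) X0 elim
        by (intro add_mono mult_left_mono mult_right_mono powr_mono2') auto
      finally show ?case by simp
    qed
  qed
  also have "b \<in> O(\<lambda>n. 1 / ln (real n) ^ 3)"
  proof -
    have 1: "(\<lambda>n. (real n powr (1 / 4)) powr (- \<delta>)) \<in> O(\<lambda>n. 1 / ln (real n) ^ 3)"
      unfolding powr_powr using \<delta> by real_asymp
    have 2: "(\<lambda>n. real n powr (1 / 4) * (1 / sqrt (real n))) \<in> O(\<lambda>n. 1 / ln (real n) ^ 3)"
      by real_asymp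
    have "b = (\<lambda>n. (2 * Z) * (real n powr (1 / 4)) powr (- \<delta>) +
        (2 * D * X) * (real n powr (1 / 4) * (1 / sqrt (real n))))"
      by (simp add: b_def fun_eq_iff)
    then show ?thesis using sum_in_bigo(1)[OF bigo_cmult[OF 1] bigo_cmult[OF 2]] by simp
  qed
  finally show ?thesis .
qed

definition log_shift :: real where "log_shift = 1 / c + euler_mascheroni + suminf H"

text \<open>
  Replacing \<open>c u\<^sub>n\<close> by \<open>1 / A\<^sub>n\<close>, where \<open>A\<^sub>n = shift + h\<^sub>n = log n + log_shift + O(1/n)\<close>, costs
  \<open>O(log\<^sup>-\<^sup>3 n)\<close>; the rest is the geometric expansion of \<open>log n / A\<^sub>n\<close>.
\<close>

theorem u_asymptotics:
  "(\<lambda>n. c * ln (real n) * u n - 1 + log_shift / ln (real n)) \<in> O(\<lambda>n. 1 / (ln (real n))\<^sup>2)"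
proof -
  define A where "A n = shift + (harm n :: real)" for n
  define \<rho> where "\<rho> n = harm n - ln (real n) - (euler_mascheroni :: real)" for n
  have \<rho>: "\<rho> \<in> O(\<lambda>n. 1 / real n)"
    by (rule landau_o.big_mono, rule eventually_sequentiallyI[of 1])
       (use harm_minus_ln_bounds in \<open>auto simp: \<rho>_def\<close>)
  have A_eq: "A n = ln (real n) + log_shift + \<rho> n" for n
    by (simp add: A_def \<rho>_def log_shift_def shift_def)
  have A_ge: "\<forall>\<^sub>F n in sequentially. ln (real n) / 2 \<le> A n"
  proof -
    have "filterlim (\<lambda>n. ln (real n) / 2) at_top sequentially" by real_asymp
    then have "\<forall>\<^sub>F n in sequentially. - log_shift \<le> ln (real n) / 2"
      unfolding filterlim_at_top by blast
    then have "\<forall>\<^sub>F n in sequentially. ln (real n) / 2 \<le> ln (real n) + log_shift"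
      by eventually_elim simp
    then show ?thesis using eventually_gt_at_top[of 0]
    proof eventually_elim
      case (elim n)
      then show ?case using harm_minus_ln_bounds(1)[of n] by (simp add: A_eq \<rho>_def)
    qed
  qed
  have ln_pos: "\<forall>\<^sub>F n in sequentially. 0 < ln (real n)" by real_asymp
  have inv_A: "(\<lambda>n. 1 / A n) \<in> O(\<lambda>n. 1 / ln (real n))"
  proof (rule bigoI)
    show "\<forall>\<^sub>F n in sequentially. norm (1 / A n) \<le> 2 * norm (1 / ln (real n))"
      using A_ge ln_pos
    proof eventually_elim
      case (elim n)
      then have "1 / A n \<le> 1 / (ln (real n) / 2)" by (intro divide_left_mono) auto
      then show ?case using elim by simp
    qed
  qed
  have v1: "(\<lambda>n. v n - 1 / A n) \<in> O(\<lambda>n. 1 / ln (real n) ^ 3)"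
  proof -
    have "(\<lambda>n. v n - 1 / A n) \<in> O(\<lambda>n. (1 / A n) ^ 3)"
    proof (rule bigoI)
      show "\<forall>\<^sub>F n in sequentially. norm (v n - 1 / A n) \<le> 6 * norm ((1 / A n) ^ 3)"
        using A_ge ln_pos
      proof eventually_elim
        case (elim n)
        then show ?case using model_seq_asymp[of shift n] by (simp add: A_def power_divide)
      qed
    qed
    also have "(\<lambda>n. (1 / A n) ^ 3) \<in> O(\<lambda>n. (1 / ln (real n)) ^ 3)"
      by (rule landau_o.big_power[OF inv_A])
    finally show ?thesis by (simp add: power_divide)
  qed
  have cu: "(\<lambda>n. c * u n - 1 / A n) \<in> O(\<lambda>n. 1 / ln (real n) ^ 3)"
  proof -
    have "(\<lambda>n. (v n - 1 / A n) - c * (v n / c - u n)) \<in> O(\<lambda>n. 1 / ln (real n) ^ 3)"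
      using model_seq_approx by (intro sum_in_bigo v1) simp
    then show ?thesis using c_pos by (simp add: algebra_simps)
  qed
  have "(\<lambda>n. ln (real n) * (c * u n - 1 / A n)) \<in> O(\<lambda>n. ln (real n) * (1 / ln (real n) ^ 3))"
    by (intro landau_o.big.mult cu) simp
  also have "(\<lambda>n. ln (real n) * (1 / ln (real n) ^ 3)) \<in> O(\<lambda>n. 1 / (ln (real n))\<^sup>2)" by real_asymp
  finally have 1: "(\<lambda>n. ln (real n) * (c * u n - 1 / A n)) \<in> O(\<lambda>n. 1 / (ln (real n))\<^sup>2)" .
  have 2: "(\<lambda>n. (log_shift\<^sup>2 + log_shift * \<rho> n - ln (real n) * \<rho> n) * (1 / ln (real n) * (1 / A n)))
      \<in> O(\<lambda>n. 1 / (ln (real n))\<^sup>2)"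
  proof -
    have a: "\<rho> \<in> O(\<lambda>n. 1)" by (rule landau_o.big_trans[OF \<rho>]) real_asymp
    have "(\<lambda>n. ln (real n) * \<rho> n) \<in> O(\<lambda>n. ln (real n) * (1 / real n))"
      by (intro landau_o.big.mult \<rho>) simp
    then have b: "(\<lambda>n. ln (real n) * \<rho> n) \<in> O(\<lambda>n. 1)" by (rule landau_o.big_trans) real_asymp
    have "(\<lambda>n. log_shift\<^sup>2 + log_shift * \<rho> n - ln (real n) * \<rho> n) \<in> O(\<lambda>n. 1)"
      using b by (intro sum_in_bigo bigo_cmult a) auto
    then have "(\<lambda>n. (log_shift\<^sup>2 + log_shift * \<rho> n - ln (real n) * \<rho> n) * (1 / ln (real n) * (1 / A n)))
        \<in> O(\<lambda>n. 1 * (1 / ln (real n) * (1 / ln (real n))))"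
      by (intro landau_o.big.mult inv_A) simp_all
    then show ?thesis by (simp add: power2_eq_square)
  qed
  have "(\<lambda>n. ln (real n) * (c * u n - 1 / A n) +
      (log_shift\<^sup>2 + log_shift * \<rho> n - ln (real n) * \<rho> n) * (1 / ln (real n) * (1 / A n)))
      \<in> O(\<lambda>n. 1 / (ln (real n))\<^sup>2)"
    by (intro sum_in_bigo 1 2)
  moreover have "\<forall>\<^sub>F n in sequentially. ln (real n) * (c * u n - 1 / A n) +
      (log_shift\<^sup>2 + log_shift * \<rho> n - ln (real n) * \<rho> n) * (1 / ln (real n) * (1 / A n)) =
      c * ln (real n) * u n - 1 + log_shift / ln (real n)"
    using A_ge ln_pos
  proof eventually_elim
    case (elim n)
    define l a r where "l = ln (real n)" and "a = A n" and "r = \<rho> n"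
    have la: "l \<noteq> 0" "a \<noteq> 0" "r = a - l - log_shift"
      using elim A_eq[of n] by (auto simp: l_def a_def r_def)
    have "l * (c * x - 1 / a) + (log_shift\<^sup>2 + log_shift * r - l * r) * (1 / l * (1 / a)) =
        c * l * x - 1 + log_shift / l" for x
      unfolding la(3) using la(1,2) by (simp add: field_simps power2_eq_square)
    from this[of "u n"] show ?case by (simp add: l_def a_def r_def)
  qed
  ultimately show ?thesis by (simp only: landau_o.big.in_cong)
qed

end

section \<open>The integral of the tail correction\<close>

text \<open>
  On \<open>[i, i + 1)\<close> with \<open>i \<ge> 1\<close> the integral is \<open>1/i - log (1 + 1/i) + H(i)\<close>; the first two
  terms sum to Euler's constant.
\<close>

lemma integral_tail_correction:
  fixes H :: "nat \<Rightarrow> real"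
  assumes H: "summable (\<lambda>n. \<bar>H n\<bar>)"
  shows "(LINT x:{0..}|lborel. tail_correction c H x) = 1 / c + euler_mascheroni + (\<Sum>n. H (Suc n))"
proof -
  define g where "g = tail_correction c H"
  define F where "F i x = indicator {real i..<real (Suc i)} x * g x" for i x
  define k where "k i = (if i = 0 then 1 / c else 1 / real i + H i)" for i :: nat
  define b where "b i = (if i = 0 then 0 else (1::real))" for i :: nat
  define I where "I i = k i - (if i = 0 then 0 else ln (real (Suc i)) - ln (real i))" for i :: nat
  \<comment> \<open>A summable majorant: on each piece \<open>1/i - 1/x\<close> lies between \<open>0\<close> and the telescoping \<open>1/i - 1/(i + 1)\<close>.\<close>
  define W where "W i = (if i = 0 then \<bar>1 / c\<bar> else \<bar>H i\<bar> + (1 / real i - 1 / real (Suc i)))" for i :: nat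
  have F_eq: "F i x = indicator {real i..<real (Suc i)} x * (k i - b i / x)" for i x
  proof (cases "x \<in> {real i..<real (Suc i)}")
    case True
    then have "\<lfloor>x\<rfloor> = int i" by (intro floor_unique) auto
    then show ?thesis using True
      by (cases "i = 0") (auto simp: F_def g_def tail_correction_def k_def b_def)
  qed (simp add: F_def)
  have F_meas: "F i \<in> borel_measurable lborel" for i
    unfolding F_eq[abs_def] by measurable
  have F_bi: "has_bochner_integral lborel (F i) (I i)" for i
  proof -
    have "has_bochner_integral lborel (\<lambda>x. indicator {real i..real (Suc i)} x *\<^sub>R (k i - b i / x)) (I i)"
    proof (cases "i = 0")
      case True
      have "has_bochner_integral lborel (\<lambda>x. indicator {real i..real (Suc i)} x *\<^sub>R (k i - b i / x))
          (k i * real (Suc i) - k i * real i)"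
        using True by (intro has_bochner_integral_FTC_Icc) (auto simp: b_def has_real_derivative_iff_has_vector_derivative[symmetric] intro!: derivative_eq_intros continuous_intros)
      then show ?thesis using True by (simp add: I_def)
    next
      case False
      have "has_bochner_integral lborel (\<lambda>x. indicator {real i..real (Suc i)} x *\<^sub>R (k i - b i / x))
          ((k i * real (Suc i) - ln (real (Suc i))) - (k i * real i - ln (real i)))"
        using False by (intro has_bochner_integral_FTC_Icc) (auto simp: b_def has_real_derivative_iff_has_vector_derivative[symmetric] intro!: derivative_eq_intros continuous_intros)
      then show ?thesis using False by (simp add: I_def algebra_simps)
    qed
    moreover have "AE x in lborel. indicator {real i..real (Suc i)} x *\<^sub>R (k i - b i / x) = F i x"
      using AE_lborel_singleton[of "real (Suc i)"]
      by eventually_elim (auto simp: F_eq indicator_def)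
    ultimately show ?thesis
      using F_meas by (subst (asm) has_bochner_integral_cong_AE) (auto simp: has_bochner_integral_iff)
  qed
  have F_norm: "norm (F i x) \<le> indicator {real i..real (Suc i)} x * W i" for i x
  proof (cases "x \<in> {real i..<real (Suc i)}")
    case True
    show ?thesis
    proof (cases "i = 0")
      case False
      have "1 / real (Suc i) \<le> 1 / x" "1 / x \<le> 1 / real i"
        using True False by (auto intro!: divide_left_mono)
      then have "\<bar>(1 / real i + H i) - 1 / x\<bar> \<le> \<bar>H i\<bar> + (1 / real i - 1 / real (Suc i))" by linarith
      then show ?thesis using True False by (simp add: F_eq k_def b_def W_def)
    qed (use True in \<open>simp add: F_eq k_def b_def W_def\<close>)
  next
    case False
    have "1 / real (Suc i) \<le> 1 / real i" if "i \<noteq> 0" using that by (intro divide_left_mono) auto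
    then have "0 \<le> W i" by (auto simp: W_def)
    then show ?thesis using False by (simp add: F_eq)
  qed
  have inorm: "(\<integral>x. norm (F i x) \<partial>lborel) \<le> W i" for i
  proof -
    have "(\<integral>x. norm (F i x) \<partial>lborel) \<le> (\<integral>x. indicator {real i..real (Suc i)} x * W i \<partial>lborel)"
      using F_bi F_norm by (intro integral_mono) (auto simp: has_bochner_integral_iff)
    then show ?thesis by simp
  qed
  have sumW: "summable W"
  proof -
    have "(\<lambda>n. 1 / real (Suc n) - 1 / real (Suc (Suc n))) sums (1 / real (Suc 0) - 0)"
      by (rule telescope_sums') real_asymp
    then have "summable (\<lambda>n. \<bar>H (Suc n)\<bar> + (1 / real (Suc n) - 1 / real (Suc (Suc n))))"
      using H by (intro summable_add) (auto simp: sums_iff summable_Suc_iff[of "\<lambda>n. \<bar>H n\<bar>"])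
    then have "summable (\<lambda>n. W (Suc n))" by (simp add: W_def)
    then show ?thesis by (simp only: summable_Suc_iff)
  qed
  have summ_inorm: "summable (\<lambda>i. \<integral>x. norm (F i x) \<partial>lborel)"
    by (rule summable_comparison_test'[OF sumW]) (use inorm in auto)
  have pw: "F i x = 0" if "i \<noteq> nat \<lfloor>x\<rfloor>" for i x
  proof (rule ccontr)
    assume "F i x \<noteq> 0"
    then have "x \<in> {real i..<real (Suc i)}" by (auto simp: F_def indicator_def split: if_splits)
    then have "\<lfloor>x\<rfloor> = int i" by (intro floor_unique) auto
    then show False using that by simp
  qed
  have sum_F: "(\<Sum>i. F i x) = indicator {0..} x * g x" and summ_F: "summable (\<lambda>i. norm (F i x))" for x
  proof -
    have "(\<Sum>i. F i x) = (\<Sum>i\<in>{nat \<lfloor>x\<rfloor>}. F i x)"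
      by (rule suminf_finite) (use pw in auto)
    also have "\<dots> = indicator {0..} x * g x"
    proof (cases "0 \<le> x")
      case True
      then have "x \<in> {real (nat \<lfloor>x\<rfloor>)..<real (Suc (nat \<lfloor>x\<rfloor>))}" by (auto simp: of_nat_nat) linarith+
      then show ?thesis using True by (simp add: F_def)
    qed (auto simp: F_def indicator_def)
    finally show "(\<Sum>i. F i x) = indicator {0..} x * g x" .
    show "summable (\<lambda>i. norm (F i x))"
      by (rule summable_finite[of "{nat \<lfloor>x\<rfloor>}"]) (use pw in auto)
  qed
  have "(LINT x:{0..}|lborel. g x) = (\<integral>x. (\<Sum>i. F i x) \<partial>lborel)"
    by (simp add: set_lebesgue_integral_def sum_F)
  also have "\<dots> = (\<Sum>i. \<integral>x. F i x \<partial>lborel)"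
    using F_bi by (intro integral_suminf summ_inorm AE_I2 summ_F) (auto simp: has_bochner_integral_iff)
  also have "\<dots> = (\<Sum>i. I i)"
    using F_bi by (simp add: has_bochner_integral_iff)
  also have "\<dots> = 1 / c + euler_mascheroni + (\<Sum>n. H (Suc n))"
  proof -
    have "summable (\<lambda>n. H (Suc n))"
      using summable_rabs_cancel[OF H] by (simp add: summable_Suc_iff)
    then have "(\<lambda>n. (inverse (of_nat (n + 1)) + ln (of_nat (n + 1)) - ln (of_nat (n + 2))) + H (Suc n))
        sums (euler_mascheroni + (\<Sum>n. H (Suc n)))"
      by (intro sums_add euler_mascheroni_sum_real summable_sums)
    moreover have "(inverse (of_nat (n + 1)) + ln (of_nat (n + 1)) - ln (of_nat (n + 2))) + H (Suc n) = I (Suc n)" for n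
      by (simp add: I_def k_def inverse_eq_divide add.commute)
    ultimately have "(\<lambda>n. I (Suc n)) sums (euler_mascheroni + (\<Sum>n. H (Suc n)))" by simp
    then have "I sums (euler_mascheroni + (\<Sum>n. H (Suc n)) + I 0)" by (simp add: sums_Suc_iff)
    moreover have "I 0 = 1 / c" by (simp add: I_def k_def)
    ultimately show ?thesis by (simp add: sums_iff)
  qed
  finally show ?thesis by (simp add: g_def)
qed

section \<open>Complex-linear operators on a complexification\<close>

lemma blinfun_compose_assoc: "(A o\<^sub>L B) o\<^sub>L C = A o\<^sub>L (B o\<^sub>L C)"
  by (rule blinfun_eqI) simp

lemmas blinfun_compose_distrib =
  bounded_bilinear.add_left[OF bounded_bilinear_blinfun_compose]
  bounded_bilinear.add_right[OF bounded_bilinear_blinfun_compose]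
  bounded_bilinear.diff_left[OF bounded_bilinear_blinfun_compose]
  bounded_bilinear.diff_right[OF bounded_bilinear_blinfun_compose]
  bounded_bilinear.minus_left[OF bounded_bilinear_blinfun_compose]
  bounded_bilinear.minus_right[OF bounded_bilinear_blinfun_compose]
  bounded_bilinear.scaleR_left[OF bounded_bilinear_blinfun_compose]
  bounded_bilinear.scaleR_right[OF bounded_bilinear_blinfun_compose]

lemma cscale_add: "cscale (z + w) = cscale z + cscale w"
  by (rule blinfun_eqI) (auto simp: cscale_apply blinfun.add_left algebra_simps)

lemma cscale_scaleR: "cscale (r *\<^sub>R z) = r *\<^sub>R cscale z"
  by (rule blinfun_eqI) (auto simp: cscale_apply blinfun.scaleR_left algebra_simps)

lemma cscale_mult: "cscale (z * w) = cscale z o\<^sub>L cscale w"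
  by (rule blinfun_eqI) (auto simp: cscale_apply algebra_simps)

lemma cscale_1: "cscale 1 = id_blinfun"
  by (rule blinfun_eqI) (auto simp: cscale_apply)

lemma norm_cscale_le: "norm (cscale z :: ('b \<times> 'b) \<Rightarrow>\<^sub>L ('b::banach \<times> 'b)) \<le> cmod z * 4"
proof (rule norm_blinfun_bound)
  fix p :: "'b \<times> 'b"
  obtain x y where p: "p = (x, y)" by (cases p)
  have xy: "norm x \<le> norm p" "norm y \<le> norm p" using norm_fst_le norm_snd_le by (auto simp: p)
  have le: "norm (a *\<^sub>R x) \<le> cmod z * norm p" "norm (a *\<^sub>R y) \<le> cmod z * norm p"
    if "\<bar>a\<bar> \<le> cmod z" for a
    using that xy by (auto intro!: mult_mono)
  note R = le[OF abs_Re_le_cmod] and I = le[OF abs_Im_le_cmod]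
  have "norm (blinfun_apply (cscale z) p) \<le>
      norm (Re z *\<^sub>R x - Im z *\<^sub>R y) + norm (Im z *\<^sub>R x + Re z *\<^sub>R y)"
    by (simp add: p cscale_apply norm_Pair_le)
  also have "\<dots> \<le> (cmod z * norm p + cmod z * norm p) + (cmod z * norm p + cmod z * norm p)"
    using R I by (intro add_mono order.trans[OF norm_triangle_ineq4] order.trans[OF norm_triangle_ineq]) auto
  finally show "norm (blinfun_apply (cscale z) p) \<le> cmod z * 4 * norm p" by simp
qed simp

text \<open>
  The bounded complex-linear operators on the complexification, realised as the real-linear
  ones that commute with the complex scalars. The restriction is needed for the scalars to be
  central.
\<close>

typedef (overloaded) 'b cop = "{A :: ('b::banach \<times> 'b) \<Rightarrow>\<^sub>L ('b \<times> 'b). \<forall>z. A o\<^sub>L cscale z = cscale z o\<^sub>L A}"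
  by (rule exI[of _ 0]) simp

setup_lifting type_definition_cop

instantiation cop :: (banach) real_algebra
begin

lift_definition zero_cop :: "'a cop" is 0 by simp
lift_definition plus_cop :: "'a cop \<Rightarrow> 'a cop \<Rightarrow> 'a cop" is "(+)"
  by (simp add: blinfun_compose_distrib)
lift_definition minus_cop :: "'a cop \<Rightarrow> 'a cop \<Rightarrow> 'a cop" is "(-)"
  by (simp add: blinfun_compose_distrib)
lift_definition uminus_cop :: "'a cop \<Rightarrow> 'a cop" is uminus
  by (simp add: blinfun_compose_distrib)
lift_definition scaleR_cop :: "real \<Rightarrow> 'a cop \<Rightarrow> 'a cop" is scaleR
  by (simp add: blinfun_compose_distrib)
lift_definition times_cop :: "'a cop \<Rightarrow> 'a cop \<Rightarrow> 'a cop" is "(o\<^sub>L)"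
  by (metis blinfun_compose_assoc)

instance
  by standard (transfer, simp add: blinfun_compose_distrib blinfun_compose_assoc algebra_simps)+

end

instantiation cop :: (banach) real_normed_algebra
begin

lift_definition norm_cop :: "'a cop \<Rightarrow> real" is norm .
definition dist_cop :: "'a cop \<Rightarrow> 'a cop \<Rightarrow> real" where "dist_cop A B = norm (A - B)"
definition sgn_cop :: "'a cop \<Rightarrow> 'a cop" where "sgn_cop A = A /\<^sub>R norm A"
definition uniformity_cop :: "('a cop \<times> 'a cop) filter" where
  "uniformity_cop = (INF e\<in>{0<..}. principal {(x, y). dist x y < e})"
definition open_cop :: "'a cop set \<Rightarrow> bool" where
  "open_cop U = (\<forall>x\<in>U. \<forall>\<^sub>F (x', y) in uniformity. x' = x \<longrightarrow> y \<in> U)"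

instance
proof
  fix A B :: "'a cop" and r :: real
  show "dist A B = norm (A - B)" by (rule dist_cop_def)
  show "sgn A = A /\<^sub>R norm A" by (rule sgn_cop_def)
  show "uniformity = (INF e\<in>{0<..}. principal {(x, y). dist (x::'a cop) y < e})" by (rule uniformity_cop_def)
  show "open U = (\<forall>x\<in>U. \<forall>\<^sub>F (x', y) in uniformity. x' = x \<longrightarrow> y \<in> U)" for U :: "'a cop set"
    by (rule open_cop_def)
  show "norm A = 0 \<longleftrightarrow> A = 0" by transfer simp
  show "norm (A + B) \<le> norm A + norm B" by transfer (rule norm_triangle_ineq)
  show "norm (r *\<^sub>R A) = \<bar>r\<bar> * norm A" by transfer simp
  show "norm (A * B) \<le> norm A * norm B" by transfer (rule norm_blinfun_compose)
qed

end

lemma Rep_cop_commutes: "Rep_cop A o\<^sub>L cscale z = cscale z o\<^sub>L Rep_cop A"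
  using Rep_cop[of A] by simp

lemma bounded_linear_Rep_cop: "bounded_linear Rep_cop"
  by (rule bounded_linear_intro[where K = 1])
     (simp_all add: plus_cop.rep_eq scaleR_cop.rep_eq norm_cop.rep_eq)

lemma dist_Rep_cop: "dist (Rep_cop A) (Rep_cop B) = dist A B"
  by (simp add: dist_norm norm_cop.rep_eq minus_cop.rep_eq)

instance cop :: (banach) banach
proof
  fix X :: "nat \<Rightarrow> 'a cop"
  assume "Cauchy X"
  then have "Cauchy (\<lambda>n. Rep_cop (X n))" by (simp add: Cauchy_def dist_Rep_cop)
  then obtain A where A: "(\<lambda>n. Rep_cop (X n)) \<longlonglongrightarrow> A"
    using Cauchy_convergent convergent_def by blast
  have "A o\<^sub>L cscale z = cscale z o\<^sub>L A" for z
  proof (rule LIMSEQ_unique)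
    show "(\<lambda>n. Rep_cop (X n) o\<^sub>L cscale z) \<longlonglongrightarrow> (A o\<^sub>L cscale z)"
      by (intro bounded_bilinear.tendsto[OF bounded_bilinear_blinfun_compose] A tendsto_const)
    show "(\<lambda>n. Rep_cop (X n) o\<^sub>L cscale z) \<longlonglongrightarrow> (cscale z o\<^sub>L A)"
      unfolding Rep_cop_commutes
      by (intro bounded_bilinear.tendsto[OF bounded_bilinear_blinfun_compose] A tendsto_const)
  qed
  then have "Rep_cop (Abs_cop A) = A" by (simp add: Abs_cop_inverse)
  then have "dist (X n) (Abs_cop A) = dist (Rep_cop (X n)) A" for n
    using dist_Rep_cop[of "X n" "Abs_cop A"] by simp
  with A have "X \<longlonglongrightarrow> Abs_cop A"
    unfolding tendsto_iff by simp
  then show "convergent X" by (rule convergentI)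
qed

instantiation cop :: (banach) monoid_mult
begin
lift_definition one_cop :: "'a cop" is id_blinfun
  by (auto intro: blinfun_eqI)
instance
  by standard (transfer, auto intro: blinfun_eqI)+
end

lift_definition cop_scalar :: "complex \<Rightarrow> 'b::banach cop" is cscale
  by (metis cscale_mult mult.commute)

lift_definition cop_of :: "('b::banach \<Rightarrow>\<^sub>L 'b) \<Rightarrow> 'b cop" is complexify
  by (auto intro!: blinfun_eqI simp: complexify_apply cscale_apply blinfun.bilinear_simps)

lemma scalar_algebra_cop: "scalar_algebra (cop_scalar :: complex \<Rightarrow> 'b::banach cop)"
proof (rule scalar_algebra.intro)
  show "cop_scalar (z * w) = (cop_scalar z * cop_scalar w :: 'b cop)" for z w
    by transfer (rule cscale_mult)
  show "cop_scalar 1 = (1 :: 'b cop)" by transfer (rule cscale_1)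
  show "x * cop_scalar z = cop_scalar z * x" for x :: "'b cop" and z by transfer simp
  show "bounded_linear (cop_scalar :: complex \<Rightarrow> 'b cop)"
  proof (rule bounded_linear_intro)
    show "cop_scalar (z + w) = (cop_scalar z + cop_scalar w :: 'b cop)" for z w
      by transfer (rule cscale_add)
    show "cop_scalar (r *\<^sub>R z) = r *\<^sub>R (cop_scalar z :: 'b cop)" for r z
      by transfer (rule cscale_scaleR)
    show "norm (cop_scalar z :: 'b cop) \<le> cmod z * 4" for z
      by transfer (rule norm_cscale_le)
  qed
qed

lemma cop_of_add: "cop_of (A + B) = cop_of A + cop_of B"
  by transfer (auto intro!: blinfun_eqI simp: complexify_apply blinfun.bilinear_simps)

lemma cop_of_diff: "cop_of (A - B) = cop_of A - cop_of B"
  by transfer (auto intro!: blinfun_eqI simp: complexify_apply blinfun.bilinear_simps)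

lemma cop_of_scaleR: "cop_of (r *\<^sub>R A) = r *\<^sub>R cop_of A"
  by transfer (auto intro!: blinfun_eqI simp: complexify_apply blinfun.bilinear_simps)

lemma cop_of_0: "cop_of 0 = 0"
  by transfer (auto intro!: blinfun_eqI simp: complexify_apply blinfun.bilinear_simps zero_prod_def)

lemma cop_of_id: "cop_of id_blinfun = 1"
  by transfer (auto intro!: blinfun_eqI simp: complexify_apply)

lemma cop_of_compose: "cop_of (A o\<^sub>L B) = cop_of A * cop_of B"
  by transfer (auto intro!: blinfun_eqI simp: complexify_apply)

lemma cop_of_sum: "cop_of (sum A S) = (\<Sum>i\<in>S. cop_of (A i))"
  by (induction S rule: infinite_finite_induct) (auto simp: cop_of_0 cop_of_add)

lemma norm_cop_of_le:
  fixes A :: "'a::banach \<Rightarrow>\<^sub>L 'a"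
  shows "norm (cop_of A) \<le> 2 * norm A"
proof -
  have "norm (complexify A) \<le> 2 * norm A"
  proof (rule norm_blinfun_bound)
    fix p :: "'a \<times> 'a"
    obtain x y where p: "p = (x, y)" by (cases p)
    have "norm (blinfun_apply (complexify A) p) \<le> norm (blinfun_apply A x) + norm (blinfun_apply A y)"
      by (simp add: p complexify_apply norm_Pair_le)
    also have "\<dots> \<le> norm A * norm p + norm A * norm p"
      using norm_fst_le[of x y] norm_snd_le[of y x]
      by (intro add_mono order.trans[OF norm_blinfun] mult_left_mono) (auto simp: p)
    finally show "norm (blinfun_apply (complexify A) p) \<le> 2 * norm A * norm p" by (simp add: mult.commute)
  qed simp
  then show ?thesis by (simp add: norm_cop.rep_eq cop_of.rep_eq)
qed

lemma norm_le_norm_cop_of: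
  fixes A :: "'a::banach \<Rightarrow>\<^sub>L 'a"
  shows "norm A \<le> norm (cop_of A)"
proof -
  have "norm A \<le> norm (complexify A)"
  proof (rule norm_blinfun_bound)
    fix x
    have "norm (blinfun_apply A x) = norm (blinfun_apply (complexify A) (x, 0))"
      by (simp add: complexify_apply norm_Pair blinfun.zero_right)
    also have "\<dots> \<le> norm (complexify A) * norm (x, 0 :: 'a)" by (rule norm_blinfun)
    finally show "norm (blinfun_apply A x) \<le> norm (complexify A) * norm x" by (simp add: norm_Pair)
  qed simp
  then show ?thesis by (simp add: norm_cop.rep_eq cop_of.rep_eq)
qed

lemma is_inverse_unique: "is_inverse A S \<Longrightarrow> is_inverse A S' \<Longrightarrow> S = S'"
  unfolding is_inverse_def
  by (metis blinfun_compose_assoc blinfun_eqI blinfun_apply_blinfun_compose blinfun_apply_id_blinfun)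

text \<open>
  The inverse of a complex-linear operator is complex-linear, so invertibility within the
  subalgebra agrees with invertibility among all bounded operators, which is what the spectrum
  refers to.
\<close>

lemma is_inverse_cop:
  assumes "is_inverse (Rep_cop A) S"
  obtains G where "Rep_cop G = S" "G * A = 1" "A * G = 1"
proof -
  have S: "Rep_cop A o\<^sub>L S = id_blinfun" "S o\<^sub>L Rep_cop A = id_blinfun"
    using assms by (auto simp: is_inverse_def)
  have "S o\<^sub>L cscale z = cscale z o\<^sub>L S" for z
  proof -
    have "S o\<^sub>L cscale z = S o\<^sub>L (cscale z o\<^sub>L (Rep_cop A o\<^sub>L S))"
      by (auto simp: S intro: blinfun_eqI)
    also have "\<dots> = (S o\<^sub>L Rep_cop A) o\<^sub>L (cscale z o\<^sub>L S)"
      by (simp only: blinfun_compose_assoc[symmetric] Rep_cop_commutes) (simp only: blinfun_compose_assoc Rep_cop_commutes)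
    finally show ?thesis by (auto simp: S intro: blinfun_eqI)
  qed
  then have r: "Rep_cop (Abs_cop S) = S" by (simp add: Abs_cop_inverse)
  show ?thesis
    by (rule that[OF r]) (simp_all add: S r times_cop.rep_eq one_cop.rep_eq flip: Rep_cop_inject)
qed

context scalar_algebra
begin

text \<open>
  \<open>S\<close> is \<open>(2 \<pi> i)\<^sup>-\<^sup>1 \<integral> (\<zeta> - A)\<^sup>-\<^sup>1 / (\<zeta> - 1) d\<zeta>\<close> over the circle: on \<open>\<zeta> = 1 + r e\<^sup>i\<^sup>t\<close> one has
  \<open>(\<zeta> - A)\<^sup>-\<^sup>1 (1 - A) = 1 - (\<zeta> - 1) (\<zeta> - A)\<^sup>-\<^sup>1\<close>, and integration gives \<open>1 - P\<close>.
\<close>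

lemma reduced_resolvent:
  assumes res: "\<And>t. Res t * (\<sigma> (1 + of_real r * cis t) - A) = 1"
      "\<And>t. (\<sigma> (1 + of_real r * cis t) - A) * Res t = 1"
    and P: "((\<lambda>t. (1 / (2 * pi)) *\<^sub>R (\<sigma> (of_real r * cis t) * Res t)) has_integral P) {0..2 * pi}"
  obtains S where "S * (1 - A) = 1 - P" "P * A = A * P"
proof -
  interpret scal: bounded_linear \<sigma> by (rule scal_linear)
  have cont: "continuous_on {0..2 * pi} Res"
  proof (rule continuous_on_two_sided_inverse)
    show "continuous_on {0..2 * pi} (\<lambda>t. \<sigma> (1 + of_real r * cis t) - A)"
      by (intro continuous_intros)
  qed (rule res)+
  define S where "S = integral {0..2 * pi} (\<lambda>t. (1 / (2 * pi)) *\<^sub>R Res t)"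
  have "((\<lambda>t. (1 / (2 * pi)) *\<^sub>R Res t) has_integral S) {0..2 * pi}"
    unfolding S_def by (intro integrable_integral integrable_continuous_real continuous_intros cont)
  from has_integral_linear[OF this bounded_linear_mult_left[of "1 - A"]]
  have 1: "((\<lambda>t. (1 / (2 * pi)) *\<^sub>R (Res t * (1 - A))) has_integral S * (1 - A)) {0..2 * pi}"
    by (simp add: o_def)
  have eq: "(1 / (2 * pi)) *\<^sub>R (Res t * (1 - A)) =
      (1 / (2 * pi)) *\<^sub>R 1 - (1 / (2 * pi)) *\<^sub>R (\<sigma> (of_real r * cis t) * Res t)" for t
  proof -
    have "Res t * (1 - A) = Res t * (\<sigma> (1 + of_real r * cis t) - A) - Res t * \<sigma> (of_real r * cis t)"
      by (simp add: scal.add scal_1 algebra_simps)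
    also have "\<dots> = 1 - \<sigma> (of_real r * cis t) * Res t"
      by (simp only: res scal_commute)
    finally show ?thesis by (simp add: scaleR_diff_right)
  qed
  have "((\<lambda>t. (1 / (2 * pi)) *\<^sub>R (1 :: 'x)) has_integral (2 * pi - 0) *\<^sub>R ((1 / (2 * pi)) *\<^sub>R 1)) {0..2 * pi}"
    using has_integral_const_real[of "(1 / (2 * pi)) *\<^sub>R (1 :: 'x)" 0 "2 * pi"] by simp
  then have "((\<lambda>t. (1 / (2 * pi)) *\<^sub>R (1 :: 'x)) has_integral 1) {0..2 * pi}" by simp
  from has_integral_diff[OF this P] 1 have "S * (1 - A) = 1 - P"
    unfolding eq by (rule has_integral_unique[rotated])
  moreover have "P * A = A * P"
  proof -
    have comm: "Res t * A = A * Res t" for t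
    proof -
      have "Res t * A = Res t * \<sigma> (1 + of_real r * cis t) - 1"
        using res(1)[of t] by (simp add: algebra_simps)
      also have "\<dots> = A * Res t"
        using res(2)[of t] by (simp add: algebra_simps scal_commute[symmetric])
      finally show ?thesis .
    qed
    have "(\<sigma> w * Res t) * A = A * (\<sigma> w * Res t)" for t w
      by (simp only: mult.assoc comm scal_left_commute)
    then have "(\<lambda>t. (1 / (2 * pi)) *\<^sub>R (\<sigma> (of_real r * cis t) * Res t) * A) =
        (\<lambda>t. A * (1 / (2 * pi)) *\<^sub>R (\<sigma> (of_real r * cis t) * Res t))"
      by simp
    moreover note has_integral_linear[OF P bounded_linear_mult_left[of A], unfolded o_def]
      has_integral_linear[OF P bounded_linear_mult_right[of A], unfolded o_def]
    ultimately show ?thesis by (simp add: has_integral_unique)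
  qed
  ultimately show ?thesis by (rule that)
qed

end

section \<open>First returns\<close>

text \<open>
  Test against the sign of the difference.
\<close>

lemma AE_eq_of_integral_eq:
  fixes a b :: "'a \<Rightarrow> real"
  assumes ab: "integrable N a" "integrable N b"
    and eq: "\<And>w. w \<in> borel_measurable N \<Longrightarrow> bounded (w ` space N) \<Longrightarrow>
      (\<integral>y. a y * w y \<partial>N) = (\<integral>y. b y * w y \<partial>N)"
  shows "AE y in N. a y = b y"
proof -
  have [measurable]: "a \<in> borel_measurable N" "b \<in> borel_measurable N" using ab by auto
  define w where "w y = sgn (a y - b y)" for y
  have w: "w \<in> borel_measurable N" unfolding w_def by measurable
  have w1: "\<bar>w y\<bar> \<le> 1" for y by (simp add: w_def abs_sgn_eq)
  then have bw: "bounded (w ` space N)" by (auto simp: bounded_iff)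
  have i: "integrable N (\<lambda>y. a y * w y)" "integrable N (\<lambda>y. b y * w y)"
    by (rule Bochner_Integration.integrable_bound[OF ab(1)], use w w1 in \<open>auto simp: abs_mult mult_left_le\<close>)
       (rule Bochner_Integration.integrable_bound[OF ab(2)], use w w1 in \<open>auto simp: abs_mult mult_left_le\<close>)
  have "(\<integral>y. \<bar>a y - b y\<bar> \<partial>N) = (\<integral>y. a y * w y - b y * w y \<partial>N)"
    by (intro Bochner_Integration.integral_cong) (auto simp: w_def sgn_if abs_if algebra_simps)
  also have "\<dots> = 0" using eq[OF w bw] i by simp
  finally have "(\<integral>y. \<bar>a y - b y\<bar> \<partial>N) = 0" .
  then have "AE y in N. \<bar>a y - b y\<bar> = 0"
    using integral_nonneg_eq_0_iff_AE[of N "\<lambda>y. \<bar>a y - b y\<bar>"] ab by auto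
  then show ?thesis by eventually_elim simp
qed

lemma transfer_operator_funpow:
  assumes L: "transfer_operator M f L" and f: "f \<in> measurable M M"
    and v: "integrable M v"
  shows "integrable M ((L ^^ n) v)"
    "w \<in> borel_measurable M \<Longrightarrow> bounded (w ` space M) \<Longrightarrow>
      (\<integral>x. (L ^^ n) v x * w x \<partial>M) = (\<integral>x. v x * w ((f ^^ n) x) \<partial>M)"
proof (induction n arbitrary: w)
  case (Suc n)
  { case 1
    then show ?case using Suc(1) L by (simp add: transfer_operator_def) }
  { case 2
    have wf: "(\<lambda>x. w (f x)) \<in> borel_measurable M" using 2(1) f by measurable
    have "(\<lambda>x. w (f x)) ` space M \<subseteq> w ` space M" using measurable_space[OF f] by auto
    then have bwf: "bounded ((\<lambda>x. w (f x)) ` space M)" using 2(2) bounded_subset by blast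
    have "(\<integral>x. (L ^^ Suc n) v x * w x \<partial>M) = (\<integral>x. (L ^^ n) v x * w (f x) \<partial>M)"
      using L Suc(1) 2 by (simp add: transfer_operator_def)
    also have "\<dots> = (\<integral>x. v x * w (f ((f ^^ n) x)) \<partial>M)"
      by (rule Suc(2)[OF wf bwf])
    finally show ?case by simp }
qed (use v in simp_all)

locale first_return =
  fixes M :: "'a measure" and f :: "'a \<Rightarrow> 'a" and Y :: "'a set"
  assumes preserving: "measure_preserving_map M f" and conserv: "conservative M f"
    and Y_sets: "Y \<in> sets M" and Y_measure: "emeasure M Y = 1"
begin

abbreviation N :: "'a measure" where "N \<equiv> restrict_space M Y"
abbreviation \<phi> :: "'a \<Rightarrow> nat" where "\<phi> \<equiv> first_return_time f Y"

lemma f_measurable [measurable]: "f \<in> measurable M M"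
  using preserving by (simp add: measure_preserving_map_def)

lemma funpow_measurable [measurable]: "f ^^ n \<in> measurable M M"
  by (induction n) (auto intro: measurable_comp)

lemma Y_space: "Y \<subseteq> space M"
  using Y_sets sets.sets_into_space by blast

lemma space_N: "space N = Y"
  using Y_space by (auto simp: space_restrict_space)

lemma Y_inter: "Y \<inter> space M \<in> sets M"
  using Y_sets by simp

lemma sets_N_iff: "A \<in> sets N \<longleftrightarrow> A \<in> sets M \<and> A \<subseteq> Y"
  using sets_restrict_space_iff[OF Y_inter] by auto

sublocale prob: prob_space N
  by (rule prob_spaceI) (simp add: space_N emeasure_restrict_space[OF Y_inter] Y_measure)

lemma measure_N: "A \<subseteq> Y \<Longrightarrow> measure N A = measure M A"
  by (rule measure_restrict_space[OF Y_inter])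

text \<open>
  At a point that never returns the first return time is the infimum of the empty set, a
  number without meaning for the orbit; \<open>returns\<close> separates these points.
\<close>

definition returns :: "'a \<Rightarrow> bool" where
  "returns y \<longleftrightarrow> (\<exists>n\<ge>1. (f ^^ n) y \<in> Y)"

lemma return_time_mem:
  assumes "returns y"
  shows "1 \<le> \<phi> y" "(f ^^ \<phi> y) y \<in> Y"
proof -
  let ?S = "{n. n \<ge> 1 \<and> (f ^^ n) y \<in> Y}"
  have "?S \<noteq> {}" using assms by (auto simp: returns_def)
  then have "\<phi> y \<in> ?S" unfolding first_return_time_def by (rule Inf_nat_def1)
  then show "1 \<le> \<phi> y" "(f ^^ \<phi> y) y \<in> Y" by simp_all
qed

lemma return_time_le:
  assumes "1 \<le> n" "(f ^^ n) y \<in> Y"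
  shows "1 \<le> \<phi> y" "\<phi> y \<le> n"
proof -
  let ?S = "{n. n \<ge> 1 \<and> (f ^^ n) y \<in> Y}"
  have n: "n \<in> ?S" using assms by simp
  then have "\<phi> y \<in> ?S" unfolding first_return_time_def by (intro Inf_nat_def1) auto
  then show "1 \<le> \<phi> y" by simp
  show "\<phi> y \<le> n" unfolding first_return_time_def using n by (rule cInf_lower) simp
qed

lemma preimage_Y_sets: "{y \<in> Y. (f ^^ n) y \<in> Y} \<in> sets M"
proof -
  have "(f ^^ n) -` Y \<inter> space M \<in> sets M" using Y_sets by (intro measurable_sets[OF funpow_measurable])
  then have "((f ^^ n) -` Y \<inter> space M) \<inter> Y \<in> sets M" using Y_sets by blast
  moreover have "((f ^^ n) -` Y \<inter> space M) \<inter> Y = {y \<in> Y. (f ^^ n) y \<in> Y}" using Y_space by auto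
  ultimately show ?thesis by simp
qed

lemma return_time_le_sets: "{y \<in> Y. returns y \<and> \<phi> y \<le> n} \<in> sets M"
proof -
  have "{y \<in> Y. returns y \<and> \<phi> y \<le> n} = (\<Union>k\<in>{1..n}. {y \<in> Y. (f ^^ k) y \<in> Y})"
  proof (intro equalityI subsetI)
    fix y assume "y \<in> {y \<in> Y. returns y \<and> \<phi> y \<le> n}"
    then show "y \<in> (\<Union>k\<in>{1..n}. {y \<in> Y. (f ^^ k) y \<in> Y})"
      using return_time_mem[of y] by auto
  next
    fix y assume "y \<in> (\<Union>k\<in>{1..n}. {y \<in> Y. (f ^^ k) y \<in> Y})"
    then obtain k where k: "1 \<le> k" "k \<le> n" "y \<in> Y" "(f ^^ k) y \<in> Y" by auto
    moreover have "returns y" unfolding returns_def using k(1,4) by blast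
    ultimately show "y \<in> {y \<in> Y. returns y \<and> \<phi> y \<le> n}"
      using return_time_le[OF k(1,4)] by auto
  qed
  then show ?thesis using preimage_Y_sets by auto
qed

lemma never_return_sets: "{y \<in> Y. \<not> returns y} \<in> sets M"
proof -
  have "{y \<in> Y. \<not> returns y} = Y - (\<Union>n. {y \<in> Y. returns y \<and> \<phi> y \<le> n})" by auto
  then show ?thesis using return_time_le_sets Y_sets by auto
qed

lemma return_time_eq_sets: "{y \<in> Y. \<phi> y = n} \<in> sets M"
proof -
  let ?A = "\<lambda>n. {y \<in> Y. returns y \<and> \<phi> y \<le> n}"
  \<comment> \<open>All points that never return share the value \<open>Inf {}\<close>, so they fall into one of the level sets.\<close>
  have \<phi>_never: "\<phi> y = Inf {}" if "\<not> returns y" for y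
    using that unfolding first_return_time_def returns_def by (intro arg_cong[where f = Inf]) auto
  have "{y \<in> Y. \<phi> y = n} = (?A n - (\<Union>m\<in>{..<n}. ?A m)) \<union> (if Inf {} = n then {y \<in> Y. \<not> returns y} else {})"
  proof (rule set_eqI)
    fix y
    have "(\<phi> y \<le> n \<and> (\<forall>m<n. \<not> \<phi> y \<le> m)) \<longleftrightarrow> \<phi> y = n"
      by (metis le_neq_implies_less not_less order_refl)
    then show "y \<in> {y \<in> Y. \<phi> y = n} \<longleftrightarrow>
        y \<in> (?A n - (\<Union>m\<in>{..<n}. ?A m)) \<union> (if Inf {} = n then {y \<in> Y. \<not> returns y} else {})"
      using \<phi>_never[of y] by (cases "returns y") auto
  qed
  then show ?thesis using return_time_le_sets never_return_sets by auto
qed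

lemma return_time_gt_sets: "{y \<in> Y. n < \<phi> y} \<in> sets M"
proof -
  have "{y \<in> Y. n < \<phi> y} = Y - (\<Union>k\<in>{..n}. {y \<in> Y. \<phi> y = k})" by auto
  then show ?thesis using return_time_eq_sets Y_sets by auto
qed

text \<open>
  The points of \<open>Y\<close> that never return form a wandering set: an orbit that visits this set
  cannot come back to \<open>Y\<close>, in particular not to the set itself.
\<close>

lemma never_return_null: "{y \<in> Y. \<not> returns y} \<in> null_sets M"
proof -
  let ?W = "{y \<in> Y. \<not> returns y}"
  have no_return: "(f ^^ k) y \<notin> Y" if "y \<in> ?W" "1 \<le> k" for y k
    using that by (auto simp: returns_def)
  have "disjoint_family (\<lambda>n. (f ^^ n) -` ?W \<inter> space M)"
    unfolding disjoint_family_on_def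
  proof (intro ballI impI)
    fix m n :: nat assume "m \<noteq> n"
    have "False" if mn: "m < n" and x: "(f ^^ m) x \<in> ?W" "(f ^^ n) x \<in> ?W" for m n x
    proof -
      have "(f ^^ n) x = (f ^^ (n - m)) ((f ^^ m) x)"
        using mn by (metis comp_apply funpow_add le_add_diff_inverse2 less_imp_le)
      then show False using no_return[OF x(1), of "n - m"] x(2) mn by auto
    qed
    then show "((f ^^ m) -` ?W \<inter> space M) \<inter> ((f ^^ n) -` ?W \<inter> space M) = {}"
      using \<open>m \<noteq> n\<close> by (fastforce simp: nat_neq_iff)
  qed
  then show ?thesis
    using conserv never_return_sets by (simp add: conservative_def)
qed

lemma AE_return: "AE y in N. returns y"
proof -
  have "AE y in M. y \<notin> {y \<in> Y. \<not> returns y}" using never_return_null by (rule AE_not_in)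
  then show ?thesis by (subst AE_restrict_space_iff[OF Y_inter]) (auto elim: AE_mp)
qed

text \<open>
  The value at \<open>0\<close> is set to \<open>0\<close>; the first return time can vanish only on the null set of
  points that never return.
\<close>

definition rt_prob :: "nat \<Rightarrow> real" where
  "rt_prob n = (if n = 0 then 0 else measure M {y \<in> Y. \<phi> y = n})"

lemma rt_prob_tail: "1 - (\<Sum>k\<le>n. rt_prob k) = measure M {y \<in> Y. n < \<phi> y}"
proof -
  have s: "{y \<in> Y. \<phi> y = k} \<in> sets N" for k using return_time_eq_sets by (auto simp: sets_N_iff)
  have g: "{y \<in> Y. n < \<phi> y} \<in> sets N" using return_time_gt_sets by (auto simp: sets_N_iff)
  have z: "measure N {y \<in> Y. \<phi> y = 0} = 0"
  proof -
    have "{y \<in> Y. \<phi> y = 0} \<in> null_sets M"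
      using return_time_mem(1) by (intro null_sets_subset[OF never_return_null return_time_eq_sets]) fastforce
    then show ?thesis by (subst measure_N) (auto simp: measure_def null_setsD1)
  qed
  have "(\<Union>k\<in>{..n}. {y \<in> Y. \<phi> y = k}) = space N - {y \<in> Y. n < \<phi> y}"
    by (auto simp: space_N)
  then have "measure N (space N - {y \<in> Y. n < \<phi> y}) = (\<Sum>k\<le>n. measure N {y \<in> Y. \<phi> y = k})"
    using s by (subst prob.finite_measure_finite_Union[symmetric]) (auto simp: disjoint_family_on_def)
  also have "\<dots> = (\<Sum>k\<le>n. rt_prob k)"
    using z by (intro sum.cong) (auto simp: rt_prob_def measure_N)
  finally show ?thesis using prob.prob_compl[OF g] by (simp add: measure_N)
qed

lemma first_return_map_eq: "\<phi> y = n \<Longrightarrow> first_return_map f Y y = (f ^^ n) y"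
  by (simp add: first_return_map_def)

lemma measurable_on_M:
  assumes "w \<in> borel_measurable N"
  shows "(\<lambda>x. indicator Y x * w x :: real) \<in> borel_measurable M"
  using assms borel_measurable_restrict_space_iff[OF Y_inter, of w] by simp

lemma measurable_on_N: "w \<in> borel_measurable M \<Longrightarrow> w \<in> borel_measurable N"
  by (rule measurable_restrict_space1)

lemma bounded_cut:
  fixes w :: "'a \<Rightarrow> real"
  assumes "bounded (w ` space N)"
  shows "bounded ((\<lambda>x. indicator Y x * w x) ` A)"
proof -
  obtain B where B: "\<And>y. y \<in> Y \<Longrightarrow> \<bar>w y\<bar> \<le> B"
    using assms by (auto simp: bounded_iff space_N)
  have "norm (indicator Y x * w x) \<le> \<bar>B\<bar>" for x
    using B[of x] by (cases "x \<in> Y") auto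
  then show ?thesis by (auto simp: bounded_iff)
qed

text \<open>
  A point that is in \<open>Y\<close> at time \<open>n\<close> has exactly one first return time in \<open>{1..n}\<close>.
\<close>

lemma return_decomposition:
  fixes r :: real
  assumes "1 \<le> n"
  shows "(\<Sum>k = 1..n. indicator {y. \<phi> y = k} y * (indicator Y ((f ^^ n) y) * r)) = indicator Y ((f ^^ n) y) * r"
proof (cases "(f ^^ n) y \<in> Y")
  case True
  then have "\<phi> y \<in> {1..n}" using return_time_le[OF assms] by auto
  then have "(\<Sum>k = 1..n. indicator {y. \<phi> y = k} y * (indicator Y ((f ^^ n) y) * r)) =
      (\<Sum>k\<in>{\<phi> y}. indicator {y. \<phi> y = k} y * (indicator Y ((f ^^ n) y) * r))"
    by (intro sum.mono_neutral_right) (auto simp: indicator_def)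
  then show ?thesis by simp
qed simp

end

section \<open>Transfer operators as renewal operators\<close>

text \<open>
  The recursion \<open>T\<^sub>n = \<Sum>\<^sub>k T\<^sub>n\<^sub>-\<^sub>k R\<^sub>k\<close> for operators on the real space, which carry no
  multiplicative notation; complexification turns it into \<open>renewal_seq\<close>.
\<close>

fun renewal_op :: "(nat \<Rightarrow> 'b \<Rightarrow>\<^sub>L 'b) \<Rightarrow> nat \<Rightarrow> 'b::banach \<Rightarrow>\<^sub>L 'b" where
  "renewal_op R n = (if n = 0 then id_blinfun else (\<Sum>k = 1..n. renewal_op R (n - k) o\<^sub>L R k))"

declare renewal_op.simps [simp del]

lemma cop_of_renewal_op: "cop_of (renewal_op R n) = renewal_seq (\<lambda>n. cop_of (R n)) n"
proof (induction n rule: less_induct)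
  case (less n)
  then show ?case
    by (subst renewal_op.simps, subst renewal_seq.simps)
       (auto simp: cop_of_id cop_of_sum cop_of_compose intro!: sum.cong)
qed

lemma renewal_op_cong: "(\<And>k. 1 \<le> k \<Longrightarrow> R k = R' k) \<Longrightarrow> renewal_op R n = renewal_op R' n"
proof (induction n rule: less_induct)
  case (less n)
  then show ?case
    by (subst (1 2) renewal_op.simps) (auto intro!: sum.cong)
qed

locale first_return_operators = first_return M f Y
  for M :: "'a measure" and f Y +
  fixes L R :: "('a \<Rightarrow> real) \<Rightarrow> ('a \<Rightarrow> real)" and \<iota> :: "'b::banach \<Rightarrow> 'a \<Rightarrow> real"
    and Rn :: "nat \<Rightarrow> 'b \<Rightarrow>\<^sub>L 'b"
  assumes L: "transfer_operator M f L"
    and R: "transfer_operator (restrict_space M Y) (first_return_map f Y) R"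
    and sub: "Linfty_subspace (restrict_space M Y) \<iota>"
    and Rn: "\<And>n. n \<ge> 1 \<Longrightarrow>
        acts_as (restrict_space M Y) \<iota> (\<lambda>v. R (\<lambda>y. indicator {y. first_return_time f Y y = n} y * v y)) (Rn n)"
begin

lemma \<iota>_measurable [measurable]: "\<iota> v \<in> borel_measurable N"
  using sub by (simp add: Linfty_subspace_def)

lemma \<iota>_add: "AE y in N. \<iota> (u + v) y = \<iota> u y + \<iota> v y"
  using sub by (simp add: Linfty_subspace_def)

lemma \<iota>_scaleR: "AE y in N. \<iota> (r *\<^sub>R v) y = r * \<iota> v y"
  using sub by (simp add: Linfty_subspace_def)

lemma \<iota>_inject: "AE y in N. \<iota> u y = \<iota> v y \<Longrightarrow> u = v"
  using sub unfolding Linfty_subspace_def by blast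

lemma \<iota>_bounded: "AE y in N. \<bar>\<iota> v y\<bar> \<le> norm v"
proof -
  have le: "esssup N (\<lambda>y. ereal \<bar>\<iota> v y\<bar>) \<le> ereal (norm v)"
    using sub by (simp add: Linfty_subspace_def)
  show ?thesis
    using esssup_AE[of "\<lambda>y. ereal \<bar>\<iota> v y\<bar>" N]
  proof eventually_elim
    case (elim y)
    then have "ereal \<bar>\<iota> v y\<bar> \<le> ereal (norm v)" using le by (rule order.trans)
    then show ?case by simp
  qed
qed

lemma \<iota>_integrable: "integrable N (\<iota> v)"
  by (rule prob.integrable_const_bound[where B = "norm v"]) (use \<iota>_bounded in auto)

lemma \<iota>_sum: "AE y in N. \<iota> (\<Sum>k\<in>S. g k) y = (\<Sum>k\<in>S. \<iota> (g k) y)"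
proof (induction S rule: infinite_finite_induct)
  case (insert k S)
  from \<iota>_add[of "g k" "\<Sum>k\<in>S. g k"] insert(3) show ?case
    by eventually_elim (simp add: insert(1,2))
next
  case empty
  show ?case using \<iota>_scaleR[of 0 0] by simp
next
  case (infinite S)
  show ?case using \<iota>_scaleR[of 0 0] infinite by simp
qed

lemma return_indicator_measurable [measurable]:
  "(\<lambda>y. indicator {y. \<phi> y = k} y :: real) \<in> borel_measurable N"
proof -
  have "(\<lambda>y. indicator {y \<in> Y. \<phi> y = k} y :: real) \<in> borel_measurable N"
    using return_time_eq_sets[of k] by (intro borel_measurable_indicator) (auto simp: sets_N_iff)
  then show ?thesis
    by (rule measurable_cong[THEN iffD1, rotated]) (simp add: space_N indicator_def)
qed

lemma integrable_mult_bounded: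
  assumes g: "integrable N g" and w: "w \<in> borel_measurable N" "bounded (w ` space N)"
  shows "integrable N (\<lambda>y. g y * w y :: real)"
proof -
  obtain B where B: "\<And>y. y \<in> space N \<Longrightarrow> \<bar>w y\<bar> \<le> B" using w(2) by (auto simp: bounded_iff)
  have [measurable]: "g \<in> borel_measurable N" using g by auto
  note w(1) [measurable]
  show ?thesis
  proof (rule Bochner_Integration.integrable_bound)
    show "integrable N (\<lambda>y. g y * B)" using g by simp
    show "(\<lambda>y. g y * w y) \<in> borel_measurable N" by measurable
    show "AE y in N. norm (g y * w y) \<le> norm (g y * B)"
    proof (rule AE_I2)
      fix y assume "y \<in> space N"
      then have "\<bar>w y\<bar> \<le> \<bar>B\<bar>" using B[of y] by linarith
      then show "norm (g y * w y) \<le> norm (g y * B)" by (simp add: abs_mult mult_left_mono)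
    qed
  qed
qed

lemma restricted_integrable: "integrable N (\<lambda>y. indicator {y. \<phi> y = k} y * \<iota> v y)"
proof -
  have "integrable N (\<lambda>y. \<iota> v y * indicator {y. \<phi> y = k} y)"
    by (rule integrable_mult_bounded[OF \<iota>_integrable return_indicator_measurable])
       (auto simp: bounded_iff indicator_def intro!: exI[of _ 1])
  then show ?thesis by (simp add: mult.commute)
qed

text \<open>
  The dual of \<open>R\<^sub>k\<close>: restrict to \<open>\<phi> = k\<close>, where the first return map is \<open>f\<^sup>k\<close>.
\<close>

lemma Rn_duality:
  assumes k: "1 \<le> k" and w: "w \<in> borel_measurable N" "bounded (w ` space N)"
  shows "(\<integral>y. \<iota> (Rn k v) y * w y \<partial>N) = (\<integral>y. \<iota> v y * (indicator {y. \<phi> y = k} y * w ((f ^^ k) y)) \<partial>N)"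
proof -
  let ?g = "\<lambda>y. indicator {y. \<phi> y = k} y * \<iota> v y"
  have Rg: "integrable N (R ?g)" "(\<integral>y. R ?g y * w y \<partial>N) = (\<integral>y. ?g y * w (first_return_map f Y y) \<partial>N)"
    using R restricted_integrable[of k v] w unfolding transfer_operator_def by blast+
  have [measurable]: "R ?g \<in> borel_measurable N" using Rg(1) by auto
  note w(1) [measurable]
  have "AE y in N. \<iota> (Rn k v) y = R ?g y"
    using Rn[OF k] by (simp add: acts_as_def)
  then have "(\<integral>y. \<iota> (Rn k v) y * w y \<partial>N) = (\<integral>y. R ?g y * w y \<partial>N)"
    by (intro integral_cong_AE) (measurable, auto)
  also have "\<dots> = (\<integral>y. \<iota> v y * (indicator {y. \<phi> y = k} y * w ((f ^^ k) y)) \<partial>N)"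
    unfolding Rg(2) by (intro Bochner_Integration.integral_cong) (auto simp: indicator_def first_return_map_eq)
  finally show ?thesis .
qed

lemma cut_funpow:
  fixes w :: "'a \<Rightarrow> real"
  assumes "w \<in> borel_measurable N" "bounded (w ` space N)"
  defines "w' \<equiv> \<lambda>n y. indicator Y ((f ^^ n) y) * w ((f ^^ n) y)"
  shows "w' n \<in> borel_measurable M" "w' n \<in> borel_measurable N" "bounded (w' n ` A)"
proof -
  note [measurable] = measurable_on_M[OF assms(1)]
  show m: "w' n \<in> borel_measurable M"
    unfolding w'_def by (rule measurable_compose[OF funpow_measurable measurable_on_M[OF assms(1)]])
  then show "w' n \<in> borel_measurable N" by (rule measurable_on_N)
  have "bounded ((\<lambda>x. indicator Y x * w x) ` UNIV)" by (rule bounded_cut[OF assms(2)])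
  then show "bounded (w' n ` A)"
    unfolding w'_def by (rule bounded_subset) auto
qed

text \<open>
  Both sides are split according to the first return time \<open>k \<le> n\<close>: the induction hypothesis
  for \<open>n - k\<close> is applied to \<open>R\<^sub>k v\<close>, and the duality of \<open>R\<^sub>k\<close> moves the test function along the
  first \<open>k\<close> steps of the orbit.
\<close>

lemma renewal_op_duality:
  assumes w: "w \<in> borel_measurable N" "bounded (w ` space N)"
  shows "(\<integral>y. \<iota> (renewal_op Rn n v) y * w y \<partial>N) =
    (\<integral>y. \<iota> v y * (indicator Y ((f ^^ n) y) * w ((f ^^ n) y)) \<partial>N)"
proof (induction n arbitrary: v rule: less_induct)
  case (less n)
  let ?w = "\<lambda>n y. indicator Y ((f ^^ n) y) * w ((f ^^ n) y)"
  note cut = cut_funpow[OF w]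
  note w(1) [measurable]
  show ?case
  proof (cases "n = 0")
    case True
    then show ?thesis
      by (subst renewal_op.simps) (auto intro!: Bochner_Integration.integral_cong simp: space_N)
  next
    case False
    have AE: "AE y in N. \<iota> (renewal_op Rn n v) y = (\<Sum>k = 1..n. \<iota> (renewal_op Rn (n - k) (Rn k v)) y)"
    proof -
      have "renewal_op Rn n v = (\<Sum>k = 1..n. renewal_op Rn (n - k) (Rn k v))"
        using False by (subst renewal_op.simps) (simp add: blinfun.sum_left)
      then show ?thesis using \<iota>_sum[of "\<lambda>k. renewal_op Rn (n - k) (Rn k v)" "{1..n}"] by simp
    qed
    have "(\<integral>y. \<iota> (renewal_op Rn n v) y * w y \<partial>N) =
        (\<integral>y. (\<Sum>k = 1..n. \<iota> (renewal_op Rn (n - k) (Rn k v)) y * w y) \<partial>N)"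
      using AE by (intro integral_cong_AE) (measurable, auto simp: sum_distrib_right)
    also have "\<dots> = (\<Sum>k = 1..n. \<integral>y. \<iota> (renewal_op Rn (n - k) (Rn k v)) y * w y \<partial>N)"
      by (intro Bochner_Integration.integral_sum integrable_mult_bounded \<iota>_integrable w)
    also have "\<dots> = (\<Sum>k = 1..n. \<integral>y. \<iota> v y * (indicator {y. \<phi> y = k} y * ?w n y) \<partial>N)"
    proof (rule sum.cong[OF refl])
      fix k assume k: "k \<in> {1..n}"
      have "(\<integral>y. \<iota> (renewal_op Rn (n - k) (Rn k v)) y * w y \<partial>N) = (\<integral>y. \<iota> (Rn k v) y * ?w (n - k) y \<partial>N)"
        using k by (intro less) auto
      also have "\<dots> = (\<integral>y. \<iota> v y * (indicator {y. \<phi> y = k} y * ?w (n - k) ((f ^^ k) y)) \<partial>N)"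
        using k by (intro Rn_duality cut) auto
      moreover have "(f ^^ (n - k)) ((f ^^ k) y) = (f ^^ n) y" for y
        using k by (simp flip: funpow_add comp_apply[of "f ^^ (n - k)"])
      ultimately show "(\<integral>y. \<iota> (renewal_op Rn (n - k) (Rn k v)) y * w y \<partial>N) =
          (\<integral>y. \<iota> v y * (indicator {y. \<phi> y = k} y * ?w n y) \<partial>N)" by simp
    qed
    also have "\<dots> = (\<integral>y. (\<Sum>k = 1..n. \<iota> v y * (indicator {y. \<phi> y = k} y * ?w n y)) \<partial>N)"
    proof (intro Bochner_Integration.integral_sum[symmetric] integrable_mult_bounded \<iota>_integrable)
      fix k
      note cut(2)[of n, measurable]
      show "(\<lambda>y. indicator {y. \<phi> y = k} y * ?w n y) \<in> borel_measurable N" by measurable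
      obtain B where B: "\<And>y. \<bar>?w n y\<bar> \<le> B" using cut(3)[of n UNIV] by (auto simp: bounded_iff)
      have "norm (indicator {y. \<phi> y = k} y * ?w n y) \<le> \<bar>B\<bar>" for y
        using B[of y] by (cases "\<phi> y = k") auto
      then show "bounded ((\<lambda>y. indicator {y. \<phi> y = k} y * ?w n y) ` space N)"
        by (auto simp: bounded_iff)
    qed
    also have "\<dots> = (\<integral>y. \<iota> v y * ?w n y \<partial>N)"
      using False by (intro Bochner_Integration.integral_cong refl)
        (simp only: sum_distrib_left[symmetric] return_decomposition)
    finally show ?thesis .
  qed
qed

text \<open>
  \<open>1\<^sub>Y L\<^sup>n 1\<^sub>Y\<close> and the renewal operator have the same dual, which determines them up to null
  sets.
\<close>

lemma renewal_op_acts_as: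
  "acts_as N \<iota> (\<lambda>v y. indicator Y y * (L ^^ n) (\<lambda>x. indicator Y x * v x) y) (renewal_op Rn n)"
  unfolding acts_as_def
proof
  fix v
  define g where "g x = indicator Y x * \<iota> v x" for x
  have g: "integrable M g"
    using \<iota>_integrable[of v] integrable_restrict_space[OF Y_inter, of "\<iota> v"] by (simp add: g_def[abs_def])
  note Lg = transfer_operator_funpow[OF L f_measurable g]
  have N_int: "(\<integral>y. h y \<partial>N) = (\<integral>x. indicator Y x * h x \<partial>M)" for h :: "'a \<Rightarrow> real"
    using integral_restrict_space[OF Y_inter, of h] by simp
  have Lint: "integrable N (\<lambda>y. indicator Y y * (L ^^ n) g y)"
  proof -
    have "integrable M (\<lambda>x. indicator Y x *\<^sub>R (indicator Y x * (L ^^ n) g x))"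
    proof -
      have "indicator Y x *\<^sub>R (indicator Y x * r) = indicator Y x *\<^sub>R r" for x :: 'a and r :: real
        by (simp add: indicator_def)
      then show ?thesis using integrable_mult_indicator[OF Y_sets Lg(1)[of n]] by (simp only:)
    qed
    then show ?thesis using integrable_restrict_space[OF Y_inter, of "\<lambda>y. indicator Y y * (L ^^ n) g y"] by simp
  qed
  have "AE y in N. \<iota> (renewal_op Rn n v) y = indicator Y y * (L ^^ n) g y"
  proof (rule AE_eq_of_integral_eq[OF \<iota>_integrable Lint])
    fix w :: "'a \<Rightarrow> real" assume w: "w \<in> borel_measurable N" "bounded (w ` space N)"
    have "(\<integral>y. indicator Y y * (L ^^ n) g y * w y \<partial>N) = (\<integral>x. (L ^^ n) g x * (indicator Y x * w x) \<partial>M)"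
      unfolding N_int by (intro Bochner_Integration.integral_cong) (auto simp: indicator_def)
    also have "\<dots> = (\<integral>x. g x * (indicator Y ((f ^^ n) x) * w ((f ^^ n) x)) \<partial>M)"
      by (rule Lg(2)[OF measurable_on_M[OF w(1)] bounded_cut[OF w(2)]])
    also have "\<dots> = (\<integral>y. \<iota> v y * (indicator Y ((f ^^ n) y) * w ((f ^^ n) y)) \<partial>N)"
      unfolding N_int g_def by (simp add: mult.assoc)
    finally show "(\<integral>y. \<iota> (renewal_op Rn n v) y * w y \<partial>N) = (\<integral>y. indicator Y y * (L ^^ n) g y * w y \<partial>N)"
      using renewal_op_duality[OF w, of n v] by simp
  qed
  then show "AE y in N. \<iota> (renewal_op Rn n v) y = indicator Y y * (L ^^ n) (\<lambda>x. indicator Y x * \<iota> v x) y"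
    by (simp add: g_def[abs_def])
qed

end

section \<open>Asymptotics of the transfer operators\<close>

lemma Rep_cop_scalar_minus: "cscale \<alpha> - Rep_cop A = Rep_cop (cop_scalar \<alpha> - A)"
  by (simp add: minus_cop.rep_eq cop_scalar.rep_eq)

lemma not_in_spectrum_imp_inverse:
  assumes "\<alpha> \<notin> spectrum (Rep_cop A)"
  obtains G where "Rep_cop G = resolvent (Rep_cop A) \<alpha>"
    "G * (cop_scalar \<alpha> - A) = 1" "(cop_scalar \<alpha> - A) * G = 1"
proof -
  obtain S where S: "is_inverse (cscale \<alpha> - Rep_cop A) S"
    using assms by (auto simp: spectrum_def)
  then have res: "resolvent (Rep_cop A) \<alpha> = S"
    unfolding resolvent_def using is_inverse_unique by blast
  show ?thesis
    using is_inverse_cop[OF S[unfolded Rep_cop_scalar_minus]] that unfolding res by metis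
qed

text \<open>
  The integral of the spectral projection is taken among all bounded operators; since the
  resolvents depend continuously on the parameter within the subalgebra, the integral exists
  there and has the same value.
\<close>

lemma spectral_projection_reduced_resolvent:
  assumes "spectral_projection (Rep_cop A) 1 (complexify P)"
  obtains S where "S * (1 - A) = 1 - cop_of P" "cop_of P * A = A * cop_of P"
proof -
  interpret sa: scalar_algebra "cop_scalar :: complex \<Rightarrow> 'a cop" by (rule scalar_algebra_cop)
  obtain r where r: "0 < r" "spectrum (Rep_cop A) \<inter> cball 1 r = {1}"
    and int: "((\<lambda>t. (1 / (2 * pi)) *\<^sub>R
            (cscale (of_real r * cis t) o\<^sub>L resolvent (Rep_cop A) (1 + of_real r * cis t)))
          has_integral complexify P) {0..2 * pi}"
    using assms by (auto simp: spectral_projection_def)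
  have "\<exists>G. Rep_cop G = resolvent (Rep_cop A) (1 + of_real r * cis t) \<and>
      G * (cop_scalar (1 + of_real r * cis t) - A) = 1 \<and> (cop_scalar (1 + of_real r * cis t) - A) * G = 1" for t
  proof -
    have "1 + of_real r * cis t \<in> cball 1 r" "1 + of_real r * cis t \<noteq> 1"
      using r(1) by (auto simp: dist_norm norm_mult)
    then have "1 + of_real r * cis t \<notin> spectrum (Rep_cop A)" using r(2) by blast
    then show ?thesis using not_in_spectrum_imp_inverse by metis
  qed
  then obtain Res where Res: "\<And>t. Rep_cop (Res t) = resolvent (Rep_cop A) (1 + of_real r * cis t)"
    "\<And>t. Res t * (cop_scalar (1 + of_real r * cis t) - A) = 1"
    "\<And>t. (cop_scalar (1 + of_real r * cis t) - A) * Res t = 1"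
    by metis
  have "continuous_on {0..2 * pi} Res"
  proof (rule continuous_on_two_sided_inverse)
    show "continuous_on {0..2 * pi} (\<lambda>t. cop_scalar (1 + of_real r * cis t) - A)"
      by (intro continuous_intros sa.continuous_on_scal)
  qed (rule Res)+
  then have "(\<lambda>t. (1 / (2 * pi)) *\<^sub>R (cop_scalar (of_real r * cis t) * Res t)) integrable_on {0..2 * pi}"
    by (intro integrable_continuous_real continuous_intros sa.continuous_on_scal)
  then obtain J where J: "((\<lambda>t. (1 / (2 * pi)) *\<^sub>R (cop_scalar (of_real r * cis t) * Res t)) has_integral J) {0..2 * pi}"
    by (auto simp: integrable_on_def)
  from has_integral_linear[OF this bounded_linear_Rep_cop]
  have "((\<lambda>t. (1 / (2 * pi)) *\<^sub>R
            (cscale (of_real r * cis t) o\<^sub>L resolvent (Rep_cop A) (1 + of_real r * cis t)))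
          has_integral Rep_cop J) {0..2 * pi}"
    by (simp add: o_def scaleR_cop.rep_eq times_cop.rep_eq cop_scalar.rep_eq Res(1))
  then have "Rep_cop J = Rep_cop (cop_of P)"
    using int by (simp add: cop_of.rep_eq has_integral_unique)
  then have "J = cop_of P" by (simp add: Rep_cop_inject)
  with J have "((\<lambda>t. (1 / (2 * pi)) *\<^sub>R (cop_scalar (of_real r * cis t) * Res t)) has_integral cop_of P) {0..2 * pi}"
    by simp
  from sa.reduced_resolvent[OF Res(2,3) this] show ?thesis using that by blast
qed

lemma bounded_linear_cop_of: "bounded_linear cop_of"
  by (rule bounded_linear_intro[OF cop_of_add cop_of_scaleR, of 2])
     (use norm_cop_of_le in \<open>simp add: mult.commute\<close>)

lemma Rep_gen_cop_of:
  fixes Rn :: "nat \<Rightarrow> 'b::banach \<Rightarrow>\<^sub>L 'b"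
  assumes summ: "summable (\<lambda>n. norm (cop_of (Rn n)))" and R0: "Rn 0 = 0" and z: "cmod z \<le> 1"
  shows "Rep_cop (scalar_algebra.gen cop_scalar (\<lambda>n. cop_of (Rn n)) z) = power_series_operator Rn z"
proof -
  interpret sa: scalar_algebra "cop_scalar :: complex \<Rightarrow> 'b cop" by (rule scalar_algebra_cop)
  have "(\<lambda>n. cop_scalar (z ^ n) * cop_of (Rn n)) sums sa.gen (\<lambda>n. cop_of (Rn n)) z"
    using sa.gen_sums[of "\<lambda>n. cop_of (Rn n)" 1 z] summ z by simp
  then have "(\<lambda>n. cop_scalar (z ^ Suc n) * cop_of (Rn (Suc n))) sums sa.gen (\<lambda>n. cop_of (Rn n)) z"
    by (subst sums_Suc_iff) (simp add: R0 cop_of_0)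
  from bounded_linear.sums[OF bounded_linear_Rep_cop this]
  show ?thesis
    by (simp add: power_series_operator_def times_cop.rep_eq cop_scalar.rep_eq cop_of.rep_eq sums_iff)
qed

context first_return_operators
begin

definition mean :: "'b \<Rightarrow> real" where "mean v = (\<integral>y. \<iota> v y \<partial>N)"

lemma mean_scaleR: "mean (r *\<^sub>R v) = r * mean v"
proof -
  have "mean (r *\<^sub>R v) = (\<integral>y. r * \<iota> v y \<partial>N)"
    unfolding mean_def using \<iota>_scaleR by (intro integral_cong_AE) auto
  then show ?thesis by (simp add: mean_def)
qed

lemma mean_Rn: "1 \<le> k \<Longrightarrow> mean (Rn k v) = (\<integral>y. indicator {y. \<phi> y = k} y * \<iota> v y \<partial>N)"
proof -
  assume k: "1 \<le> k"
  have "bounded ((\<lambda>_. 1 :: real) ` space N)" by (rule boundedI[of _ 1]) auto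
  from Rn_duality[OF k _ this, of v] show ?thesis by (simp add: mean_def mult.commute)
qed

text \<open>
  Almost every point returns, so the sets \<open>\<phi> = n\<close> with \<open>n \<ge> 1\<close> exhaust \<open>Y\<close>. This is the
  invariance of the mean under \<open>R(1)\<close>.
\<close>

lemma mean_Rn_sums: "(\<lambda>n. if n = 0 then 0 else mean (Rn n v)) sums mean v"
proof -
  define s where "s m y = (\<Sum>n<m. if n = 0 then 0 else indicator {y. \<phi> y = n} y * \<iota> v y)" for m y
  have s_eq: "s m y = (if \<phi> y \<noteq> 0 \<and> \<phi> y < m then \<iota> v y else 0)" for m y
  proof -
    have "s m y = (\<Sum>n<m. if n = \<phi> y then (if \<phi> y = 0 then 0 else \<iota> v y) else 0)"
      unfolding s_def by (intro sum.cong) (auto simp: indicator_def)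
    then show ?thesis by simp
  qed
  have int: "integrable N (\<lambda>y. if n = 0 then 0 else indicator {y. \<phi> y = n} y * \<iota> v y)" for n
    using restricted_integrable[of n v] by (cases "n = 0") simp_all
  have "(\<lambda>m. \<integral>y. s m y \<partial>N) \<longlonglongrightarrow> (\<integral>y. \<iota> v y \<partial>N)"
  proof (rule integral_dominated_convergence)
    show "integrable N (\<lambda>y. \<bar>\<iota> v y\<bar>)" using \<iota>_integrable by simp
    show "s m \<in> borel_measurable N" for m
      unfolding s_def[abs_def] using int by (intro borel_measurable_sum) auto
    show "AE y in N. (\<lambda>m. s m y) \<longlonglongrightarrow> \<iota> v y"
      using AE_return
    proof eventually_elim
      case (elim y)
      then have "\<phi> y \<noteq> 0" using return_time_mem(1)[of y] by auto
      then have "\<forall>\<^sub>F m in sequentially. s m y = \<iota> v y"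
        by (intro eventually_sequentiallyI[of "Suc (\<phi> y)"]) (auto simp: s_eq)
      then show ?case by (rule tendsto_eventually)
    qed
    show "AE y in N. norm (s m y) \<le> \<bar>\<iota> v y\<bar>" for m by (simp add: s_eq)
  qed simp
  moreover have "(\<integral>y. s m y \<partial>N) = (\<Sum>n<m. if n = 0 then 0 else mean (Rn n v))" for m
    unfolding s_def using int
    by (subst Bochner_Integration.integral_sum) (auto intro!: sum.cong simp: mean_Rn)
  ultimately show ?thesis by (simp add: sums_def mean_def)
qed

end

theorem theorem9p6:
  fixes M :: "'a measure" and f :: "'a \<Rightarrow> 'a" and Y :: "'a set"
    and L R :: "('a \<Rightarrow> real) \<Rightarrow> ('a \<Rightarrow> real)"
    and \<iota> :: "'b::banach \<Rightarrow> 'a \<Rightarrow> real"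
    and Rn :: "nat \<Rightarrow> 'b \<Rightarrow>\<^sub>L 'b" and P :: "'b \<Rightarrow>\<^sub>L 'b"
    and C c q :: real and H :: "nat \<Rightarrow> real"
  assumes infinite_measure: "emeasure M (space M) = \<infinity>"
    and preserving: "measure_preserving_map M f"
    and conservative: "conservative M f"
    and Y: "Y \<in> sets M" "emeasure M Y = 1"
    and L: "transfer_operator M f L"
    and R: "transfer_operator (restrict_space M Y) (first_return_map f Y) R"
    and B: "Linfty_subspace (restrict_space M Y) \<iota>" "contains_constants (restrict_space M Y) \<iota>"
    and Rn: "\<And>n. n \<ge> 1 \<Longrightarrow>
        acts_as (restrict_space M Y) \<iota> (\<lambda>v. R (\<lambda>y. indicator {y. first_return_time f Y y = n} y * v y)) (Rn n)"
    and H1: "C > 0" "\<And>n. n \<ge> 1 \<Longrightarrow> norm (Rn n) \<le> C * measure M {y \<in> Y. first_return_time f Y y = n}"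
    and H2_i: "simple_isolated_eigenvalue (power_series_operator Rn 1) 1"
    and H2_ii: "\<And>z. norm z \<le> 1 \<Longrightarrow> z \<noteq> 1 \<Longrightarrow> 1 \<notin> spectrum (power_series_operator Rn z)"
    and P: "spectral_projection (power_series_operator Rn 1) 1 (complexify P)"
      "acts_as (restrict_space M Y) \<iota> (\<lambda>v _. \<integral>y. v y \<partial>(restrict_space M Y)) P"
    and tail: "c > 0" "\<And>n. n \<ge> 1 \<Longrightarrow> measure M {y \<in> Y. first_return_time f Y y > n} = c * (1 / real n + H n)"
    and H: "q > 1" "H \<in> O(\<lambda>n. real n powr (-q))"
  shows "\<exists>T :: nat \<Rightarrow> 'b \<Rightarrow>\<^sub>L 'b.
      (\<forall>n. acts_as (restrict_space M Y) \<iota>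
        (\<lambda>v y. indicator Y y * (L ^^ n) (\<lambda>x. indicator Y x * v x) y) (T n)) \<and>
      (\<exists>e :: nat \<Rightarrow> real.
        e \<in> O(\<lambda>n. 1 / (ln (real n))\<^sup>2) \<and>
        (\<lambda>n. norm (ln (real n) *\<^sub>R T n
            - ((1 / c) * (1 - (LINT x:{0..}|lborel. tail_correction c H x) / ln (real n) + e n)) *\<^sub>R P))
          \<in> O(\<lambda>n. sqrt (ln (real n)) / sqrt (real n)))"
proof -
  interpret fr: first_return_operators M f Y L R \<iota> Rn
    by unfold_locales (fact preserving conservative Y L R B Rn)+
  interpret sa: scalar_algebra "cop_scalar :: complex \<Rightarrow> 'b cop" by (rule scalar_algebra_cop)
  let ?N = "restrict_space M Y"
  \<comment> \<open>The values at index \<open>0\<close> are arbitrary in the hypotheses; setting them to \<open>0\<close> allows sums over all indices.\<close>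
  define Rn' where "Rn' n = (if n = 0 then 0 else Rn n)" for n
  define H' where "H' n = (if n = 0 then 0 else H n)" for n
  define R' where "R' n = cop_of (Rn' n)" for n
  have H'_bigo: "H' \<in> O(\<lambda>n. real n powr (-q))"
  proof -
    have "\<forall>\<^sub>F n in sequentially. H' n = H n"
      using eventually_gt_at_top[of 0] by eventually_elim (simp add: H'_def)
    then show ?thesis using H(2) by (simp add: landau_o.big.in_cong)
  qed
  have rt: "renewal_tail fr.rt_prob c q H'"
  proof
    show "0 \<le> fr.rt_prob n" for n by (simp add: fr.rt_prob_def)
    show "fr.rt_prob 0 = 0" by (simp add: fr.rt_prob_def)
    show tl: "1 - (\<Sum>k\<le>n. fr.rt_prob k) = c * (1 / real n + H' n)" if "0 < n" for n
      using tail(2)[of n] that by (simp add: fr.rt_prob_tail H'_def)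
    show "fr.rt_prob sums 1"
    proof -
      have "(\<lambda>n. real n powr (-q)) \<in> o(\<lambda>_. 1)" using H(1) by real_asymp
      from smalloD_tendsto[OF landau_o.big_small_trans[OF H'_bigo this]] have "H' \<longlonglongrightarrow> 0"
        by simp
      then have "(\<lambda>n. 1 - c * (1 / real n + H' n)) \<longlonglongrightarrow> 1 - c * (0 + 0)"
        by (intro tendsto_intros lim_1_over_n)
      then have "(\<lambda>n. 1 - c * (1 / real n + H' n)) \<longlonglongrightarrow> 1" by simp
      moreover have "\<forall>\<^sub>F n in sequentially. 1 - c * (1 / real n + H' n) = (\<Sum>k\<le>n. fr.rt_prob k)"
        using eventually_gt_at_top[of 0]
      proof eventually_elim
        case (elim n)
        then show ?case using tl[of n] by linarith
      qed
      ultimately show ?thesis unfolding sums_def_le by (rule Lim_transform_eventually)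
    qed
  qed (use tail(1) H(1) H'_bigo in \<open>simp_all add: H'_def\<close>)
  obtain one where one: "AE y in ?N. \<iota> one y = 1"
    using B(2) by (auto simp: contains_constants_def)
  have mean_one: "fr.mean one = 1"
  proof -
    have "fr.mean one = (\<integral>y. 1 \<partial>?N)"
      unfolding fr.mean_def using one by (intro integral_cong_AE) auto
    then show ?thesis using fr.prob.prob_space by simp
  qed
  \<comment> \<open>\<open>P\<close> has rank one, with the constant function \<open>1\<close> spanning its range.\<close>
  have P_eq: "blinfun_apply P v = fr.mean v *\<^sub>R one" for v
  proof (rule fr.\<iota>_inject)
    have "AE y in ?N. \<iota> (blinfun_apply P v) y = fr.mean v"
      using P(2) by (simp add: acts_as_def fr.mean_def)
    then show "AE y in ?N. \<iota> (blinfun_apply P v) y = \<iota> (fr.mean v *\<^sub>R one) y"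
      using fr.\<iota>_scaleR[of "fr.mean v" one] one by eventually_elim simp
  qed
  have mean_Rn_one: "fr.mean (Rn n one) = fr.rt_prob n" if "1 \<le> n" for n
  proof -
    have "fr.mean (Rn n one) = (\<integral>y. indicator {y. fr.\<phi> y = n} y * \<iota> one y \<partial>?N)"
      using that by (rule fr.mean_Rn)
    also have "\<dots> = (\<integral>y. indicator {y \<in> Y. fr.\<phi> y = n} y \<partial>?N)"
    proof (rule integral_cong_AE)
      show "(\<lambda>y. indicator {y. fr.\<phi> y = n} y * \<iota> one y) \<in> borel_measurable ?N" by measurable
      show "(\<lambda>y. indicator {y \<in> Y. fr.\<phi> y = n} y :: real) \<in> borel_measurable ?N"
        using fr.return_time_eq_sets[of n] by (intro borel_measurable_indicator) (auto simp: fr.sets_N_iff)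
      show "AE y in ?N. indicator {y. fr.\<phi> y = n} y * \<iota> one y = indicator {y \<in> Y. fr.\<phi> y = n} y"
        using one AE_space[of ?N] by eventually_elim (simp add: indicator_def fr.space_N)
    qed
    also have "\<dots> = measure ?N {y \<in> Y. fr.\<phi> y = n}"
      by (simp add: fr.space_N Int_absorb2 subset_eq)
    also have "\<dots> = fr.rt_prob n"
      using that by (subst fr.measure_N) (auto simp: fr.rt_prob_def)
    finally show ?thesis .
  qed
  have R'_bound: "norm (R' n) \<le> (2 * C) * fr.rt_prob n" for n
  proof (cases "n = 0")
    case False
    then have "norm (Rn n) \<le> C * fr.rt_prob n" using H1(2)[of n] by (simp add: fr.rt_prob_def)
    then show ?thesis
      using False norm_cop_of_le[of "Rn n"] by (simp add: R'_def Rn'_def)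
  qed (simp add: R'_def Rn'_def cop_of_0 fr.rt_prob_def)
  have summable_rt: "summable fr.rt_prob"
    using renewal_tail.f_sums[OF rt] by (rule sums_summable)
  have summable_R': "summable (\<lambda>n. norm (R' n))"
  proof (rule summable_comparison_test')
    show "summable (\<lambda>n. (2 * C) * fr.rt_prob n)" by (intro summable_mult summable_rt)
    show "norm (norm (R' n)) \<le> (2 * C) * fr.rt_prob n" for n using R'_bound[of n] by simp
  qed
  have pso_eq: "power_series_operator Rn' z = power_series_operator Rn z" for z
    by (simp add: power_series_operator_def Rn'_def)
  have Rep_gen: "Rep_cop (sa.gen R' z) = power_series_operator Rn z" if "cmod z \<le> 1" for z
    using Rep_gen_cop_of[of Rn' z] summable_R' that
    by (simp add: R'_def[abs_def] pso_eq) (simp add: Rn'_def)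
  obtain S1 where S1: "S1 * (1 - sa.gen R' 1) = 1 - cop_of P" "cop_of P * sa.gen R' 1 = sa.gen R' 1 * cop_of P"
    using spectral_projection_reduced_resolvent[of "sa.gen R' 1" P] P(1) Rep_gen[of 1] by auto
  have PR: "cop_of P * sa.gen R' 1 = cop_of P"
  proof -
    have PRn: "(\<lambda>n. P o\<^sub>L Rn' n) sums (\<Sum>n. P o\<^sub>L Rn' n)"
    proof (rule summable_sums, rule summable_norm_cancel, rule summable_comparison_test')
      show "summable (\<lambda>n. norm P * (C * fr.rt_prob n))" by (intro summable_mult summable_rt)
      fix n
      have "norm (Rn' n) \<le> C * fr.rt_prob n"
        using H1(2)[of n] by (simp add: Rn'_def fr.rt_prob_def)
      then show "norm (norm (P o\<^sub>L Rn' n)) \<le> norm P * (C * fr.rt_prob n)"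
        using norm_blinfun_compose[of P "Rn' n"] mult_left_mono[of "norm (Rn' n)" _ "norm P"]
        by (simp add: order.trans)
    qed
    have "(\<Sum>n. P o\<^sub>L Rn' n) = P"
    proof (rule blinfun_eqI)
      fix v :: 'b
      have "bounded_linear (\<lambda>A :: 'b \<Rightarrow>\<^sub>L 'b. blinfun_apply A v)" by (rule blinfun.bounded_linear_left)
      from bounded_linear.sums[OF this PRn]
      have "(\<lambda>n. fr.mean (Rn' n v) *\<^sub>R one) sums blinfun_apply (\<Sum>n. P o\<^sub>L Rn' n) v"
        by (simp add: P_eq)
      moreover have "(\<lambda>n. fr.mean (Rn' n v) *\<^sub>R one) sums (fr.mean v *\<^sub>R one)"
      proof -
        have "fr.mean (Rn' n v) = (if n = 0 then 0 else fr.mean (Rn n v))" for n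
          using fr.mean_scaleR[of 0 0] by (simp add: Rn'_def)
        then show ?thesis
          using sums_scaleR_left[OF fr.mean_Rn_sums[of v], of one] by simp
      qed
      ultimately show "blinfun_apply (\<Sum>n. P o\<^sub>L Rn' n) v = blinfun_apply P v"
        unfolding P_eq by (rule sums_unique2)
    qed
    with PRn have "(\<lambda>n. P o\<^sub>L Rn' n) sums P" by simp
    from bounded_linear.sums[OF bounded_linear_cop_of this]
    have 1: "(\<lambda>n. cop_of P * R' n) sums cop_of P"
      by (simp add: cop_of_compose R'_def)
    have "(\<lambda>n. cop_scalar (1 ^ n) * R' n) sums sa.gen R' 1"
      using sa.gen_sums[of R' 1 1] summable_R' by simp
    then have "(\<lambda>n. cop_of P * R' n) sums (cop_of P * sa.gen R' 1)"
      by (intro sums_mult) (simp add: sa.scal_1)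
    with 1 show ?thesis by (metis sums_unique2)
  qed
  interpret op: operator_renewal cop_scalar fr.rt_prob c q H' R' "cop_of P" S1 "2 * C"
  proof (intro operator_renewal.intro operator_renewal_axioms.intro)
    show "R' 0 = 0" by (simp add: R'_def Rn'_def cop_of_0)
    show "norm (R' n) \<le> 2 * C * fr.rt_prob n" for n by (rule R'_bound)
    have "P o\<^sub>L P = P" by (rule blinfun_eqI) (simp add: P_eq fr.mean_scaleR mean_one)
    then show "cop_of P * cop_of P = cop_of P" by (simp flip: cop_of_compose)
    show "cop_of P \<noteq> 0"
    proof
      assume "cop_of P = 0"
      then have "P = 0" using norm_le_norm_cop_of[of P] by simp
      then have "one = 0" using P_eq[of one] mean_one by simp
      then show False using mean_one fr.mean_scaleR[of 0 0] by simp
    qed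
    show "cop_of P * R' n * cop_of P = fr.rt_prob n *\<^sub>R cop_of P" for n
    proof (cases "n = 0")
      case False
      then have "P o\<^sub>L Rn n o\<^sub>L P = fr.rt_prob n *\<^sub>R P"
        by (intro blinfun_eqI)
           (simp add: P_eq blinfun.scaleR_right blinfun.scaleR_left fr.mean_scaleR mean_Rn_one)
      then show ?thesis
        using False by (simp add: R'_def Rn'_def flip: cop_of_compose cop_of_scaleR)
    qed (simp add: R'_def Rn'_def cop_of_0 fr.rt_prob_def)
    show "cop_of P * sa.gen R' 1 = cop_of P" by (rule PR)
    show "sa.gen R' 1 * cop_of P = cop_of P" using PR S1(2) by simp
    show "S1 * (1 - sa.gen R' 1) = 1 - cop_of P" by (rule S1(1))
    show "\<exists>G. G * (1 - sa.gen R' z) = 1 \<and> (1 - sa.gen R' z) * G = 1" if z: "cmod z \<le> 1" "z \<noteq> 1" for z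
    proof -
      have "1 \<notin> spectrum (Rep_cop (sa.gen R' z))"
        using H2_ii[OF z] Rep_gen[OF z(1)] by simp
      then show ?thesis using not_in_spectrum_imp_inverse[of 1 "sa.gen R' z"] by (metis sa.scal_1)
    qed
  qed (rule scalar_algebra_cop rt)+
  define T where "T = renewal_op Rn"
  have T_eq: "op.T n = cop_of (T n)" for n
  proof -
    have "renewal_op Rn n = renewal_op Rn' n" by (rule renewal_op_cong) (simp add: Rn'_def)
    then show ?thesis by (simp add: T_def cop_of_renewal_op R'_def[abs_def])
  qed
  have T_bigo: "(\<lambda>n. norm (T n - op.u n *\<^sub>R P)) \<in> O(\<lambda>n. 1 / sqrt (real n * ln (real n)))"
  proof (rule landau_o.big_trans[OF _ op.renewal_seq_approx])
    show "(\<lambda>n. norm (T n - op.u n *\<^sub>R P)) \<in> O(\<lambda>n. norm (op.T n - op.u n *\<^sub>R cop_of P))"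
      by (intro landau_o.big_mono always_eventually)
         (simp add: T_eq norm_le_norm_cop_of flip: cop_of_scaleR cop_of_diff)
  qed
  define I where "I = (LINT x:{0..}|lborel. tail_correction c H x)"
  have I_eq: "I = op.log_shift"
  proof -
    have summ: "summable (\<lambda>n. \<bar>H' n\<bar>)" by (rule op.summable_abs_H)
    have "summable (\<lambda>n. \<bar>H n\<bar>)"
      using summ summable_Suc_iff[of "\<lambda>n. \<bar>H' n\<bar>"] summable_Suc_iff[of "\<lambda>n. \<bar>H n\<bar>"] by (simp add: H'_def)
    then have "I = 1 / c + euler_mascheroni + (\<Sum>n. H (Suc n))"
      unfolding I_def by (rule integral_tail_correction)
    also have "(\<Sum>n. H (Suc n)) = suminf H'"
      using suminf_split_head[OF op.summable_H] by (simp add: H'_def)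
    finally show ?thesis by (simp add: op.log_shift_def)
  qed
  \<comment> \<open>With this choice the bracket in the statement is exactly \<open>c u\<^sub>n log n\<close>, and only the operator error remains.\<close>
  define e where "e n = c * ln (real n) * op.u n - 1 + I / ln (real n)" for n
  have e: "e \<in> O(\<lambda>n. 1 / (ln (real n))\<^sup>2)"
    unfolding e_def I_eq by (rule op.u_asymptotics)
  have "(\<lambda>n. norm (ln (real n) *\<^sub>R T n - ((1 / c) * (1 - I / ln (real n) + e n)) *\<^sub>R P))
      \<in> O(\<lambda>n. sqrt (ln (real n)) / sqrt (real n))"
  proof -
    have "norm (ln (real n) *\<^sub>R T n - ((1 / c) * (1 - I / ln (real n) + e n)) *\<^sub>R P) =
        \<bar>ln (real n)\<bar> * norm (T n - op.u n *\<^sub>R P)" for n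
    proof -
      have "(1 / c) * (1 - I / ln (real n) + e n) = ln (real n) * op.u n"
        using tail(1) by (simp add: e_def)
      then have "ln (real n) *\<^sub>R T n - ((1 / c) * (1 - I / ln (real n) + e n)) *\<^sub>R P =
          ln (real n) *\<^sub>R (T n - op.u n *\<^sub>R P)"
        by (simp add: scaleR_diff_right)
      then show ?thesis by simp
    qed
    moreover have "(\<lambda>n. \<bar>ln (real n)\<bar> * norm (T n - op.u n *\<^sub>R P)) \<in>
        O(\<lambda>n. ln (real n) * (1 / sqrt (real n * ln (real n))))"
      by (intro landau_o.big.mult T_bigo) simp
    moreover have "(\<lambda>n. ln (real n) * (1 / sqrt (real n * ln (real n)))) \<in> O(\<lambda>n. sqrt (ln (real n)) / sqrt (real n))"
      by real_asymp
    ultimately show ?thesis by (simp add: landau_o.big_trans)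
  qed
  then show ?thesis
    using fr.renewal_op_acts_as e by (intro exI[of _ T] conjI exI[of _ e] allI) (simp_all add: T_def I_def)
qed

end
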